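(* Let $\Omega\subset\mathbb{R}^d$ be a bounded smooth domain, let $s$ satisfy (s1)–(s2) and $c$ satisfy (c1)–(c3) (see context). Let $\rho_0,\rho_1\in X$ both satisfy condition (N), and let \[ \rho_i^*=\operatorname{argmin}_{\rho\in X} J(\rho,\rho_i),\qquad i=0,1 . \] Then \[ \|(\rho_1^*-\rho_0^* )_+\|_{L^1(\Omega)}\le \|(\rho_1-\rho_0)_+\|_{L^1(\Omega)} . \]
   Context: $\Omega\subset\mathbb{R}^d$ is a bounded smooth (open, connected) domain. The energy density $s:\mathbb{R}\times\Omega\to\mathbb{R}\cup\{+\infty\}$ satisfies: (s1) for every $x\in\Omega$, $s(\cdot,x)$ is proper, lower semicontinuous and convex; (s2) $s(z,x)=+\infty$ for $z<0$, $s(0,x)=0$, $\inf_{(z,x)\in\mathbb{R}\times\Omega}s(z,x)>-\infty$, and $\lim_{z\to+\infty}\inf_{x\in\Omega}s(z,x)/z=+\infty$. Set $s^*(p,x)=\sup_{z\in\mathbb{R}}(pz-s(z,x))$; $\partial s(z,x)$, $\partial s^*(p,x)$ denote subdifferentials in the first variable. $E(\rho)=\int_\Omega s(\rho(x),x)\,dx$, $E^*(p)=\int_\Omega s^*(p(x),x)\,dx$, $X=\{\rho\in L^1(\Omega):E(\rho)<\infty\}$. The cost $c:\mathbb{R}^d\times\mathbb{R}^d\to[0,\infty)$ satisfies (c1) $c(x,y)=c(y,x)$, $c(x,x)=0$; (c2) $c\in C^1_{loc}$; (c3) for every $x_0$, $y\mapsto\nabla_x c(x_0,y)$ is injective on $\mathbb{R}^d$.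 For nonnegative measures $\mu,\nu$ on $\Omega$, $C(\mu,\nu)=\inf_{\pi\in\Pi(\mu,\nu)}\int_{\Omega\times\Omega}c\,d\pi$, where $\Pi(\mu,\nu)$ is the set of nonnegative measures on $\Omega\times\Omega$ with marginals $\mu,\nu$ (so $C=+\infty$ if the masses differ). $J(\rho,\bar\rho)=E(\rho)+C(\rho,\bar\rho)$. Condition (N) on $\bar\rho\in X$: $0<\int_\Omega\bar\rho\,dx<\lim_{b\to\infty}\int_\Omega\sup\partial s^*(b,x)\,dx$. (Under these assumptions the minimizer $\rho_i^*$ exists and is unique.) *)

theory Defs
  imports "HOL-Analysis.Analysis"
begin

inductive iter_deriv :: "('a::euclidean_space \<Rightarrow> real) \<Rightarrow> ('a \<Rightarrow> real) \<Rightarrow> bool"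
  for f where
  base: "iter_deriv f f"
| step: "iter_deriv f g \<Longrightarrow> iter_deriv f (\<lambda>x. frechet_derivative g (at x) v)"

definition smooth_fun :: "('a::euclidean_space \<Rightarrow> real) \<Rightarrow> bool" where
  "smooth_fun f \<longleftrightarrow> (\<forall>g. iter_deriv f g \<longrightarrow> (\<forall>x. g differentiable (at x)))"

text \<open>Bounded smooth domain: open, connected, bounded, with a C-infinity boundary given
  by a global defining function with nonvanishing gradient on the boundary.\<close>
definition smooth_bounded_domain :: "'a::euclidean_space set \<Rightarrow> bool" where
  "smooth_bounded_domain \<Omega> \<longleftrightarrow> open \<Omega> \<and> connected \<Omega> \<and> \<Omega> \<noteq> {} \<and> bounded \<Omega> \<and>
     (\<exists>\<phi>. smooth_fun \<phi> \<and> \<Omega> = {x. \<phi> x < 0} \<and>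
          (\<forall>x. \<phi> x = 0 \<longrightarrow> frechet_derivative \<phi> (at x) \<noteq> (\<lambda>h. 0)))"

definition proper_ereal :: "(real \<Rightarrow> ereal) \<Rightarrow> bool" where
  "proper_ereal f \<longleftrightarrow> (\<exists>z. f z < \<infinity>) \<and> (\<forall>z. f z > -\<infinity>)"

definition lsc_ereal :: "(real \<Rightarrow> ereal) \<Rightarrow> bool" where
  "lsc_ereal f \<longleftrightarrow> (\<forall>z. f z \<le> Liminf (at z) f)"

definition convex_ereal :: "(real \<Rightarrow> ereal) \<Rightarrow> bool" where
  "convex_ereal f \<longleftrightarrow> (\<forall>z w t. 0 \<le> t \<and> t \<le> 1 \<longrightarrow>
      f ((1 - t) * z + t * w) \<le> ereal (1 - t) * f z + ereal t * f w)"

definition conj_s :: "(real \<Rightarrow> 'a \<Rightarrow> ereal) \<Rightarrow> real \<Rightarrow> 'a \<Rightarrow> ereal" where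
  "conj_s s p x = (SUP z. ereal (p * z) - s z x)"

definition subdiff :: "(real \<Rightarrow> ereal) \<Rightarrow> real \<Rightarrow> real set" where
  "subdiff f z = {q. f z < \<infinity> \<and> (\<forall>w. f w \<ge> f z + ereal (q * (w - z)))}"

definition energy :: "'a::euclidean_space set \<Rightarrow> (real \<Rightarrow> 'a \<Rightarrow> ereal) \<Rightarrow> ('a \<Rightarrow> real) \<Rightarrow> ereal" where
  "energy \<Omega> s \<rho> =
     enn2ereal (\<integral>\<^sup>+ x. e2ennreal (max (s (\<rho> x) x) 0) * indicator \<Omega> x \<partial>lborel)
   - enn2ereal (\<integral>\<^sup>+ x. e2ennreal (max (- s (\<rho> x) x) 0) * indicator \<Omega> x \<partial>lborel)"

definition Xset :: "'a::euclidean_space set \<Rightarrow> (real \<Rightarrow> 'a \<Rightarrow> ereal) \<Rightarrow> ('a \<Rightarrow> real) set" where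
  "Xset \<Omega> s = {\<rho>. set_integrable lborel \<Omega> \<rho> \<and> energy \<Omega> s \<rho> < \<infinity>}"

definition couplings :: "'a::euclidean_space set \<Rightarrow> ('a \<Rightarrow> real) \<Rightarrow> ('a \<Rightarrow> real) \<Rightarrow> ('a \<times> 'a) measure set" where
  "couplings \<Omega> \<rho> \<sigma> = {\<pi>.
     sets \<pi> = sets (restrict_space borel \<Omega> \<Otimes>\<^sub>M restrict_space borel \<Omega>) \<and>
     (\<forall>A \<in> sets (restrict_space borel \<Omega>).
        emeasure \<pi> (A \<times> \<Omega>) = (\<integral>\<^sup>+ x. ennreal (\<rho> x) * indicator A x \<partial>lborel) \<and>
        emeasure \<pi> (\<Omega> \<times> A) = (\<integral>\<^sup>+ x. ennreal (\<sigma> x) * indicator A x \<partial>lborel))}"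

definition transport_cost :: "'a::euclidean_space set \<Rightarrow> ('a \<Rightarrow> 'a \<Rightarrow> real) \<Rightarrow> ('a \<Rightarrow> real) \<Rightarrow> ('a \<Rightarrow> real) \<Rightarrow> ennreal" where
  "transport_cost \<Omega> c \<rho> \<sigma> = (INF \<pi> \<in> couplings \<Omega> \<rho> \<sigma>. \<integral>\<^sup>+ p. ennreal (c (fst p) (snd p)) \<partial>\<pi>)"

definition Jfun :: "'a::euclidean_space set \<Rightarrow> (real \<Rightarrow> 'a \<Rightarrow> ereal) \<Rightarrow> ('a \<Rightarrow> 'a \<Rightarrow> real) \<Rightarrow> ('a \<Rightarrow> real) \<Rightarrow> ('a \<Rightarrow> real) \<Rightarrow> ereal" where
  "Jfun \<Omega> s c \<rho> \<sigma> = energy \<Omega> s \<rho> + enn2ereal (transport_cost \<Omega> c \<rho> \<sigma>)"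

definition is_minimizer :: "'a::euclidean_space set \<Rightarrow> (real \<Rightarrow> 'a \<Rightarrow> ereal) \<Rightarrow> ('a \<Rightarrow> 'a \<Rightarrow> real) \<Rightarrow> ('a \<Rightarrow> real) \<Rightarrow> ('a \<Rightarrow> real) \<Rightarrow> bool" where
  "is_minimizer \<Omega> s c \<sigma> \<rho>s \<longleftrightarrow> \<rho>s \<in> Xset \<Omega> s \<and> (\<forall>\<rho> \<in> Xset \<Omega> s. Jfun \<Omega> s c \<rho>s \<sigma> \<le> Jfun \<Omega> s c \<rho> \<sigma>)"

definition energy_density_ok :: "'a::euclidean_space set \<Rightarrow> (real \<Rightarrow> 'a \<Rightarrow> ereal) \<Rightarrow> bool" where
  "energy_density_ok \<Omega> s \<longleftrightarrow>
     (\<forall>x\<in>\<Omega>. proper_ereal (\<lambda>z. s z x) \<and> lsc_ereal (\<lambda>z. s z x) \<and> convex_ereal (\<lambda>z. s z x)) \<and>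
     (\<forall>x\<in>\<Omega>. (\<forall>z<0. s z x = \<infinity>) \<and> s 0 x = 0) \<and>
     (\<exists>M::real. \<forall>z. \<forall>x\<in>\<Omega>. ereal M \<le> s z x) \<and>
     ((\<lambda>z. INF x\<in>\<Omega>. s z x / ereal z) \<longlongrightarrow> \<infinity>) at_top"

definition cost_ok :: "('a::euclidean_space \<Rightarrow> 'a \<Rightarrow> real) \<Rightarrow> bool" where
  "cost_ok c \<longleftrightarrow>
     (\<forall>x y. c x y \<ge> 0) \<and> (\<forall>x y. c x y = c y x) \<and> (\<forall>x. c x x = 0) \<and>
     (\<exists>D. (\<forall>p. ((\<lambda>q. c (fst q) (snd q)) has_derivative blinfun_apply (D p)) (at p)) \<and>
          continuous_on UNIV D) \<and>
     (\<forall>x0. inj (\<lambda>y. frechet_derivative (\<lambda>x. c x y) (at x0)))"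

definition condN :: "'a::euclidean_space set \<Rightarrow> (real \<Rightarrow> 'a \<Rightarrow> ereal) \<Rightarrow> ('a \<Rightarrow> real) \<Rightarrow> bool" where
  "condN \<Omega> s \<sigma> \<longleftrightarrow>
     0 < (\<integral>\<^sup>+ x. ennreal (\<sigma> x) * indicator \<Omega> x \<partial>lborel) \<and>
     (\<integral>\<^sup>+ x. ennreal (\<sigma> x) * indicator \<Omega> x \<partial>lborel) <
       Lim at_top (\<lambda>b::real. \<integral>\<^sup>+ x. e2ennreal (Sup (ereal ` subdiff (\<lambda>p. conj_s s p x) b))
                                      * indicator \<Omega> x \<partial>lborel)"

end

theory Submission
  imports Defs "HOL-Probability.Probability"
begin

text \<open>Let \<open>p0\<close>, \<open>p1\<close> be optimal plans between the minimizers \<open>\<rho>0s\<close>, \<open>\<rho>1s\<close> and the data \<open>\<rho>0\<close>, \<open>\<rho>1\<close>.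
  Exchanging \<open>\<rho>0s\<close> and \<open>\<rho>1s\<close> over a Borel set preserves the total energy, so by minimality it cannot lower
  the total cost; by approximation, neither can an exchange of fractions of the excesses \<open>(\<rho>1s - \<rho>0s)\<^sub>+\<close> and
  \<open>(\<rho>0s - \<rho>1s)\<^sub>+\<close>. Send the relative excess of \<open>\<rho>1s\<close> forth along \<open>p1\<close>, back along \<open>p0\<close>, and so on with
  damping; let \<open>f\<close> and \<open>u\<close> be the resulting densities on the two marginals, and \<open>g\<close>, \<open>v\<close> those obtained from the excess of
  \<open>\<rho>0s\<close> with the plans interchanged. Moving multiples of the pieces \<open>f v p1\<close> and \<open>g u p0\<close> from one plan to the other keeps the
  total cost and the second marginals, and changes the first marginals by fractions of the excesses only. Hence the
  new plans are optimal. By the twist condition an optimal plan is the graph of a map over its second marginal, so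
  the two pieces have the same first marginal, and this forces \<open>f = 0\<close> almost everywhere on \<open>{\<rho>0s > \<rho>1s}\<close>. With \<open>S = {f > 0}\<close> and
  \<open>H = {u > 0}\<close>, the plan \<open>p1\<close> carries \<open>S\<close> into \<open>H\<close> and all that \<open>p0\<close> carries into \<open>H\<close> comes from \<open>S\<close>, whence the positive
  part of \<open>\<rho>1s - \<rho>0s\<close> has integral \<open>\<integral>\<^sub>S (\<rho>1s - \<rho>0s) \<le> \<integral>\<^sub>H (\<rho>1 - \<rho>0)\<close>.\<close>

section \<open>Measures on products and their marginals\<close>

text \<open>Comparing the energies of mixtures would mean adding lower integrals of integrands that
  may be nonmeasurable in x, and these are not additive. Exchanges over Borel sets need additivity
  over sets only; hence the detour through them. Why equal first marginals force f to vanish: let F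
  and G be the relative excesses of \<open>\<rho>1s\<close> and \<open>\<rho>0s\<close>, m the sum
  of both minimizers, f' and g' the densities after a round trip, so that f = F + f'/2 and g = G +
  g'/2. The two pieces have second marginals of the same density u v, and first marginals f g' m and
  g f' m. Where G > 0 we have F = 0, so f = f'/2 and f G m + f g' m / 2 = f g m = g f' m / 2. If the
  first marginals agree, f G m = 0 follows. The damping 1/2 bounds f, g, u, v by 2, so the weights f
  v and g u are at most 4, and exchanging an eighth of a piece removes at most half of a plan. What
  is left has the same null sets as the old plan. Optimality of the new plan therefore constrains
  the old plan together with the piece brought in.\<close>

lemma fst_borel [measurable]:
  "(fst :: 'a::second_countable_topology \<times> 'b::second_countable_topology \<Rightarrow> 'a) \<in> borel \<rightarrow>\<^sub>M borel"
  by (intro borel_measurable_continuous_onI continuous_on_fst continuous_on_snd continuous_on_id)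

lemma snd_borel [measurable]:
  "(snd :: 'a::second_countable_topology \<times> 'b::second_countable_topology \<Rightarrow> 'b) \<in> borel \<rightarrow>\<^sub>M borel"
  by (intro borel_measurable_continuous_onI continuous_on_fst continuous_on_snd continuous_on_id)

lemma Times_borel [measurable]:
  fixes A :: "'a::second_countable_topology set" and B :: "'b::second_countable_topology set"
  shows "A \<in> sets borel \<Longrightarrow> B \<in> sets borel \<Longrightarrow> A \<times> B \<in> sets borel"
  by (metis borel_prod pair_measureI)

text \<open>A finite sum of measures. The sigma-algebra is fixed as \<open>borel\<close> rather than
  read off the summands, so that \<open>sets_msum\<close> holds without assumptions on
  \<open>M\<close>.\<close>

definition msum :: "'i set \<Rightarrow> ('i \<Rightarrow> 'a::topological_space measure) \<Rightarrow> 'a measure" where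
  "msum I M = measure_of UNIV (sets borel) (\<lambda>A. \<Sum>i\<in>I. emeasure (M i) A)"

lemma space_msum [simp]: "space (msum I M) = UNIV"
  and sets_msum [simp, measurable_cong]: "sets (msum I M) = sets borel"
proof -
  have s: "sets (borel :: 'a measure) \<subseteq> Pow UNIV" by auto
  have "sigma_algebra UNIV (sets (borel :: 'a measure))"
    by (metis sets.sigma_algebra_axioms space_borel)
  then have e: "sigma_sets UNIV (sets (borel :: 'a measure)) = sets borel"
    by (rule sigma_algebra.sigma_sets_eq)
  show "space (msum I M) = UNIV" unfolding msum_def using s by (simp add: space_measure_of)
  show "sets (msum I M) = sets borel" unfolding msum_def using s e by (simp add: sets_measure_of)
qed

lemma emeasure_msum:
  fixes M :: "'i \<Rightarrow> 'a::topological_space measure"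
  assumes "\<And>i. i \<in> I \<Longrightarrow> sets (M i) = sets borel" and "A \<in> sets borel"
  shows "emeasure (msum I M) A = (\<Sum>i\<in>I. emeasure (M i) A)"
  unfolding msum_def
proof (rule emeasure_measure_of_sigma)
  show "sigma_algebra UNIV (sets (borel :: 'a measure))"
    by (metis sets.sigma_algebra_axioms space_borel)
  show "positive (sets borel) (\<lambda>A. \<Sum>i\<in>I. emeasure (M i) A)"
    by (simp add: positive_def)
  show "countably_additive (sets borel) (\<lambda>A. \<Sum>i\<in>I. emeasure (M i) A)"
    unfolding countably_additive_def
  proof safe
    fix F :: "nat \<Rightarrow> 'a set" assume F: "range F \<subseteq> sets borel" "disjoint_family F"
    have "(\<Sum>n. \<Sum>i\<in>I. emeasure (M i) (F n)) = (\<Sum>i\<in>I. \<Sum>n. emeasure (M i) (F n))"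
      by (rule suminf_sum) simp
    also have "\<dots> = (\<Sum>i\<in>I. emeasure (M i) (\<Union>n. F n))"
      using F assms(1) by (intro sum.cong refl suminf_emeasure) auto
    finally show "(\<Sum>n. \<Sum>i\<in>I. emeasure (M i) (F n)) = (\<Sum>i\<in>I. emeasure (M i) (\<Union>(range F)))" .
  qed
qed (use assms in auto)

lemma nn_integral_msum:
  assumes "\<And>i. i \<in> I \<Longrightarrow> sets (M i) = sets borel" and "f \<in> borel_measurable borel"
  shows "(\<integral>\<^sup>+x. f x \<partial>msum I M) = (\<Sum>i\<in>I. \<integral>\<^sup>+x. f x \<partial>M i)"
  using assms(2)
proof (induction rule: borel_measurable_induct)
  case (cong f g) then show ?case by (simp add: fun_eq_iff)
next
  case (set A)
  then show ?case using assms(1) by (simp add: emeasure_msum)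
next
  case (mult u c)
  have "\<And>i. i \<in> I \<Longrightarrow> u \<in> borel_measurable (M i)"
    using mult(2) assms(1) by (simp cong: measurable_cong_sets)
  then show ?case using mult by (simp add: nn_integral_cmult sum_distrib_left cong: measurable_cong_sets)
next
  case (add u v)
  have "\<And>i. i \<in> I \<Longrightarrow> u \<in> borel_measurable (M i)" "\<And>i. i \<in> I \<Longrightarrow> v \<in> borel_measurable (M i)"
    using add assms(1) by (simp_all cong: measurable_cong_sets)
  then show ?case using add by (simp add: nn_integral_add sum.distrib cong: measurable_cong_sets)
next
  case (seq U)
  have m: "\<And>i n. i \<in> I \<Longrightarrow> U n \<in> borel_measurable (M i)"
    using seq assms(1) by (simp cong: measurable_cong_sets)
  have "(\<integral>\<^sup>+x. (SUP n. U n) x \<partial>msum I M) = (SUP n. \<integral>\<^sup>+x. U n x \<partial>msum I M)"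
    using seq by (simp add: nn_integral_monotone_convergence_SUP image_comp cong: measurable_cong_sets)
  also have "\<dots> = (SUP n. \<Sum>i\<in>I. \<integral>\<^sup>+x. U n x \<partial>M i)"
    using seq by simp
  also have "\<dots> = (\<Sum>i\<in>I. SUP n. \<integral>\<^sup>+x. U n x \<partial>M i)"
    using seq(3) by (intro ennreal_SUP_sum) (auto simp: incseq_def le_fun_def intro!: nn_integral_mono)
  also have "\<dots> = (\<Sum>i\<in>I. \<integral>\<^sup>+x. (SUP n. U n) x \<partial>M i)"
    using seq(3) m by (intro sum.cong refl) (simp add: nn_integral_monotone_convergence_SUP image_comp)
  finally show ?case .
qed

section \<open>Marginals and couplings\<close>

abbreviation Xm :: "('a::second_countable_topology \<times> 'b::second_countable_topology) measure \<Rightarrow> 'a measure" where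
  "Xm w \<equiv> distr w borel fst"

abbreviation Ym :: "('a::second_countable_topology \<times> 'b::second_countable_topology) measure \<Rightarrow> 'b measure" where
  "Ym w \<equiv> distr w borel snd"

lemma emeasure_Xm:
  "sets w = sets borel \<Longrightarrow> A \<in> sets borel \<Longrightarrow> emeasure (Xm w) A = emeasure w (A \<times> UNIV)"
  by (subst emeasure_distr)
    (auto cong: measurable_cong_sets simp: sets_eq_imp_space_eq intro!: arg_cong[where f="emeasure w"])

lemma emeasure_Ym:
  "sets w = sets borel \<Longrightarrow> A \<in> sets borel \<Longrightarrow> emeasure (Ym w) A = emeasure w (UNIV \<times> A)"
  by (subst emeasure_distr)
    (auto cong: measurable_cong_sets simp: sets_eq_imp_space_eq intro!: arg_cong[where f="emeasure w"])

lemma nn_integral_Xm: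
  "sets w = sets borel \<Longrightarrow> f \<in> borel_measurable borel \<Longrightarrow> (\<integral>\<^sup>+x. f x \<partial>Xm w) = (\<integral>\<^sup>+z. f (fst z) \<partial>w)"
  by (subst nn_integral_distr) (auto cong: measurable_cong_sets)

lemma nn_integral_Ym:
  "sets w = sets borel \<Longrightarrow> f \<in> borel_measurable borel \<Longrightarrow> (\<integral>\<^sup>+x. f x \<partial>Ym w) = (\<integral>\<^sup>+z. f (snd z) \<partial>w)"
  by (subst nn_integral_distr) (auto cong: measurable_cong_sets)

lemma emeasure_Xm_nn_integral:
  "sets w = sets borel \<Longrightarrow> A \<in> sets borel \<Longrightarrow> emeasure (Xm w) A = (\<integral>\<^sup>+z. indicator A (fst z) \<partial>w)"
  using nn_integral_Xm[of w "indicator A"] by simp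

lemma emeasure_Ym_nn_integral:
  "sets w = sets borel \<Longrightarrow> A \<in> sets borel \<Longrightarrow> emeasure (Ym w) A = (\<integral>\<^sup>+z. indicator A (snd z) \<partial>w)"
  using nn_integral_Ym[of w "indicator A"] by simp

lemma emeasure_density_eq_0:
  fixes f :: "'a::euclidean_space \<Rightarrow> ennreal"
  assumes "f \<in> borel_measurable borel" "A \<in> sets borel" "\<And>x. x \<in> A \<Longrightarrow> f x = 0"
  shows "emeasure (density lborel f) A = 0"
proof -
  have "emeasure (density lborel f) A = (\<integral>\<^sup>+x. f x * indicator A x \<partial>lborel)"
    using assms by (subst emeasure_density) auto
  also have "\<dots> = (\<integral>\<^sup>+(x::'a). 0 \<partial>lborel)"
    using assms(3) by (intro nn_integral_cong) (auto simp: indicator_def)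
  finally show ?thesis by simp
qed

definition coupling :: "'a::second_countable_topology measure \<Rightarrow> 'b::second_countable_topology measure
    \<Rightarrow> ('a \<times> 'b) measure \<Rightarrow> bool" where
  "coupling \<mu> \<nu> w \<longleftrightarrow> sets w = sets borel \<and> Xm w = \<mu> \<and> Ym w = \<nu>"

definition cost :: "('a \<Rightarrow> 'b \<Rightarrow> real) \<Rightarrow> ('a \<times> 'b) measure \<Rightarrow> ennreal" where
  "cost c w = (\<integral>\<^sup>+z. ennreal (c (fst z) (snd z)) \<partial>w)"

definition optimal :: "('a::second_countable_topology \<Rightarrow> 'b::second_countable_topology \<Rightarrow> real)
    \<Rightarrow> ('a \<times> 'b) measure \<Rightarrow> bool" where
  "optimal c w \<longleftrightarrow> sets w = sets borel \<and> (\<forall>w'. coupling (Xm w) (Ym w) w' \<longrightarrow> cost c w \<le> cost c w')"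

lemma sets_eq_borel_measurableI:
  "sets M = sets borel \<Longrightarrow> f \<in> borel \<rightarrow>\<^sub>M N \<Longrightarrow> f \<in> M \<rightarrow>\<^sub>M N"
  by (simp cong: measurable_cong_sets)

lemma measure_eqI_closed:
  fixes M N :: "'a::metric_space measure"
  assumes "sets M = sets borel" "sets N = sets borel" "emeasure M UNIV < \<infinity>"
    and "\<And>C. closed C \<Longrightarrow> emeasure M C = emeasure N C"
  shows "M = N"
proof (rule measure_eqI_generator_eq[where E="Collect closed" and A="\<lambda>_. UNIV" and \<Omega>=UNIV])
  show "Int_stable (Collect (closed :: 'a set \<Rightarrow> bool))" by (auto simp: Int_stable_def)
  show "sets M = sigma_sets UNIV (Collect closed)" "sets N = sigma_sets UNIV (Collect closed)"
    using assms(1,2) by (simp_all add: borel_eq_closed)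
qed (use assms in auto)

text \<open>Closed sets determine a finite Borel measure, and cut-off distance functions tend to the
  indicator of a closed set. This serves to identify the marginals of a weak limit.\<close>

lemma measure_eqI_continuous:
  fixes M N :: "'a::metric_space measure"
  assumes M: "sets M = sets borel" "finite_measure M" and N: "sets N = sets borel" "finite_measure N"
    and eq: "\<And>f :: 'a \<Rightarrow> real. continuous_on UNIV f \<Longrightarrow> (\<And>x. 0 \<le> f x \<and> f x \<le> 1) \<Longrightarrow> integral\<^sup>L M f = integral\<^sup>L N f"
  shows "M = N"
proof (rule measure_eqI_closed)
  interpret M: finite_measure M by fact
  interpret N: finite_measure N by fact
  show "emeasure M UNIV < \<infinity>" by (simp add: less_top[symmetric])
  fix C :: "'a set" assume C: "closed C"
  show "emeasure M C = emeasure N C"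
  \<comment> \<open>\<open>infdist x {}\<close> is 0 by convention, so for the empty set the
    cut-offs would tend to 1 instead of 0.\<close>
  proof (cases "C = {}")
    case False
    define f where "f n x = max 0 (1 - real n * infdist x C)" for n x
    have cont: "continuous_on UNIV (f n)" for n unfolding f_def by (intro continuous_intros)
    have bd: "0 \<le> f n x \<and> f n x \<le> 1" for n x by (simp add: f_def infdist_nonneg)
    have fm: "f n \<in> borel_measurable borel" for n using cont by (rule borel_measurable_continuous_onI)
    have lim: "(\<lambda>n. f n x) \<longlonglongrightarrow> indicator C x" for x
    proof (cases "x \<in> C")
      case True then show ?thesis by (simp add: f_def)
    next
      case False
      then have pos: "infdist x C > 0"
        using C \<open>C \<noteq> {}\<close> in_closed_iff_infdist_zero[of C x] infdist_nonneg[of x C] by auto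
      obtain n0 where n0: "1 < real n0 * infdist x C"
        using reals_Archimedean3[OF pos] by blast
      have "f n x = 0" if "n \<ge> n0" for n
      proof -
        have "real n0 * infdist x C \<le> real n * infdist x C"
          using that pos by (intro mult_right_mono) auto
        then show ?thesis using n0 by (simp add: f_def)
      qed
      then have "eventually (\<lambda>n. f n x = 0) sequentially"
        by (auto simp: eventually_sequentially)
      then show ?thesis using False by (simp add: tendsto_eventually)
    qed
    have L: "(\<lambda>n. integral\<^sup>L P (f n)) \<longlonglongrightarrow> measure P C" if "sets P = sets borel" "finite_measure P" for P
    proof -
      interpret P: finite_measure P by fact
      have "(\<lambda>n. integral\<^sup>L P (f n)) \<longlonglongrightarrow> integral\<^sup>L P (indicator C)"
        using lim bd fm C that(1)
        by (intro integral_dominated_convergence[where w="\<lambda>_. 1"])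
          (auto simp: borel_closed intro!: borel_measurable_indicator)
      also have "integral\<^sup>L P (indicator C) = measure P C"
        using sets_eq_imp_space_eq[OF that(1)] by simp
      finally show ?thesis .
    qed
    have "integral\<^sup>L M (f n) = integral\<^sup>L N (f n)" for n by (intro eq cont bd)
    then have "measure M C = measure N C"
      using LIMSEQ_unique[OF L[OF M] ] L[OF N] by simp
    then show ?thesis by (simp add: M.emeasure_eq_measure N.emeasure_eq_measure)
  qed simp
qed (use assms in auto)

section \<open>Weak compactness and existence of optimal plans\<close>

text \<open>In base 3 with digits 0 and 1, the places after the first disagreement m contribute at
  most half of \<open>(1/3)^m\<close>, so carries cannot hide it. In base 2 the tail could
  compensate the leading digit.\<close>

lemma code_agree:
  fixes A :: "nat \<Rightarrow> 'z set"
  defines "e \<equiv> \<lambda>z. \<Sum>k. (1/3::real)^k * indicator (A k) z"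
  assumes "\<bar>e z - e z'\<bar> < (1/3)^n / 2" "k \<le> n"
  shows "z \<in> A k \<longleftrightarrow> z' \<in> A k"
proof (rule ccontr)
  assume neq: "(z \<in> A k) \<noteq> (z' \<in> A k)"
  define d where "d j = (indicator (A j) z - indicator (A j) z' :: real)" for j
  define m where "m = (LEAST j. d j \<noteq> 0)"
  have dk: "d k \<noteq> 0" using neq by (auto simp: d_def indicator_def)
  have dm: "d m \<noteq> 0" unfolding m_def using dk by (rule LeastI)
  have mk: "m \<le> k" unfolding m_def using dk by (rule Least_le)
  have lt: "d j = 0" if "j < m" for j using that not_less_Least unfolding m_def by blast
  have db: "\<bar>d j\<bar> \<le> 1" for j by (auto simp: d_def indicator_def)
  have dm1: "\<bar>d m\<bar> = 1" using dm by (auto simp: d_def indicator_def split: if_splits)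
  have g: "summable (\<lambda>j. (1/3::real)^j)" by (rule summable_geometric) simp
  have S: "summable (\<lambda>j. (1/3::real)^j * indicator (A j) y)" for y
    by (rule summable_comparison_test[OF _ g]) (auto simp: indicator_def)
  have Sd: "summable (\<lambda>j. (1/3::real)^j * d j)"
    by (rule summable_comparison_test[OF _ g]) (use db in \<open>auto simp: abs_mult intro!: exI[of _ 0] mult_left_le\<close>)
  have "e z - e z' = (\<Sum>j. (1/3)^j * d j)"
    unfolding e_def d_def by (simp add: suminf_diff[OF S S] right_diff_distrib)
  also have "\<dots> = (\<Sum>j. (1/3)^(j + Suc m) * d (j + Suc m)) + (\<Sum>j<Suc m. (1/3)^j * d j)"
    by (rule suminf_split_initial_segment[OF Sd])
  also have "(\<Sum>j<Suc m. (1/3)^j * d j) = (1/3)^m * d m"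
    using lt by simp
  finally have 1: "e z - e z' = (\<Sum>j. (1/3)^(j + Suc m) * d (j + Suc m)) + (1/3)^m * d m" .
  have Sa: "summable (\<lambda>j. \<bar>(1/3)^(j + Suc m) * d (j + Suc m)\<bar>)"
  proof (rule summable_comparison_test)
    show "summable (\<lambda>j. (1/3::real)^Suc m * (1/3)^j)" using g by (rule summable_mult)
    show "\<exists>N. \<forall>n\<ge>N. norm \<bar>(1/3)^(n + Suc m) * d (n + Suc m)\<bar> \<le> (1/3::real)^Suc m * (1/3)^n"
      using db by (auto simp: abs_mult power_add intro!: mult_left_le)
  qed
  have "\<bar>\<Sum>j. (1/3)^(j + Suc m) * d (j + Suc m)\<bar> \<le> (\<Sum>j. \<bar>(1/3)^(j + Suc m) * d (j + Suc m)\<bar>)"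
    using Sa by (rule summable_rabs)
  also have "\<dots> \<le> (\<Sum>j. (1/3::real)^Suc m * (1/3)^j)"
    using db by (intro suminf_le Sa summable_mult g) (auto simp: abs_mult power_add intro!: mult_left_le)
  also have "\<dots> = (1/3)^Suc m * (3/2)"
    by (subst suminf_mult[OF g]) (simp add: suminf_geometric)
  also have "\<dots> = (1/3)^m / 2" by simp
  finally have 2: "\<bar>\<Sum>j. (1/3)^(j + Suc m) * d (j + Suc m)\<bar> \<le> (1/3)^m / 2" .
  have 3: "\<bar>(1/3)^m * d m\<bar> = (1/3)^m" using dm1 by (simp add: abs_mult)
  have "(1/3::real)^n \<le> (1/3)^m"
    by (rule power_decreasing) (use mk assms(3) in auto)
  then show False using 1 2 3 assms(2) by linarith
qed

text \<open>A ternary expansion over a countable base codes a compact set by reals, and the decoding map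
  is uniformly continuous. This reduces weak compactness to Helly's selection theorem.\<close>

lemma compact_coding:
  fixes K :: "'z::euclidean_space set"
  assumes K: "compact K"
  obtains e :: "'z \<Rightarrow> real" and h :: "real \<Rightarrow> 'z"
  where "e \<in> borel_measurable borel" "\<And>z. 0 \<le> e z \<and> e z \<le> 2" "continuous_on UNIV h" "\<And>z. z \<in> K \<Longrightarrow> h (e z) = z"
proof -
  obtain D :: "'z set" where D': "countable D" "\<forall>X. open X \<longrightarrow> X \<noteq> {} \<longrightarrow> (\<exists>d\<in>D. d \<in> X)"
    using countable_dense_exists[where 'a='z] by blast
  have D: "\<exists>d\<in>D. dist d x < e" if "0 < e" for x e
  proof -
    have "open (ball x e)" "ball x e \<noteq> {}" using that by auto
    then obtain d where "d \<in> D" "d \<in> ball x e" using D'(2) by blast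
    then show ?thesis by (auto simp: dist_commute)
  qed
  define F where "F = (\<lambda>(d, n). ball d (1 / real (Suc n))) ` (D \<times> (UNIV :: nat set))"
  have "countable F" unfolding F_def using D'(1) by blast
  moreover have "F \<noteq> {}" unfolding F_def using D[of 1 0] by auto
  moreover define A where "A = from_nat_into F"
  ultimately have A: "range A = F" by (simp add: range_from_nat_into)
  have Aopen: "open (A k)" for k 
  proof -
    have "A k \<in> F" using A by blast
    then show ?thesis unfolding F_def by auto
  qed
  define e where "e = (\<lambda>z. \<Sum>k. (1/3::real)^k * indicator (A k) z)"
  have g: "summable (\<lambda>j. (1/3::real)^j)" by (rule summable_geometric) simp
  have S: "summable (\<lambda>j. (1/3::real)^j * indicator (A j) y)" for y
    by (rule summable_comparison_test[OF _ g]) (auto simp: indicator_def)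
  have em: "e \<in> borel_measurable borel"
    unfolding e_def using Aopen by (intro borel_measurable_suminf borel_measurable_times borel_measurable_indicator) auto
  have eb: "0 \<le> e z \<and> e z \<le> 2" for z
  proof
    show "0 \<le> e z" unfolding e_def by (intro suminf_nonneg S) auto
    have "e z \<le> (\<Sum>j. (1/3::real)^j)" unfolding e_def
      by (intro suminf_le S g) (auto simp: indicator_def)
    also have "\<dots> \<le> 2" by (simp add: suminf_geometric)
    finally show "e z \<le> 2" .
  qed
  have uc: "\<exists>\<delta>>0. \<forall>z\<in>K. \<forall>z'\<in>K. \<bar>e z - e z'\<bar> < \<delta> \<longrightarrow> dist z z' < \<epsilon>" if eps: "\<epsilon> > 0" for \<epsilon>
  proof -
    obtain n where n: "1 / real (Suc n) < \<epsilon> / 2" by (rule nat_approx_posE[of "\<epsilon>/2"]) (use eps in auto)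
    define B where "B = {k. \<exists>d\<in>D. A k = ball d (1 / real (Suc n))}"
    have "K \<subseteq> (\<Union>k\<in>B. A k)"
    proof
      fix x obtain d where d: "d \<in> D" "dist d x < 1 / real (Suc n)" using D[of "1 / real (Suc n)" x] by auto
      then have "ball d (1 / real (Suc n)) \<in> range A" unfolding A F_def by force
      then obtain k where k: "A k = ball d (1 / real (Suc n))" by (metis imageE)
      have "k \<in> B" "x \<in> A k" using d k unfolding B_def by (blast, simp)
      then show "x \<in> (\<Union>k\<in>B. A k)" by blast
    qed
    then obtain B' where B': "B' \<subseteq> B" "finite B'" "K \<subseteq> (\<Union>k\<in>B'. A k)"
      using compactE_image[OF K, of B A] Aopen by metis
    \<comment> \<open>The finite subcover involves digits up to \<open>N\<close> only, so close
      codes put both points into one ball of the cover. The 0 takes care of an empty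
      subcover.\<close>
    define N where "N = Max (insert 0 B')"
    have "dist z z' < \<epsilon>" if zz: "z \<in> K" "z' \<in> K" and ez: "\<bar>e z - e z'\<bar> < (1/3)^N / 2" for z z'
    proof -
      obtain k where k: "k \<in> B'" "z \<in> A k" using B' zz by auto
      have "k \<le> N" unfolding N_def using k B' by auto
      then have "z' \<in> A k" using code_agree[of A z z' N k] ez k unfolding e_def by simp
      moreover obtain d where "A k = ball d (1 / real (Suc n))" using k B' unfolding B_def by auto
      ultimately have "dist d z < \<epsilon>/2" "dist d z' < \<epsilon>/2" using k n by auto
      then show ?thesis by (metis dist_commute dist_triangle_half_l)
    qed
    then show ?thesis by (intro exI[of _ "(1/3)^N / 2"]) auto
  qed
  have inj: "inj_on e K"
  proof (rule inj_onI)
    fix x y assume xy: "x \<in> K" "y \<in> K" "e x = e y"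
    show "x = y"
    proof (rule ccontr)
      assume "x \<noteq> y"
      then obtain \<delta> where "\<delta> > 0" "\<forall>z\<in>K. \<forall>z'\<in>K. \<bar>e z - e z'\<bar> < \<delta> \<longrightarrow> dist z z' < dist x y"
        using uc[of "dist x y"] by (metis zero_less_dist_iff)
      then show False using xy by force
    qed
  qed
  define r where "r = inv_into K e"
  have "uniformly_continuous_on (e ` K) r"
    unfolding uniformly_continuous_on_def
  proof safe
    fix \<epsilon> :: real assume "\<epsilon> > 0"
    then obtain \<delta> where "\<delta> > 0" "\<forall>z\<in>K. \<forall>z'\<in>K. \<bar>e z - e z'\<bar> < \<delta> \<longrightarrow> dist z z' < \<epsilon>"
      using uc[of \<epsilon>] by blast
    then show "\<exists>d>0. \<forall>x\<in>e ` K. \<forall>x'\<in>e ` K. dist x' x < d \<longrightarrow> dist (r x') (r x) < \<epsilon>"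
      by (intro exI[of _ \<delta>]) (auto simp: r_def inv_into_f_f[OF inj] dist_real_def)
  qed
  \<comment> \<open>\<open>e\<close> is merely Borel, so the image of \<open>K\<close> need not be
    closed. Uniform continuity carries the decoder to the closure, where Tietze's theorem
    applies.\<close>
  then obtain r' where r': "uniformly_continuous_on (closure (e ` K)) r'" "\<And>x. x \<in> e ` K \<Longrightarrow> r x = r' x"
    using uniformly_continuous_on_extension_on_closure by metis
  obtain h where h: "continuous_on UNIV h" "\<And>x. x \<in> closure (e ` K) \<Longrightarrow> h x = r' x"
    using Tietze_unbounded[of "closure (e ` K)" r' UNIV] r'(1) uniformly_continuous_imp_continuous by auto
  have "h (e z) = z" if "z \<in> K" for z
    using that h(2)[of "e z"] r'(2)[of "e z"] closure_subset[of "e ` K"] inv_into_f_f[OF inj that]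
    by (auto simp: r_def)
  then show ?thesis using that em eb h(1) by blast
qed

text \<open>The codes of the normalized measures live on a bounded interval, hence are tight, and
  Helly gives a weak limit on the line. The decoder \<open>h\<close> brings it back. Continuity is
  needed of \<open>h\<close> alone, since integrals of \<open>f\<close> against \<open>w n\<close>
  are, up to the factor \<open>m\<close>, integrals of \<open>f\<close> composed with
  \<open>h\<close> against the codes.\<close>

theorem weak_compactness:
  fixes w :: "nat \<Rightarrow> 'z::euclidean_space measure"
  assumes s: "\<And>n. sets (w n) = sets borel" and K: "compact K" and m: "0 < m"
    and mass: "\<And>n. emeasure (w n) UNIV = ennreal m" and conc: "\<And>n. emeasure (w n) (- K) = 0"
  obtains r W where "strict_mono r" "sets W = sets borel" "emeasure W UNIV = ennreal m"
    "\<And>(f :: 'z \<Rightarrow> real) b. continuous_on UNIV f \<Longrightarrow> (\<And>z. \<bar>f z\<bar> \<le> b) \<Longrightarrow>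
       (\<lambda>n. integral\<^sup>L (w (r n)) f) \<longlonglongrightarrow> integral\<^sup>L W f"
proof -
  obtain e :: "'z \<Rightarrow> real" and h where e: "e \<in> borel_measurable borel" "\<And>z. 0 \<le> e z \<and> e z \<le> 2"
    and h: "continuous_on UNIV h" "\<And>z. z \<in> K \<Longrightarrow> h (e z) = z"
    using compact_coding[OF K] by metis
  note [measurable] = e(1)
  have hm [measurable]: "h \<in> borel \<rightarrow>\<^sub>M borel" using h(1) by (rule borel_measurable_continuous_onI)
  have sp: "space (w n) = UNIV" for n using sets_eq_imp_space_eq[OF s] by simp
  have wm: "g \<in> borel \<rightarrow>\<^sub>M borel \<Longrightarrow> g \<in> w n \<rightarrow>\<^sub>M borel" for n and g :: "'z \<Rightarrow> real"
    using s by (rule sets_eq_borel_measurableI)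
  define P where "P n = distr (scale_measure (ennreal (1/m)) (w n)) borel e" for n
  have e': "e \<in> scale_measure (ennreal (1/m)) (w n) \<rightarrow>\<^sub>M borel" for n
    using e(1) by (rule sets_eq_borel_measurableI[rotated]) (simp add: s)
  have P: "real_distribution (P n)" for n
  proof -
    have "emeasure (scale_measure (ennreal (1/m)) (w n)) (space (scale_measure (ennreal (1/m)) (w n))) = 1"
      using m by (simp add: space_scale_measure sp mass ennreal_mult[symmetric])
    then have "prob_space (scale_measure (ennreal (1/m)) (w n))" by (rule prob_spaceI)
    then have "prob_space (P n)" unfolding P_def using e' by (rule prob_space.prob_space_distr)
    then show ?thesis
      by (simp add: real_distribution_def real_distribution_axioms_def P_def)
  qed
  have "tight P" unfolding tight_def
  proof safe
    fix \<epsilon> :: real assume "\<epsilon> > 0"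
    \<comment> \<open>Tightness is phrased with intervals open on the left, and a code may be 0;
      hence the -1.\<close>
    have "measure (P n) {-1<..2} = 1" for n
    proof -
      interpret real_distribution "P n" by (rule P)
      have e2: "e z \<in> {-1<..2}" for z using e(2)[of z] by auto
      have "AE x in P n. x \<in> {-1<..2}" unfolding P_def
        by (subst AE_distr_iff[OF e']) (use e2 in simp_all)
      then show ?thesis by (subst prob_eq_1) auto
    qed
    then show "\<exists>a b::real. a < b \<and> (\<forall>n. 1 - \<epsilon> < measure (P n) {a<..b})"
      using \<open>\<epsilon> > 0\<close> by (intro exI[of _ "-1"] exI[of _ 2]) auto
  qed (rule P)
  from tight_imp_convergent_subsubsequence[OF this strict_mono_id] obtain r M
    where r: "strict_mono r" "real_distribution M" "weak_conv_m (P \<circ> r) M" by auto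
  interpret M: real_distribution M by fact
  define W where "W = distr (scale_measure (ennreal m) M) borel h"
  have h': "h \<in> scale_measure (ennreal m) M \<rightarrow>\<^sub>M borel"
    using hm by (rule sets_eq_borel_measurableI[rotated]) simp
  have int_scale: "integral\<^sup>L (scale_measure (ennreal k) N) f = k * integral\<^sup>L N f"
    if "k \<ge> 0" "f \<in> borel_measurable N" for k and f :: "'q \<Rightarrow> real" and N
  proof -
    have "scale_measure (ennreal k) N = density N (\<lambda>_. ennreal k)"
      by (rule measure_eqI) (auto simp: emeasure_density nn_integral_cmult)
    then show ?thesis using that by (simp add: integral_density)
  qed
  show ?thesis
  proof (rule that[of r W])
    show "strict_mono r" by fact
    show "sets W = sets borel" by (simp add: W_def)
    show "emeasure W UNIV = ennreal m"
      unfolding W_def using h' M.emeasure_space_1 by (subst emeasure_distr) (auto simp: space_scale_measure)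
    fix f :: "'z \<Rightarrow> real" and b assume f: "continuous_on UNIV f" "\<And>z. \<bar>f z\<bar> \<le> b"
    have fm [measurable]: "f \<in> borel_measurable borel" using f(1) by (rule borel_measurable_continuous_onI)
    have fh: "continuous_on UNIV (\<lambda>t. f (h t))" using f(1) h(1) by (rule continuous_on_compose2) auto
    have "(\<lambda>n. integral\<^sup>L ((P \<circ> r) n) (\<lambda>t. f (h t))) \<longlonglongrightarrow> integral\<^sup>L M (\<lambda>t. f (h t))"
      by (rule weak_conv_imp_integral_bdd_continuous_conv[where B=b])
        (use P r f fh in \<open>auto simp: continuous_on_eq_continuous_at comp_def\<close>)
    then have "(\<lambda>n. m * integral\<^sup>L (P (r n)) (\<lambda>t. f (h t))) \<longlonglongrightarrow> m * integral\<^sup>L M (\<lambda>t. f (h t))"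
      by (intro tendsto_mult_left) simp
    moreover have "m * integral\<^sup>L M (\<lambda>t. f (h t)) = integral\<^sup>L W f"
      unfolding W_def using m h' by (subst integral_distr) (auto simp: int_scale)
    moreover have "m * integral\<^sup>L (P n) (\<lambda>t. f (h t)) = integral\<^sup>L (w n) f" for n
    proof -
      have "AE z in w n. z \<in> K"
        using conc[of n] K by (intro AE_I[where N="- K"]) (auto simp: s sp borel_closed compact_imp_closed)
      then have "integral\<^sup>L (w n) (\<lambda>z. f (h (e z))) = integral\<^sup>L (w n) f"
        by (intro integral_cong_AE) (auto simp: h(2) intro!: wm)
      moreover have "integral\<^sup>L (scale_measure (ennreal (1/m)) (w n)) (\<lambda>z. f (h (e z))) = (1/m) * integral\<^sup>L (w n) (\<lambda>z. f (h (e z)))"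
        using m by (intro int_scale wm) simp_all
      moreover have "integral\<^sup>L (P n) (\<lambda>t. f (h t)) = integral\<^sup>L (scale_measure (ennreal (1/m)) (w n)) (\<lambda>z. f (h (e z)))"
        unfolding P_def by (subst integral_distr[OF e']) auto
      ultimately show ?thesis using m by simp
    qed
    ultimately show "(\<lambda>n. integral\<^sup>L (w (r n)) f) \<longlonglongrightarrow> integral\<^sup>L W f" by simp
  qed
qed

text \<open>The complement of a product is covered by two strips, each of them null for one
  marginal.\<close>

lemma coupling_concentrated:
  assumes w: "coupling \<mu> \<nu> w" and A: "A \<in> sets borel" "emeasure \<mu> (- A) = 0"
    and B: "B \<in> sets borel" "emeasure \<nu> (- B) = 0"
  shows "emeasure w (- (A \<times> B)) = 0"
proof -
  have s: "sets w = sets borel" using w by (simp add: coupling_def)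
  have "emeasure w ((- A) \<times> UNIV) = 0" "emeasure w (UNIV \<times> (- B)) = 0"
    using w A B emeasure_Xm[OF s, of "- A"] emeasure_Ym[OF s, of "- B"] by (auto simp: coupling_def)
  moreover have "emeasure w (- (A \<times> B)) \<le> emeasure w ((- A) \<times> UNIV \<union> UNIV \<times> (- B))"
    using A B s by (intro emeasure_mono) (auto intro!: Times_borel)
  moreover have "\<dots> \<le> emeasure w ((- A) \<times> UNIV) + emeasure w (UNIV \<times> (- B))"
    using A B s by (intro emeasure_subadditive) (auto intro!: Times_borel)
  ultimately show ?thesis by simp
qed

lemma coupling_mass:
  assumes "coupling \<mu> \<nu> w" shows "emeasure w UNIV = emeasure \<mu> UNIV" "emeasure w UNIV = emeasure \<nu> UNIV"
  using assms emeasure_Xm[of w UNIV] emeasure_Ym[of w UNIV] by (auto simp: coupling_def)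

lemma coupling_concentrated_AE:
  assumes "coupling \<mu> \<nu> w" "A \<in> sets borel" "emeasure \<mu> (- A) = 0" "B \<in> sets borel" "emeasure \<nu> (- B) = 0"
  shows "AE z in w. z \<in> A \<times> B"
proof (rule AE_I[OF _ coupling_concentrated[OF assms]])
  have s: "sets w = sets borel" using assms(1) by (simp add: coupling_def)
  show "{x \<in> space w. x \<notin> A \<times> B} \<subseteq> - (A \<times> B)" by auto
  show "- (A \<times> B) \<in> sets w" unfolding s using assms by (intro borel_comp Times_borel)
qed

text \<open>Direct method: a minimizing sequence has a weak limit, whose marginals are right because
  bounded continuous functions of one coordinate are admissible test functions.\<close>

theorem optimal_plan_exists:
  fixes \<mu> \<nu> :: "'a::euclidean_space measure"
  assumes w0: "coupling \<mu> \<nu> w0" and mass: "emeasure \<mu> UNIV = ennreal m" "0 < m"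
    and K: "compact K" "emeasure \<mu> (- K) = 0" "emeasure \<nu> (- K) = 0"
    and c: "continuous_on UNIV (\<lambda>z. c (fst z) (snd z))" "\<And>x y. 0 \<le> c x y"
  obtains w where "coupling \<mu> \<nu> w" "\<And>w'. coupling \<mu> \<nu> w' \<Longrightarrow> cost c w \<le> cost c w'"
proof -
  have KK: "compact (K \<times> K)" using K(1) by (simp add: compact_Times)
  have Kb: "K \<in> sets borel" using K(1) by (simp add: borel_closed compact_imp_closed)
  have "bounded ((\<lambda>z. c (fst z) (snd z)) ` (K \<times> K))"
    using KK c(1) by (intro compact_imp_bounded compact_continuous_image) (auto intro: continuous_on_subset)
  then obtain B where B: "B > 0" "\<And>z. z \<in> K \<times> K \<Longrightarrow> c (fst z) (snd z) \<le> B"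
    unfolding bounded_pos by force
  \<comment> \<open>Weak limits see bounded integrands only. All couplings live on
    \<open>K \<times> K\<close>, where \<open>c\<close> is at most \<open>B\<close>, so the
    truncation leaves every cost unchanged.\<close>
  define c' where "c' z = min (c (fst z) (snd z)) B" for z
  have c'c: "continuous_on UNIV c'" unfolding c'_def using c(1) by (intro continuous_intros)
  have c'b: "0 \<le> c' z" "\<bar>c' z\<bar> \<le> B" for z using c(2) B(1) by (auto simp: c'_def)
  have c'm: "c' \<in> borel_measurable borel" using c'c by (rule borel_measurable_continuous_onI)
  have cs: "sets w = sets borel" if "coupling \<mu> \<nu> w" for w using that by (simp add: coupling_def)
  have cf: "finite_measure w" if "coupling \<mu> \<nu> w" for w
    using coupling_mass(1)[OF that] mass sets_eq_imp_space_eq[OF cs[OF that]]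
    by (intro finite_measureI) simp
  have "coupling \<mu> \<nu> w \<Longrightarrow> integrable w c'" for w
    using finite_measure.integrable_const_bound[OF cf, of w c' B] c'b
      sets_eq_borel_measurableI[OF cs c'm] by simp
  then have cost: "cost c w = ennreal (integral\<^sup>L w c')" if "coupling \<mu> \<nu> w" for w
  proof -
    have "AE z in w. z \<in> K \<times> K" by (rule coupling_concentrated_AE[OF that Kb K(2) Kb K(3)])
    then have "cost c w = (\<integral>\<^sup>+z. ennreal (c' z) \<partial>w)"
      unfolding cost_def by (intro nn_integral_cong_AE) (auto simp: c'_def min_absorb1 B(2))
    also have "\<dots> = ennreal (integral\<^sup>L w c')"
      using \<open>coupling \<mu> \<nu> w \<Longrightarrow> integrable w c'\<close>[OF that] c'b by (intro nn_integral_eq_integral) auto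
    finally show ?thesis .
  qed
  define S where "S = (\<lambda>w. integral\<^sup>L w c') ` Collect (coupling \<mu> \<nu>)"
  have Sb: "bdd_below S" unfolding S_def
    by (intro bdd_belowI2[where m=0] Bochner_Integration.integral_nonneg c'b)
  have Sn: "S \<noteq> {}" using w0 by (auto simp: S_def)
  have "\<exists>w. coupling \<mu> \<nu> w \<and> integral\<^sup>L w c' < Inf S + 1 / real (Suc n)" for n
  proof -
    have "Inf S < Inf S + 1 / real (Suc n)" by simp
    then obtain x where "x \<in> S" "x < Inf S + 1 / real (Suc n)"
      using cInf_lessD[OF Sn] by blast
    then show ?thesis unfolding S_def by blast
  qed
  then obtain w where w: "\<And>n. coupling \<mu> \<nu> (w n)" "\<And>n. integral\<^sup>L (w n) c' < Inf S + 1 / real (Suc n)"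
    by metis
  obtain r W where r: "strict_mono r" and W: "sets W = sets borel" "emeasure W UNIV = ennreal m"
    and lim: "\<And>(f :: 'a \<times> 'a \<Rightarrow> real) b. continuous_on UNIV f \<Longrightarrow> (\<And>z. \<bar>f z\<bar> \<le> b) \<Longrightarrow>
       (\<lambda>n. integral\<^sup>L (w (r n)) f) \<longlonglongrightarrow> integral\<^sup>L W f"
  proof (rule weak_compactness[of w "K \<times> K" m])
    show "sets (w n) = sets borel" for n using cs[OF w(1)] .
    show "emeasure (w n) UNIV = ennreal m" for n using coupling_mass(1)[OF w(1)] mass by simp
    show "emeasure (w n) (- (K \<times> K)) = 0" for n
      using coupling_concentrated[OF w(1) Kb K(2) Kb K(3)] .
  qed (use KK mass in auto)
  have Wf: "finite_measure W" using W sets_eq_imp_space_eq[OF W(1)] by (intro finite_measureI) simp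
  have fin: "sets M = sets borel \<Longrightarrow> emeasure M UNIV = ennreal m \<Longrightarrow> finite_measure M" for M :: "'a measure"
    using sets_eq_imp_space_eq[of M borel] by (intro finite_measureI) simp
  have \<mu>s: "sets \<mu> = sets borel" "sets \<nu> = sets borel" using w0 by (auto simp: coupling_def)
  have \<nu>m: "emeasure \<nu> UNIV = ennreal m" using coupling_mass[OF w0] mass by simp
  have "Xm W = \<mu>"
  proof (rule measure_eqI_continuous)
    show "finite_measure (Xm W)" by (rule fin) (simp_all add: emeasure_Xm W)
    show "finite_measure \<mu>" by (rule fin) (simp_all add: mass \<mu>s)
    fix f :: "'a \<Rightarrow> real" assume f: "continuous_on UNIV f" "\<And>x. 0 \<le> f x \<and> f x \<le> 1"
    have fm: "f \<in> borel_measurable borel" using f(1) by (rule borel_measurable_continuous_onI)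
    have I: "integral\<^sup>L (Xm w) f = integral\<^sup>L w (\<lambda>z. f (fst z))" if "sets w = sets borel" for w :: "('a \<times> 'a) measure"
      using fm by (intro integral_distr sets_eq_borel_measurableI[OF that]) measurable
    have "(\<lambda>n. integral\<^sup>L (w (r n)) (\<lambda>z. f (fst z))) \<longlonglongrightarrow> integral\<^sup>L W (\<lambda>z. f (fst z))"
      using f(2) continuous_on_compose2[OF f(1) continuous_on_fst[OF continuous_on_id]] by (intro lim[where b=1]) auto
    moreover have "integral\<^sup>L (w (r n)) (\<lambda>z. f (fst z)) = integral\<^sup>L \<mu> f" for n
      using I[OF cs[OF w(1)], of "r n", symmetric] w(1)[of "r n"] by (simp add: coupling_def)
    ultimately show "integral\<^sup>L (Xm W) f = integral\<^sup>L \<mu> f"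
      using I[OF W(1)] LIMSEQ_unique[OF _ tendsto_const] by fastforce
  qed (simp_all add: \<mu>s)
  moreover have "Ym W = \<nu>"
  proof (rule measure_eqI_continuous)
    show "finite_measure (Ym W)" by (rule fin) (simp_all add: emeasure_Ym W)
    show "finite_measure \<nu>" by (rule fin) (simp_all add: \<nu>m \<mu>s)
    fix f :: "'a \<Rightarrow> real" assume f: "continuous_on UNIV f" "\<And>x. 0 \<le> f x \<and> f x \<le> 1"
    have fm: "f \<in> borel_measurable borel" using f(1) by (rule borel_measurable_continuous_onI)
    have I: "integral\<^sup>L (Ym w) f = integral\<^sup>L w (\<lambda>z. f (snd z))" if "sets w = sets borel" for w :: "('a \<times> 'a) measure"
      using fm by (intro integral_distr sets_eq_borel_measurableI[OF that]) measurable
    have "(\<lambda>n. integral\<^sup>L (w (r n)) (\<lambda>z. f (snd z))) \<longlonglongrightarrow> integral\<^sup>L W (\<lambda>z. f (snd z))"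
      using f(2) continuous_on_compose2[OF f(1) continuous_on_snd[OF continuous_on_id]] by (intro lim[where b=1]) auto
    moreover have "integral\<^sup>L (w (r n)) (\<lambda>z. f (snd z)) = integral\<^sup>L \<nu> f" for n
      using I[OF cs[OF w(1)], of "r n", symmetric] w(1)[of "r n"] by (simp add: coupling_def)
    ultimately show "integral\<^sup>L (Ym W) f = integral\<^sup>L \<nu> f"
      using I[OF W(1)] LIMSEQ_unique[OF _ tendsto_const] by fastforce
  qed (simp_all add: \<mu>s)
  ultimately have cW: "coupling \<mu> \<nu> W" using W(1) by (simp add: coupling_def)
  have "integral\<^sup>L W c' \<le> Inf S"
  proof (rule LIMSEQ_le)
    show "(\<lambda>n. integral\<^sup>L (w (r n)) c') \<longlonglongrightarrow> integral\<^sup>L W c'" by (rule lim[OF c'c c'b(2)])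
    have "(\<lambda>n. Inf S + 1 / real (Suc n)) \<longlonglongrightarrow> Inf S + 0"
      by (intro tendsto_intros) (rule LIMSEQ_Suc, rule lim_1_over_n)
    then show "(\<lambda>n. Inf S + 1 / real (Suc (r n))) \<longlonglongrightarrow> Inf S"
      using LIMSEQ_subseq_LIMSEQ[OF _ r] by (auto simp: comp_def)
    show "\<exists>N. \<forall>n\<ge>N. integral\<^sup>L (w (r n)) c' \<le> Inf S + 1 / real (Suc (r n))"
      using w(2) less_imp_le by blast
  qed
  then have "cost c W \<le> cost c w'" if "coupling \<mu> \<nu> w'" for w'
  proof -
    have "Inf S \<le> integral\<^sup>L w' c'" using that Sb by (intro cInf_lower) (auto simp: S_def)
    with \<open>integral\<^sup>L W c' \<le> Inf S\<close> show ?thesis by (simp add: cost[OF that] cost[OF cW] ennreal_leI)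
  qed
  with cW show ?thesis using that by blast
qed

section \<open>Optimal plans are graphs over the second marginal\<close>

definition nprod :: "'a::second_countable_topology measure \<Rightarrow> 'b::second_countable_topology measure \<Rightarrow> ('a \<times> 'b) measure" where
  "nprod \<mu> \<nu> = scale_measure (inverse (emeasure \<mu> UNIV)) (\<mu> \<Otimes>\<^sub>M \<nu>)"

text \<open>For null measures the factor is \<open>\<infinity>\<close>, which does no harm because \<open>\<infinity> * 0 = 0\<close>.\<close>

lemma coupling_nprod:
  assumes s: "sets \<mu> = sets borel" "sets \<nu> = sets borel"
    and m: "emeasure \<mu> UNIV = emeasure \<nu> UNIV" "emeasure \<mu> UNIV < \<infinity>"
  shows "coupling \<mu> \<nu> (nprod \<mu> \<nu>)"
proof -
  have sp: "space \<mu> = UNIV" "space \<nu> = UNIV" using sets_eq_imp_space_eq[OF s(1)] sets_eq_imp_space_eq[OF s(2)] by simp_all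
  interpret \<mu>: finite_measure \<mu> using m sp by (intro finite_measureI) simp
  interpret \<nu>: finite_measure \<nu> using m sp by (intro finite_measureI) simp
  have ss: "sets (nprod \<mu> \<nu>) = sets borel"
    unfolding nprod_def sets_scale_measure sets_pair_measure_cong[OF s] borel_prod ..
  define k where "k = emeasure \<mu> UNIV"
  have k: "k = 0 \<or> inverse k * k = 1"
  proof (cases "k = 0")
    case False
    then show ?thesis using m(2) ennreal_divide_self[of k] by (simp add: k_def divide_ennreal_def mult.commute less_top)
  qed simp
  have le: "emeasure \<mu> A \<le> k" "emeasure \<nu> A' \<le> k" for A A'
    unfolding k_def using emeasure_space[of \<mu> A] emeasure_space[of \<nu> A'] sp m by auto
  have 1: "inverse k * (v * k) = v" if "v \<le> k" for v :: ennreal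
    using k that by (auto simp: mult.left_commute)
  have "Xm (nprod \<mu> \<nu>) = \<mu>"
  proof (rule measure_eqI)
    fix A assume "A \<in> sets (Xm (nprod \<mu> \<nu>))"
    then have A: "A \<in> sets borel" by simp
    have "emeasure (Xm (nprod \<mu> \<nu>)) A = emeasure (nprod \<mu> \<nu>) (A \<times> UNIV)" by (rule emeasure_Xm[OF ss A])
    also have "\<dots> = inverse k * (emeasure \<mu> A * k)"
      unfolding nprod_def k_def using A s m \<nu>.emeasure_pair_measure_Times[of A \<mu> UNIV] by simp
    finally show "emeasure (Xm (nprod \<mu> \<nu>)) A = emeasure \<mu> A" using 1 le by simp
  qed (simp add: s)
  moreover have "Ym (nprod \<mu> \<nu>) = \<nu>"
  proof (rule measure_eqI)
    fix A assume "A \<in> sets (Ym (nprod \<mu> \<nu>))"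
    then have A: "A \<in> sets borel" by simp
    have "emeasure (Ym (nprod \<mu> \<nu>)) A = emeasure (nprod \<mu> \<nu>) (UNIV \<times> A)" by (rule emeasure_Ym[OF ss A])
    also have "\<dots> = inverse k * (emeasure \<nu> A * k)"
      unfolding nprod_def k_def using A s m \<nu>.emeasure_pair_measure_Times[of UNIV \<mu> A] by (simp add: mult.commute)
    finally show "emeasure (Ym (nprod \<mu> \<nu>)) A = emeasure \<nu> A" using 1 le by simp
  qed (simp add: s)
  ultimately show ?thesis using ss by (simp add: coupling_def)
qed

section \<open>Supports and pairwise monotonicity of optimal plans\<close>

definition msupport :: "'a::topological_space measure \<Rightarrow> 'a set" where
  "msupport w = {z. \<forall>U. open U \<and> z \<in> U \<longrightarrow> emeasure w U > 0}"

lemma closed_msupport: "closed (msupport w)"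
  unfolding closed_def
proof (subst open_subopen, safe)
  fix z assume "z \<notin> msupport w"
  then obtain U where U: "open U" "z \<in> U" "emeasure w U = 0" by (auto simp: msupport_def)
  then have "U \<subseteq> - msupport w" by (auto simp: msupport_def)
  with U show "\<exists>T. open T \<and> z \<in> T \<and> T \<subseteq> - msupport w" by blast
qed

text \<open>By second countability, the complement of the support is covered by countably many null
  basic open sets.\<close>

lemma AE_msupport:
  fixes w :: "'a::second_countable_topology measure"
  assumes s: "sets w = sets borel"
  shows "AE z in w. z \<in> msupport w"
proof -
  obtain B :: "'a set set" where B: "countable B" "topological_basis B" using ex_countable_basis by blast
  have "AE z in w. \<forall>U\<in>B. emeasure w U = 0 \<longrightarrow> z \<notin> U"
  proof (subst AE_ball_countable[OF B(1)], safe)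
    fix U assume "U \<in> B"
    then have "open U" using B(2) by (simp add: topological_basis_open)
    then have "U \<in> sets w" using s by simp
    then show "AE z in w. emeasure w U = 0 \<longrightarrow> z \<notin> U"
      by (cases "emeasure w U = 0") (auto intro: AE_not_in)
  qed
  then show ?thesis
  proof (rule AE_mp, intro AE_I2 impI)
    fix z assume z: "\<forall>U\<in>B. emeasure w U = 0 \<longrightarrow> z \<notin> U"
    show "z \<in> msupport w" unfolding msupport_def
    proof (intro CollectI allI impI)
      fix V assume "open V \<and> z \<in> V"
      then obtain U where U: "U \<in> B" "z \<in> U" "U \<subseteq> V" using B(2) topological_basisE by blast
      then have "emeasure w U > 0" using z by (metis zero_less_iff_neq_zero)
      moreover have "emeasure w U \<le> emeasure w V"
        using U \<open>open V \<and> z \<in> V\<close> s by (intro emeasure_mono) auto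
      ultimately show "emeasure w V > 0" by simp
    qed
  qed
qed

lemma cost_le_const:
  assumes s: "sets w = sets borel" and AE: "AE z in w. z \<in> A \<times> B"
    and le: "\<And>x y. x \<in> A \<Longrightarrow> y \<in> B \<Longrightarrow> c x y \<le> k"
  shows "cost c w \<le> ennreal k * emeasure w UNIV"
proof -
  have "cost c w \<le> (\<integral>\<^sup>+z. ennreal k \<partial>w)"
    unfolding cost_def by (rule nn_integral_mono_AE) (use AE in \<open>auto elim!: eventually_mono intro!: ennreal_leI le\<close>)
  then show ?thesis using sets_eq_imp_space_eq[OF s] by simp
qed

lemma cost_ge_const:
  assumes s: "sets w = sets borel" and AE: "AE z in w. z \<in> A \<times> B"
    and le: "\<And>x y. x \<in> A \<Longrightarrow> y \<in> B \<Longrightarrow> k \<le> c x y"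
  shows "ennreal k * emeasure w UNIV \<le> cost c w"
proof -
  have "(\<integral>\<^sup>+z. ennreal k \<partial>w) \<le> cost c w"
    unfolding cost_def by (rule nn_integral_mono_AE) (use AE in \<open>auto elim!: eventually_mono intro!: ennreal_leI le\<close>)
  then show ?thesis using sets_eq_imp_space_eq[OF s] by simp
qed

lemma emeasure_density_Times_zero:
  assumes s: "sets w = sets borel" and A: "A \<in> sets borel" and B: "B \<in> sets borel"
  shows "emeasure (Xm (density w (\<lambda>z. k * indicator (A \<times> B) z))) (- A) = 0"
    and "emeasure (Ym (density w (\<lambda>z. k * indicator (A \<times> B) z))) (- B) = 0"
proof -
  have m: "(\<lambda>z. k * indicator (A \<times> B) z) \<in> borel_measurable w"
    by (rule sets_eq_borel_measurableI[OF s]) (use A B in measurable)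
  have sd: "sets (density w (\<lambda>z. k * indicator (A \<times> B) z)) = sets borel" using s by simp
  have z: "k * indicator (A \<times> B) z * indicator ((- A) \<times> UNIV) z = 0" for z
    by (auto simp: indicator_def)
  have "emeasure (density w (\<lambda>z. k * indicator (A \<times> B) z)) ((- A) \<times> UNIV) = 0"
    using A B m s by (subst emeasure_density) (auto simp only: z nn_integral_0_iff intro!: Times_borel borel_comp, simp_all)
  then show "emeasure (Xm (density w (\<lambda>z. k * indicator (A \<times> B) z))) (- A) = 0"
    using emeasure_Xm[OF sd, of "- A"] A by (simp add: borel_comp)
  have z: "k * indicator (A \<times> B) z * indicator (UNIV \<times> (- B)) z = 0" for z
    by (auto simp: indicator_def)
  have "emeasure (density w (\<lambda>z. k * indicator (A \<times> B) z)) (UNIV \<times> (- B)) = 0"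
    using A B m s by (subst emeasure_density) (auto simp only: z nn_integral_0_iff intro!: Times_borel borel_comp, simp_all)
  then show "emeasure (Ym (density w (\<lambda>z. k * indicator (A \<times> B) z))) (- B) = 0"
    using emeasure_Ym[OF sd, of "- B"] B by (simp add: borel_comp)
qed

text \<open>Cyclical monotonicity for two points. If the inequality failed, equal masses cut from
  small boxes around the two points could be recombined crosswise by product measures. The marginals
  would stay the same and the cost would drop, against optimality.\<close>

theorem optimal_two_monotone:
  fixes w :: "('a::{metric_space,second_countable_topology} \<times> 'b::{metric_space,second_countable_topology}) measure"
  assumes opt: "optimal c w" and fin: "emeasure w UNIV < \<infinity>" "cost c w < \<infinity>"
    and c: "continuous_on UNIV (\<lambda>z. c (fst z) (snd z))" "\<And>x y. 0 \<le> c x y"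
    and z: "(x, y) \<in> msupport w" "(x', y') \<in> msupport w"
  shows "c x y + c x' y' \<le> c x y' + c x' y"
proof (rule ccontr)
  assume neg: "\<not> c x y + c x' y' \<le> c x y' + c x' y"
  \<comment> \<open>Divided by 5: each of the four costs is known only up to \<delta> on its box,
    and a surplus of \<delta> must remain.\<close>
  define \<delta> where "\<delta> = (c x y + c x' y' - (c x y' + c x' y)) / 5"
  have \<delta>: "\<delta> > 0" "c x y + c x' y' = c x y' + c x' y + 5 * \<delta>" using neg by (simp_all add: \<delta>_def field_simps)
  have s: "sets w = sets borel" using opt by (simp add: optimal_def)
  have nb: "\<exists>U V. open U \<and> open V \<and> p \<in> U \<and> q \<in> V \<and> (\<forall>u\<in>U. \<forall>v\<in>V. \<bar>c u v - c p q\<bar> < \<delta>)" for p q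
  proof -
    have "open ((\<lambda>z. c (fst z) (snd z)) -` {c p q - \<delta> <..< c p q + \<delta>})"
      using c(1) by (intro open_vimage) auto
    moreover have "(p, q) \<in> (\<lambda>z. c (fst z) (snd z)) -` {c p q - \<delta> <..< c p q + \<delta>}" using \<delta> by simp
    ultimately obtain U V where "open U" "open V" "(p, q) \<in> U \<times> V"
      "U \<times> V \<subseteq> (\<lambda>z. c (fst z) (snd z)) -` {c p q - \<delta> <..< c p q + \<delta>}"
      by (rule open_prod_elim)
    then show ?thesis by (intro exI[of _ U] exI[of _ V]) (fastforce simp: abs_less_iff)
  qed
  obtain U1 V1 where 1: "open U1" "open V1" "x \<in> U1" "y \<in> V1" "\<forall>u\<in>U1. \<forall>v\<in>V1. \<bar>c u v - c x y\<bar> < \<delta>"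
    using nb[of x y] by (elim exE conjE) (rule that; assumption)
  obtain U2 V2 where 2: "open U2" "open V2" "x' \<in> U2" "y' \<in> V2" "\<forall>u\<in>U2. \<forall>v\<in>V2. \<bar>c u v - c x' y'\<bar> < \<delta>"
    using nb[of x' y'] by (elim exE conjE) (rule that; assumption)
  obtain U3 V3 where 3: "open U3" "open V3" "x \<in> U3" "y' \<in> V3" "\<forall>u\<in>U3. \<forall>v\<in>V3. \<bar>c u v - c x y'\<bar> < \<delta>"
    using nb[of x y'] by (elim exE conjE) (rule that; assumption)
  obtain U4 V4 where 4: "open U4" "open V4" "x' \<in> U4" "y \<in> V4" "\<forall>u\<in>U4. \<forall>v\<in>V4. \<bar>c u v - c x' y\<bar> < \<delta>"
    using nb[of x' y] by (elim exE conjE) (rule that; assumption)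
  define U V U' V' where D: "U = U1 \<inter> U3" "V = V1 \<inter> V4" "U' = U2 \<inter> U4" "V' = V2 \<inter> V3"
  define A B where AB: "A = U \<times> V" "B = U' \<times> V'"
  have o: "open U" "open V" "open U'" "open V'" using 1 2 3 4 by (auto simp: D)
  have ob: "U \<in> sets borel" "V \<in> sets borel" "U' \<in> sets borel" "V' \<in> sets borel" using o by auto
  have b: "A \<in> sets borel" "B \<in> sets borel" unfolding AB using o by (auto intro!: Times_borel)
  have cm: "(\<lambda>z. ennreal (c (fst z) (snd z))) \<in> borel_measurable borel"
    by (rule measurable_compose[OF borel_measurable_continuous_onI[OF c(1)] measurable_ennreal])
  have mb: "f \<in> borel_measurable borel \<Longrightarrow> f \<in> borel_measurable w" for f :: "'a \<times> 'b \<Rightarrow> ennreal"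
    by (rule sets_eq_borel_measurableI[OF s])
  have "emeasure w A > 0" "emeasure w B > 0"
    using z 1 2 3 4 o unfolding msupport_def AB by (auto simp: D open_Times)
  moreover have "emeasure w A < \<infinity>" "emeasure w B < \<infinity>"
    using fin(1) emeasure_mono[of A UNIV w] emeasure_mono[of B UNIV w] s by (auto simp: less_top[symmetric] top_unique)
  ultimately obtain a b where a: "emeasure w A = ennreal a" "0 < a" and b': "emeasure w B = ennreal b" "0 < b"
    by (metis ennreal_cases ennreal_less_zero_iff infinity_ennreal_def less_irrefl)
  \<comment> \<open>Both boxes must give up the same mass. The half keeps either relative weight at
    most 1/2, so the remaining weight \<open>h\<close> is nonnegative even where the boxes
    overlap.\<close>
  define k where "k = min a b / 2"
  have k: "0 < k" "k / a \<le> 1/2" "k / b \<le> 1/2" using a b' by (auto simp: k_def divide_simps)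
  define f g h :: "'a \<times> 'b \<Rightarrow> ennreal" where
    fgh: "f = (\<lambda>z. ennreal (k / a) * indicator A z)" "g = (\<lambda>z. ennreal (k / b) * indicator B z)"
      "h = (\<lambda>z. ennreal (1 - k / a * indicator A z - k / b * indicator B z))"
  have fgh1: "h z + (f z + g z) = 1" for z
  proof -
    have i: "0 \<le> 1 - k / a * indicator A z - k / b * indicator B z"
    proof -
      have "k / a * indicator A z \<le> 1/2" using k(2) by (cases "z \<in> A") simp_all
      moreover have "k / b * indicator B z \<le> 1/2" using k(3) by (cases "z \<in> B") simp_all
      ultimately show ?thesis by linarith
    qed
    have ii: "f z = ennreal (k / a * indicator A z)" "g z = ennreal (k / b * indicator B z)"
      using k a b' by (auto simp: fgh indicator_def)
    show ?thesis unfolding ii unfolding fgh using i k a b'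
      by (simp add: ennreal_plus[symmetric] del: ennreal_plus)
  qed
  have fghm [measurable]: "f \<in> borel_measurable borel" "g \<in> borel_measurable borel" "h \<in> borel_measurable borel"
    unfolding fgh using b by measurable
  have split: "(\<integral>\<^sup>+z. q z \<partial>w) = (\<integral>\<^sup>+z. h z * q z \<partial>w) + (\<integral>\<^sup>+z. f z * q z \<partial>w) + (\<integral>\<^sup>+z. g z * q z \<partial>w)"
    if [measurable]: "q \<in> borel_measurable borel" for q
  proof -
    have "(\<integral>\<^sup>+z. q z \<partial>w) = (\<integral>\<^sup>+z. h z * q z + f z * q z + g z * q z \<partial>w)"
    proof (rule nn_integral_cong)
      fix z show "q z = h z * q z + f z * q z + g z * q z"
        using fgh1[of z] by (metis add.assoc distrib_right mult_1)
    qed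
    also have "\<dots> = (\<integral>\<^sup>+z. h z * q z + f z * q z \<partial>w) + (\<integral>\<^sup>+z. g z * q z \<partial>w)"
      by (rule nn_integral_add; rule mb; measurable)
    also have "(\<integral>\<^sup>+z. h z * q z + f z * q z \<partial>w) = (\<integral>\<^sup>+z. h z * q z \<partial>w) + (\<integral>\<^sup>+z. f z * q z \<partial>w)"
      by (rule nn_integral_add; rule mb; measurable)
    finally show ?thesis .
  qed
  define \<alpha> \<beta> where ab: "\<alpha> = density w f" "\<beta> = density w g"
  have abs: "sets \<alpha> = sets borel" "sets \<beta> = sets borel" by (auto simp: ab s)
  have ma: "emeasure \<alpha> UNIV = ennreal k" "emeasure \<beta> UNIV = ennreal k"
  proof -
    have "emeasure \<alpha> UNIV = (\<integral>\<^sup>+z. ennreal (k / a) * indicator A z \<partial>w)"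
      unfolding ab fgh(1) using b s by (subst emeasure_density) (auto intro!: mb)
    also have "\<dots> = ennreal k" using b s a k by (subst nn_integral_cmult_indicator) (auto simp: ennreal_mult[symmetric])
    finally show "emeasure \<alpha> UNIV = ennreal k" .
    have "emeasure \<beta> UNIV = (\<integral>\<^sup>+z. ennreal (k / b) * indicator B z \<partial>w)"
      unfolding ab fgh(2) using b s by (subst emeasure_density) (auto intro!: mb)
    also have "\<dots> = ennreal k" using b s b' k by (subst nn_integral_cmult_indicator) (auto simp: ennreal_mult[symmetric])
    finally show "emeasure \<beta> UNIV = ennreal k" .
  qed
  have mXY: "emeasure (Xm \<alpha>) UNIV = ennreal k" "emeasure (Ym \<beta>) UNIV = ennreal k"
     "emeasure (Xm \<beta>) UNIV = ennreal k" "emeasure (Ym \<alpha>) UNIV = ennreal k"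
    using ma by (simp_all add: emeasure_Xm emeasure_Ym abs)
  have C1: "coupling (Xm \<alpha>) (Ym \<beta>) (nprod (Xm \<alpha>) (Ym \<beta>))" and C2: "coupling (Xm \<beta>) (Ym \<alpha>) (nprod (Xm \<beta>) (Ym \<alpha>))"
    by (intro coupling_nprod; simp add: mXY)+
  define P where "P i = (if i = (0::nat) then density w h else if i = 1 then nprod (Xm \<alpha>) (Ym \<beta>) else nprod (Xm \<beta>) (Ym \<alpha>))" for i
  have Ps: "sets (P i) = sets borel" for i using C1 C2 s by (auto simp: P_def coupling_def)
  define w' where "w' = msum {0,1,2} P"
  have w'I: "(\<integral>\<^sup>+z. q z \<partial>w') = (\<integral>\<^sup>+z. h z * q z \<partial>w) + (\<integral>\<^sup>+z. q z \<partial>nprod (Xm \<alpha>) (Ym \<beta>)) + (\<integral>\<^sup>+z. q z \<partial>nprod (Xm \<beta>) (Ym \<alpha>))"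
    if q: "q \<in> borel_measurable borel" for q
    unfolding w'_def using q fghm by (subst nn_integral_msum[OF Ps q]) (auto simp: P_def nn_integral_density mb add.assoc)
  have ns: "sets (nprod (Xm \<alpha>) (Ym \<beta>)) = sets borel" "sets (nprod (Xm \<beta>) (Ym \<alpha>)) = sets borel"
    using C1 C2 by (auto simp: coupling_def)
  have w's: "sets w' = sets borel" by (simp add: w'_def)
  have da: "(\<integral>\<^sup>+z. q z \<partial>\<alpha>) = (\<integral>\<^sup>+z. f z * q z \<partial>w)" "(\<integral>\<^sup>+z. q z \<partial>\<beta>) = (\<integral>\<^sup>+z. g z * q z \<partial>w)"
    if "q \<in> borel_measurable borel" for q
    unfolding ab using that fghm by (auto intro!: nn_integral_density mb)
  have "coupling (Xm w) (Ym w) w'"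
    unfolding coupling_def
  proof (intro conjI w's)
    show "Xm w' = Xm w"
    proof (rule measure_eqI)
      fix S assume "S \<in> sets (Xm w')"
      then have S: "S \<in> sets borel" by simp
      let ?i = "\<lambda>z :: 'a \<times> 'b. indicator S (fst z) :: ennreal"
      have im: "?i \<in> borel_measurable borel" using S by measurable
      note e = emeasure_Xm_nn_integral[OF _ S]
      have "(\<integral>\<^sup>+z. ?i z \<partial>nprod (Xm \<alpha>) (Ym \<beta>)) = emeasure (Xm \<alpha>) S"
        using e[OF ns(1)] C1 by (simp add: coupling_def)
      also have "\<dots> = (\<integral>\<^sup>+z. f z * ?i z \<partial>w)" using e[OF abs(1)] da(1)[OF im] by simp
      finally have A: "(\<integral>\<^sup>+z. ?i z \<partial>nprod (Xm \<alpha>) (Ym \<beta>)) = (\<integral>\<^sup>+z. f z * ?i z \<partial>w)" .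
      have "(\<integral>\<^sup>+z. ?i z \<partial>nprod (Xm \<beta>) (Ym \<alpha>)) = emeasure (Xm \<beta>) S"
        using e[OF ns(2)] C2 by (simp add: coupling_def)
      also have "\<dots> = (\<integral>\<^sup>+z. g z * ?i z \<partial>w)" using e[OF abs(2)] da(2)[OF im] by simp
      finally have B: "(\<integral>\<^sup>+z. ?i z \<partial>nprod (Xm \<beta>) (Ym \<alpha>)) = (\<integral>\<^sup>+z. g z * ?i z \<partial>w)" .
      show "emeasure (Xm w') S = emeasure (Xm w) S"
        using e[OF w's] e[OF s] w'I[OF im] split[OF im] A B by simp
    qed simp
    show "Ym w' = Ym w"
    proof (rule measure_eqI)
      fix S assume "S \<in> sets (Ym w')"
      then have S: "S \<in> sets borel" by simp
      let ?i = "\<lambda>z :: 'a \<times> 'b. indicator S (snd z) :: ennreal"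
      have im: "?i \<in> borel_measurable borel" using S by measurable
      note e = emeasure_Ym_nn_integral[OF _ S]
      have "(\<integral>\<^sup>+z. ?i z \<partial>nprod (Xm \<alpha>) (Ym \<beta>)) = emeasure (Ym \<beta>) S"
        using e[OF ns(1)] C1 by (simp add: coupling_def)
      also have "\<dots> = (\<integral>\<^sup>+z. g z * ?i z \<partial>w)" using e[OF abs(2)] da(2)[OF im] by simp
      finally have A: "(\<integral>\<^sup>+z. ?i z \<partial>nprod (Xm \<alpha>) (Ym \<beta>)) = (\<integral>\<^sup>+z. g z * ?i z \<partial>w)" .
      have "(\<integral>\<^sup>+z. ?i z \<partial>nprod (Xm \<beta>) (Ym \<alpha>)) = emeasure (Ym \<alpha>) S"
        using e[OF ns(2)] C2 by (simp add: coupling_def)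
      also have "\<dots> = (\<integral>\<^sup>+z. f z * ?i z \<partial>w)" using e[OF abs(1)] da(1)[OF im] by simp
      finally have B: "(\<integral>\<^sup>+z. ?i z \<partial>nprod (Xm \<beta>) (Ym \<alpha>)) = (\<integral>\<^sup>+z. f z * ?i z \<partial>w)" .
      show "emeasure (Ym w') S = emeasure (Ym w) S"
        using e[OF w's] e[OF s] w'I[OF im] split[OF im] A B by (simp add: ac_simps)
    qed simp
  qed
  then have le: "cost c w \<le> cost c w'" using opt by (simp add: optimal_def)
  define R where "R = (\<integral>\<^sup>+z. h z * ennreal (c (fst z) (snd z)) \<partial>w)"
  have "cost c w = R + cost c \<alpha> + cost c \<beta>"
    unfolding cost_def R_def using split[OF cm] da[OF cm] by simp
  moreover have "cost c w' = R + cost c (nprod (Xm \<alpha>) (Ym \<beta>)) + cost c (nprod (Xm \<beta>) (Ym \<alpha>))"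
    unfolding cost_def R_def using w'I[OF cm] by simp
  moreover have "R < \<infinity>" using fin(2) calculation(1) by (auto simp: less_top[symmetric])
  ultimately have main: "cost c \<alpha> + cost c \<beta> \<le> cost c (nprod (Xm \<alpha>) (Ym \<beta>)) + cost c (nprod (Xm \<beta>) (Ym \<alpha>))"
    using le by (auto simp: add.assoc ennreal_add_left_cancel_le)
  have n0: "emeasure (Xm \<alpha>) (- U) = 0" "emeasure (Ym \<alpha>) (- V) = 0" "emeasure (Xm \<beta>) (- U') = 0" "emeasure (Ym \<beta>) (- V') = 0"
    unfolding ab fgh AB using ob by (auto intro!: emeasure_density_Times_zero s)
  have cXY: "coupling (Xm \<alpha>) (Ym \<alpha>) \<alpha>" "coupling (Xm \<beta>) (Ym \<beta>) \<beta>" by (simp_all add: coupling_def abs)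
  \<comment> \<open>Clipping at 0 keeps the passage to \<open>ennreal\<close> and back faithful; the
    bound stays valid because \<open>c\<close> is nonnegative.\<close>
  have low: "ennreal (k * max 0 (c x y - \<delta>)) \<le> cost c \<alpha>"
  proof -
    have "ennreal (max 0 (c x y - \<delta>)) * emeasure \<alpha> UNIV \<le> cost c \<alpha>"
      using coupling_concentrated_AE[OF cXY(1) ob(1) n0(1) ob(2) n0(2)]
    proof (rule cost_ge_const[OF abs(1)])
      fix p q assume "p \<in> U" "q \<in> V"
      then have "\<bar>c p q - c x y\<bar> < \<delta>" using 1 by (auto simp: D)
      then show "max 0 (c x y - \<delta>) \<le> c p q" using c(2)[of p q] by auto
    qed
    then show ?thesis using k by (simp add: ma ennreal_mult' mult.commute)
  qed
  have low': "ennreal (k * max 0 (c x' y' - \<delta>)) \<le> cost c \<beta>"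
  proof -
    have "ennreal (max 0 (c x' y' - \<delta>)) * emeasure \<beta> UNIV \<le> cost c \<beta>"
      using coupling_concentrated_AE[OF cXY(2) ob(3) n0(3) ob(4) n0(4)]
    proof (rule cost_ge_const[OF abs(2)])
      fix p q assume "p \<in> U'" "q \<in> V'"
      then have "\<bar>c p q - c x' y'\<bar> < \<delta>" using 2 by (auto simp: D)
      then show "max 0 (c x' y' - \<delta>) \<le> c p q" using c(2)[of p q] by auto
    qed
    then show ?thesis using k by (simp add: ma ennreal_mult' mult.commute)
  qed
  have up: "cost c (nprod (Xm \<alpha>) (Ym \<beta>)) \<le> ennreal (k * (c x y' + \<delta>))"
  proof -
    have "cost c (nprod (Xm \<alpha>) (Ym \<beta>)) \<le> ennreal (c x y' + \<delta>) * emeasure (nprod (Xm \<alpha>) (Ym \<beta>)) UNIV"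
      using coupling_concentrated_AE[OF C1 ob(1) n0(1) ob(4) n0(4)]
    proof (rule cost_le_const[OF ns(1)])
      fix p q assume "p \<in> U" "q \<in> V'"
      then have "\<bar>c p q - c x y'\<bar> < \<delta>" using 3 by (auto simp: D)
      then show "c p q \<le> c x y' + \<delta>" by auto
    qed
    also have "emeasure (nprod (Xm \<alpha>) (Ym \<beta>)) UNIV = ennreal k" using coupling_mass(1)[OF C1] mXY by simp
    finally show ?thesis using k \<delta> c(2)[of x y'] by (simp add: ennreal_mult' mult.commute)
  qed
  have up': "cost c (nprod (Xm \<beta>) (Ym \<alpha>)) \<le> ennreal (k * (c x' y + \<delta>))"
  proof -
    have "cost c (nprod (Xm \<beta>) (Ym \<alpha>)) \<le> ennreal (c x' y + \<delta>) * emeasure (nprod (Xm \<beta>) (Ym \<alpha>)) UNIV"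
      using coupling_concentrated_AE[OF C2 ob(3) n0(3) ob(2) n0(2)]
    proof (rule cost_le_const[OF ns(2)])
      fix p q assume "p \<in> U'" "q \<in> V"
      then have "\<bar>c p q - c x' y\<bar> < \<delta>" using 4 by (auto simp: D)
      then show "c p q \<le> c x' y + \<delta>" by auto
    qed
    also have "emeasure (nprod (Xm \<beta>) (Ym \<alpha>)) UNIV = ennreal k" using coupling_mass(1)[OF C2] mXY by simp
    finally show ?thesis using k \<delta> c(2)[of x' y] by (simp add: ennreal_mult' mult.commute)
  qed
  have "ennreal (k * max 0 (c x y - \<delta>)) + ennreal (k * max 0 (c x' y' - \<delta>)) \<le> ennreal (k * (c x y' + \<delta>)) + ennreal (k * (c x' y + \<delta>))"
    using add_mono[OF low low'] add_mono[OF up up'] main by (meson order_trans)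
  then have "k * max 0 (c x y - \<delta>) + k * max 0 (c x' y' - \<delta>) \<le> k * (c x y' + \<delta>) + k * (c x' y + \<delta>)"
    using k \<delta> c(2)[of x y'] c(2)[of x' y] by (simp add: ennreal_plus[symmetric] del: ennreal_plus)
  then have "k * (max 0 (c x y - \<delta>) + max 0 (c x' y' - \<delta>)) \<le> k * (c x y' + \<delta> + c x' y + \<delta>)"
    by (simp add: algebra_simps)
  then have "max 0 (c x y - \<delta>) + max 0 (c x' y' - \<delta>) \<le> c x y' + \<delta> + c x' y + \<delta>"
    using k(1) by (rule mult_left_le_imp_le)
  then show False using \<delta> by (auto simp: max_def split: if_splits)
qed

text \<open>Lebesgue measure is translation invariant, so the measure of \<open>B\<close> is the
  average of the measures of its translates along \<open>e\<close>. By Fubini this is an integral of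
  the lengths of countable sets. Averaging over \<open>t\<close> in the unit interval avoids
  splitting the space into coordinates.\<close>

lemma negligible_if_lines_countable:
  fixes B :: "'a::euclidean_space set"
  assumes B [measurable]: "B \<in> sets borel" and lines: "\<And>y. countable {t::real. y + t *\<^sub>R e \<in> B}"
  shows "emeasure lborel B = 0"
proof -
  have mB [measurable]: "(indicator B :: 'a \<Rightarrow> ennreal) \<in> borel_measurable borel" by measurable
  have mp: "(\<lambda>(y, t). indicator B (y + t *\<^sub>R e) * indicator {0..1} t :: ennreal)
      \<in> borel_measurable (lborel \<Otimes>\<^sub>M (lborel :: real measure))"
    by measurable
  have "emeasure lborel B = (\<integral>\<^sup>+t. emeasure lborel B * indicator {0..1::real} t \<partial>lborel)"
    by (simp add: nn_integral_cmult_indicator)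
  also have "\<dots> = (\<integral>\<^sup>+t. (\<integral>\<^sup>+y. indicator B (y + t *\<^sub>R e) * indicator {0..1} t \<partial>lborel) \<partial>(lborel :: real measure))"
  proof (rule nn_integral_cong)
    fix t :: real
    have "(\<integral>\<^sup>+y. indicator B (t *\<^sub>R e + y) \<partial>lborel) = (\<integral>\<^sup>+y. indicator B y \<partial>distr lborel borel ((+) (t *\<^sub>R e)))"
      by (subst nn_integral_distr) auto
    also have "\<dots> = emeasure lborel B" by (simp add: lborel_distr_plus)
    finally have "(\<integral>\<^sup>+y. indicator B (y + t *\<^sub>R e) \<partial>lborel) = emeasure lborel B" by (simp add: add.commute)
    then show "emeasure lborel B * indicator {0..1} t = (\<integral>\<^sup>+y. indicator B (y + t *\<^sub>R e) * indicator {0..1} t \<partial>lborel)"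
      by (subst nn_integral_multc) auto
  qed
  also have "\<dots> = (\<integral>\<^sup>+y. (\<integral>\<^sup>+t. indicator B (y + t *\<^sub>R e) * indicator {0..1} t \<partial>(lborel :: real measure)) \<partial>lborel)"
    by (rule lborel_pair.Fubini'[OF mp])
  also have "\<dots> = (\<integral>\<^sup>+y. 0 \<partial>(lborel :: 'a measure))"
  proof (rule nn_integral_cong)
    fix y :: 'a
    have "AE t in lborel. t \<notin> {t::real. y + t *\<^sub>R e \<in> B}"
      using countable_imp_null_set_lborel[OF lines[of y]] by (rule AE_not_in)
    then have "(\<integral>\<^sup>+t. indicator B (y + t *\<^sub>R e) * indicator {0..1} t \<partial>(lborel :: real measure)) = (\<integral>\<^sup>+t. 0 \<partial>(lborel :: real measure))"
      by (intro nn_integral_cong_AE) auto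
    then show "(\<integral>\<^sup>+t. indicator B (y + t *\<^sub>R e) * indicator {0..1} t \<partial>(lborel :: real measure)) = 0" by simp
  qed
  finally show ?thesis by simp
qed

section \<open>The twist condition and branching points\<close>

locale smooth_cost =
  fixes c :: "'a::euclidean_space \<Rightarrow> 'a \<Rightarrow> real" and D :: "'a \<times> 'a \<Rightarrow> ('a \<times> 'a) \<Rightarrow>\<^sub>L real"
  assumes c_nonneg: "\<And>x y. 0 \<le> c x y" and c_sym: "\<And>x y. c x y = c y x"
    and c_deriv: "\<And>p. ((\<lambda>q. c (fst q) (snd q)) has_derivative blinfun_apply (D p)) (at p)"
    and D_cont: "continuous_on UNIV D"
    and twist: "\<And>x0. inj (\<lambda>y. frechet_derivative (\<lambda>x. c x y) (at x0))"
begin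

lemma c_cont: "continuous_on UNIV (\<lambda>z. c (fst z) (snd z))"
  using c_deriv by (meson continuous_at_imp_continuous_on has_derivative_continuous)

lemma partial_deriv: "((\<lambda>z. c z x) has_derivative (\<lambda>h. D (y, x) (h, 0))) (at y)"
proof -
  have "((\<lambda>z. (z, x)) has_derivative (\<lambda>h. (h, 0))) (at y)"
    by (intro derivative_eq_intros) auto
  from has_derivative_compose[OF this c_deriv] show ?thesis by simp
qed

text \<open>For \<open>z = (x, y)\<close> this differentiates the first slot of \<open>c\<close> at
  \<open>(y, x)\<close>, which by symmetry is the derivative of \<open>c x\<close> at
  \<open>y\<close>. The twist condition speaks of the first slot, whereas the graph property is
  wanted over the second marginal.\<close>

definition ddir :: "'a \<Rightarrow> 'a \<times> 'a \<Rightarrow> real" where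
  "ddir e z = D (snd z, fst z) (e, 0)"

lemma ddir_cont: "continuous_on UNIV (ddir e)"
proof -
  have "continuous_on UNIV (\<lambda>z :: 'a \<times> 'a. D (snd z, fst z))"
    by (rule continuous_on_compose2[OF D_cont]) (auto intro!: continuous_intros)
  then show ?thesis unfolding ddir_def by (intro continuous_intros)
qed

lemma mean_value_dir:
  assumes "0 < \<tau>"
  obtains \<theta> where "0 < \<theta>" "\<theta> < \<tau>" "c x (y + \<tau> *\<^sub>R e) - c x y = \<tau> * ddir e (x, y + \<theta> *\<^sub>R e)"
proof -
  have "((\<lambda>t. c (y + t *\<^sub>R e) x) has_real_derivative ddir e (x, y + t *\<^sub>R e)) (at t)" for t
  proof -
    have "((\<lambda>t. y + t *\<^sub>R e) has_derivative (\<lambda>h. h *\<^sub>R e)) (at t)"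
      by (intro derivative_eq_intros) auto
    from has_derivative_compose[OF this partial_deriv]
    have "((\<lambda>t. c (y + t *\<^sub>R e) x) has_derivative (\<lambda>h. D (y + t *\<^sub>R e, x) (h *\<^sub>R e, 0))) (at t)" .
    moreover have "(\<lambda>h. D (y + t *\<^sub>R e, x) (h *\<^sub>R e, 0)) = (*) (ddir e (x, y + t *\<^sub>R e))"
    proof
      fix h :: real
      have "blinfun_apply (D (y + t *\<^sub>R e, x)) (h *\<^sub>R (e, 0)) = h *\<^sub>R D (y + t *\<^sub>R e, x) (e, 0)"
        by (rule blinfun.scaleR_right)
      then show "D (y + t *\<^sub>R e, x) (h *\<^sub>R e, 0) = ddir e (x, y + t *\<^sub>R e) * h"
        by (simp add: ddir_def mult.commute)
    qed
    ultimately show ?thesis by (simp add: has_field_derivative_def)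
  qed
  then obtain \<theta> where "0 < \<theta>" "\<theta> < \<tau>"
    "c (y + \<tau> *\<^sub>R e) x - c (y + 0 *\<^sub>R e) x = (\<tau> - 0) * ddir e (x, y + \<theta> *\<^sub>R e)"
    using MVT2[of 0 \<tau> "\<lambda>t. c (y + t *\<^sub>R e) x" "\<lambda>t. ddir e (x, y + t *\<^sub>R e)"] assms by auto
  then show ?thesis using that by (simp add: c_sym[of x])
qed

text \<open>Points over which \<Gamma> has two branches whose slopes along \<open>e\<close> differ
  by a definite amount. The weak inequality makes the set closed when \<Gamma> is compact, hence
  Borel.\<close>

definition branch_set :: "('a \<times> 'a) set \<Rightarrow> 'a \<Rightarrow> real \<Rightarrow> 'a set" where
  "branch_set \<Gamma> e \<eta> = {y. \<exists>x x'. (x, y) \<in> \<Gamma> \<and> (x', y) \<in> \<Gamma> \<and> ddir e (x, y) + \<eta> \<le> ddir e (x', y)}"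

lemma closed_branch_set:
  assumes "compact \<Gamma>" shows "closed (branch_set \<Gamma> e \<eta>)"
proof -
  define S where "S = {p \<in> \<Gamma> \<times> \<Gamma>. snd (fst p) = snd (snd p) \<and> ddir e (fst p) + \<eta> \<le> ddir e (snd p)}"
  have d: "continuous_on UNIV (\<lambda>p :: ('a \<times> 'a) \<times> 'a \<times> 'a. ddir e (f p))" if "continuous_on UNIV f" for f
    by (rule continuous_on_compose2[OF ddir_cont that]) simp
  have "closed {p :: ('a \<times> 'a) \<times> 'a \<times> 'a. snd (fst p) = snd (snd p)}"
    by (intro closed_Collect_eq continuous_intros)
  moreover have "closed {p :: ('a \<times> 'a) \<times> 'a \<times> 'a. ddir e (fst p) + \<eta> \<le> ddir e (snd p)}"
    by (intro closed_Collect_le continuous_intros d)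
  ultimately have "compact ((\<Gamma> \<times> \<Gamma>) \<inter> ({p. snd (fst p) = snd (snd p)} \<inter> {p. ddir e (fst p) + \<eta> \<le> ddir e (snd p)}))"
    using assms by (intro compact_Int_closed compact_Times closed_Int)
  also have "\<dots> = S" by (auto simp: S_def)
  finally have "compact S" .
  then have "compact ((\<lambda>p. snd (fst p)) ` S)"
    by (intro compact_continuous_image continuous_intros)
  moreover have "(\<lambda>p. snd (fst p)) ` S = branch_set \<Gamma> e \<eta>"
    by (force simp: S_def branch_set_def image_iff)
  ultimately show ?thesis by (simp add: compact_imp_closed)
qed

text \<open>Monotonicity makes the directional derivatives along a line drop by a fixed amount
  from one branching point to the next nearby one, so that a line carries only countably many of them.\<close>

lemma countable_branch_line:
  assumes \<Gamma>: "compact \<Gamma>" and \<eta>: "0 < \<eta>"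
    and mono: "\<And>x y x' y'. (x, y) \<in> \<Gamma> \<Longrightarrow> (x', y') \<in> \<Gamma> \<Longrightarrow> c x y + c x' y' \<le> c x y' + c x' y"
  shows "countable {t::real. y0 + t *\<^sub>R e \<in> branch_set \<Gamma> e \<eta>}"
proof -
  obtain R where R: "\<And>z. z \<in> \<Gamma> \<Longrightarrow> norm z \<le> R"
    using compact_imp_bounded[OF \<Gamma>] by (auto simp: bounded_iff)
  have R1: "norm x \<le> R \<and> norm y \<le> R" if "(x, y) \<in> \<Gamma>" for x y
    using R[OF that] norm_fst_le[of "(x,y)"] norm_snd_le[of "(x,y)"] by (simp add: norm_fst_le norm_snd_le) (meson norm_fst_le norm_snd_le order_trans)
  \<comment> \<open>The mean value points used below lie between second coordinates of \<Gamma>, not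
    among them; hence a convex compact set in place of the projection of \<Gamma>.\<close>
  define K where "K = cball (0::'a) R \<times> cball (0::'a) R"
  have "uniformly_continuous_on K (ddir e)" unfolding K_def
    by (intro compact_uniformly_continuous compact_Times compact_cball continuous_on_subset[OF ddir_cont]) auto
  then obtain \<delta> where \<delta>: "\<delta> > 0" "\<And>z z'. z \<in> K \<Longrightarrow> z' \<in> K \<Longrightarrow> dist z' z < \<delta> \<Longrightarrow> dist (ddir e z') (ddir e z) < \<eta> / 4"
    using \<eta> unfolding uniformly_continuous_on_def by (metis zero_less_divide_iff zero_less_numeral)
  define T where "T = {t::real. y0 + t *\<^sub>R e \<in> branch_set \<Gamma> e \<eta>}"
  have "\<exists>x x'. (x, y0 + t *\<^sub>R e) \<in> \<Gamma> \<and> (x', y0 + t *\<^sub>R e) \<in> \<Gamma> \<and>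
      ddir e (x, y0 + t *\<^sub>R e) + \<eta> \<le> ddir e (x', y0 + t *\<^sub>R e)" if "t \<in> T" for t
    using that by (auto simp: T_def branch_set_def)
  then obtain lo hi where lh: "\<And>t. t \<in> T \<Longrightarrow> (lo t, y0 + t *\<^sub>R e) \<in> \<Gamma>" "\<And>t. t \<in> T \<Longrightarrow> (hi t, y0 + t *\<^sub>R e) \<in> \<Gamma>"
    "\<And>t. t \<in> T \<Longrightarrow> ddir e (lo t, y0 + t *\<^sub>R e) + \<eta> \<le> ddir e (hi t, y0 + t *\<^sub>R e)"
    by metis
  define H where "H t = ddir e (hi t, y0 + t *\<^sub>R e)" for t
  \<comment> \<open>The 1 keeps the denominator positive when \<open>e\<close> is 0.\<close>
  define \<delta>' where "\<delta>' = \<delta> / (norm e + 1)"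
  have \<delta>': "\<delta>' > 0" using \<delta>(1) by (simp add: \<delta>'_def add_nonneg_pos)
  \<comment> \<open>Monotonicity is applied to the lower branch at \<open>t1\<close> and the upper
    branch at \<open>t2\<close>, and the mean value theorem turns it into a comparison of slopes.
    Moving each slope to its own point costs \<eta>/4, while the two branches at \<open>t1\<close>
    are \<eta> apart, which leaves \<eta>/2.\<close>
  have drop: "H t2 + \<eta> / 2 \<le> H t1" if t: "t1 \<in> T" "t2 \<in> T" "t1 < t2" "t2 - t1 < \<delta>'" for t1 t2
  proof -
    define y1 y2 where y: "y1 = y0 + t1 *\<^sub>R e" "y2 = y0 + t2 *\<^sub>R e"
    define \<tau> where "\<tau> = t2 - t1"
    have \<tau>: "\<tau> > 0" "y2 = y1 + \<tau> *\<^sub>R e" using t by (auto simp: y \<tau>_def algebra_simps)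
    have ne: "\<tau> * norm e < \<delta>"
    proof -
      have "\<tau> * norm e \<le> \<tau> * (norm e + 1)" using \<tau> by (intro mult_left_mono) auto
      also have "\<dots> < \<delta>' * (norm e + 1)" using t by (intro mult_strict_right_mono) (auto simp: \<tau>_def add_nonneg_pos)
      also have "\<dots> = \<delta>" unfolding \<delta>'_def using norm_ge_zero[of e] by (simp add: add_nonneg_eq_0_iff)
      finally show ?thesis .
    qed
    obtain \<theta> where \<theta>: "0 < \<theta>" "\<theta> < \<tau>" "c (hi t2) y2 - c (hi t2) y1 = \<tau> * ddir e (hi t2, y1 + \<theta> *\<^sub>R e)"
      using mean_value_dir[OF \<tau>(1), of "hi t2" y1 e] \<tau>(2) by metis
    obtain \<theta>' where \<theta>': "0 < \<theta>'" "\<theta>' < \<tau>" "c (lo t1) y2 - c (lo t1) y1 = \<tau> * ddir e (lo t1, y1 + \<theta>' *\<^sub>R e)"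
      using mean_value_dir[OF \<tau>(1), of "lo t1" y1 e] \<tau>(2) by metis
    have "c (lo t1) y1 + c (hi t2) y2 \<le> c (lo t1) y2 + c (hi t2) y1"
      using lh t by (intro mono) (auto simp: y)
    then have "\<tau> * ddir e (hi t2, y1 + \<theta> *\<^sub>R e) \<le> \<tau> * ddir e (lo t1, y1 + \<theta>' *\<^sub>R e)"
      using \<theta>(3) \<theta>'(3) by linarith
    then have 1: "ddir e (hi t2, y1 + \<theta> *\<^sub>R e) \<le> ddir e (lo t1, y1 + \<theta>' *\<^sub>R e)"
      using \<tau>(1) by (rule mult_left_le_imp_le)
    have nr: "norm (hi t2) \<le> R" "norm (lo t1) \<le> R" "y1 \<in> cball 0 R" "y2 \<in> cball 0 R"
      using R1[OF lh(2)[OF t(2)]] R1[OF lh(1)[OF t(1)]] by (auto simp: y)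
    have seg: "y1 + u *\<^sub>R e \<in> cball 0 R" if "0 < u" "u < \<tau>" for u
    proof -
      have "y1 + u *\<^sub>R e = (1 - u / \<tau>) *\<^sub>R y1 + (u / \<tau>) *\<^sub>R y2"
        using \<tau> by (simp add: algebra_simps)
      then show ?thesis using convexD_alt[OF convex_cball nr(3,4), of "u / \<tau>"] that by simp
    qed
    have "dist (ddir e (hi t2, y1 + \<theta> *\<^sub>R e)) (ddir e (hi t2, y2)) < \<eta> / 4"
    proof (rule \<delta>(2))
      show "(hi t2, y2) \<in> K" "(hi t2, y1 + \<theta> *\<^sub>R e) \<in> K" using nr seg \<theta> by (auto simp: K_def)
      have "dist (hi t2, y1 + \<theta> *\<^sub>R e) (hi t2, y2) = (\<tau> - \<theta>) * norm e"
        using \<theta> by (simp add: dist_Pair_Pair \<tau>(2) dist_norm scaleR_left_diff_distrib[symmetric])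
      also have "\<dots> \<le> \<tau> * norm e" using \<theta> by (intro mult_right_mono) auto
      finally show "dist (hi t2, y1 + \<theta> *\<^sub>R e) (hi t2, y2) < \<delta>" using ne by simp
    qed
    moreover have "dist (ddir e (lo t1, y1 + \<theta>' *\<^sub>R e)) (ddir e (lo t1, y1)) < \<eta> / 4"
    proof (rule \<delta>(2))
      show "(lo t1, y1) \<in> K" "(lo t1, y1 + \<theta>' *\<^sub>R e) \<in> K" using nr seg \<theta>' by (auto simp: K_def)
      have "dist (lo t1, y1 + \<theta>' *\<^sub>R e) (lo t1, y1) = \<theta>' * norm e"
        using \<theta>' by (simp add: dist_Pair_Pair dist_norm)
      also have "\<dots> \<le> \<tau> * norm e" using \<theta>' by (intro mult_right_mono) auto
      finally show "dist (lo t1, y1 + \<theta>' *\<^sub>R e) (lo t1, y1) < \<delta>" using ne by simp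
    qed
    ultimately have "ddir e (hi t2, y2) \<le> ddir e (lo t1, y1) + \<eta> / 2"
      using 1 unfolding dist_real_def abs_less_iff by linarith
    then show ?thesis using lh(3)[OF t(1)] unfolding H_def y by linarith
  qed
  \<comment> \<open>Two branching parameters in one cell of length \<open>\<delta>'\<close> have
    values \<open>2 * H t / \<eta>\<close> at least 1 apart, so the integer parts of these differ.
    The two floors thus number the branching parameters injectively.\<close>
  have ne: "(\<lfloor>t1 / \<delta>'\<rfloor>, \<lfloor>2 * H t1 / \<eta>\<rfloor>) \<noteq> (\<lfloor>t2 / \<delta>'\<rfloor>, \<lfloor>2 * H t2 / \<eta>\<rfloor>)"
    if t: "t1 \<in> T" "t2 \<in> T" "t1 < t2" for t1 t2
  proof
    assume eq: "(\<lfloor>t1 / \<delta>'\<rfloor>, \<lfloor>2 * H t1 / \<eta>\<rfloor>) = (\<lfloor>t2 / \<delta>'\<rfloor>, \<lfloor>2 * H t2 / \<eta>\<rfloor>)"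
    then have "\<lfloor>t1 / \<delta>'\<rfloor> = \<lfloor>t2 / \<delta>'\<rfloor>" by simp
    then have "t2 / \<delta>' - t1 / \<delta>' < 1" by linarith
    then have "t2 - t1 < \<delta>'" using \<delta>' by (simp add: diff_divide_distrib[symmetric])
    have "(2 * H t2 + \<eta>) / \<eta> \<le> 2 * H t1 / \<eta>"
      using drop[OF t \<open>t2 - t1 < \<delta>'\<close>] \<eta> by (intro divide_right_mono) linarith+
    then have "2 * H t2 / \<eta> + 1 \<le> 2 * H t1 / \<eta>" using \<eta> by (simp add: add_divide_distrib)
    moreover have "\<lfloor>2 * H t1 / \<eta>\<rfloor> = \<lfloor>2 * H t2 / \<eta>\<rfloor>" using eq by simp
    ultimately show False by linarith
  qed
  have "inj_on (\<lambda>t. (\<lfloor>t / \<delta>'\<rfloor>, \<lfloor>2 * H t / \<eta>\<rfloor>)) T"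
  proof (rule inj_onI)
    fix a b assume ab: "a \<in> T" "b \<in> T" "(\<lfloor>a / \<delta>'\<rfloor>, \<lfloor>2 * H a / \<eta>\<rfloor>) = (\<lfloor>b / \<delta>'\<rfloor>, \<lfloor>2 * H b / \<eta>\<rfloor>)"
    show "a = b"
    proof (rule linorder_cases[of a b])
      assume "a < b" then show ?thesis using ne[OF ab(1,2)] ab(3) by simp
    next
      assume "b < a" then show ?thesis using ne[OF ab(2,1)] ab(3) by simp
    qed
  qed
  then show ?thesis unfolding T_def[symmetric] by (rule countable_image_inj_on[rotated]) simp
qed

text \<open>If \<open>y\<close> has two partners in \<Gamma>, the twist condition makes the
  gradients differ, so some basis direction separates them by more than some
  \<open>1 / real (Suc n)\<close>. Countably many null branching sets therefore suffice.\<close>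

theorem branching_null:
  assumes \<Gamma>: "compact \<Gamma>"
    and mono: "\<And>x y x' y'. (x, y) \<in> \<Gamma> \<Longrightarrow> (x', y') \<in> \<Gamma> \<Longrightarrow> c x y + c x' y' \<le> c x y' + c x' y"
  obtains N where "N \<in> sets borel" "emeasure lborel N = 0"
    "\<And>x x' y. (x, y) \<in> \<Gamma> \<Longrightarrow> (x', y) \<in> \<Gamma> \<Longrightarrow> y \<notin> N \<Longrightarrow> x = x'"
proof -
  define N where "N = (\<Union>e\<in>Basis. \<Union>n. branch_set \<Gamma> e (1 / real (Suc n)))"
  have B: "branch_set \<Gamma> e \<eta> \<in> sets borel" for e \<eta> using closed_branch_set[OF \<Gamma>] by (rule borel_closed)
  have "branch_set \<Gamma> e \<eta> \<in> null_sets lborel" if "\<eta> > 0" for e \<eta>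
    using negligible_if_lines_countable[OF B countable_branch_line[OF \<Gamma> that mono]] B by (simp add: null_sets_def)
  then have "N \<in> null_sets lborel" unfolding N_def
    by (intro null_sets_UN'[OF countable_finite[OF finite_Basis]] null_sets_UN) simp
  then have "N \<in> sets borel" "emeasure lborel N = 0" by (auto simp: null_sets_def)
  moreover have "x = x'" if z: "(x, y) \<in> \<Gamma>" "(x', y) \<in> \<Gamma>" "y \<notin> N" for x x' y
  proof -
    have le: "ddir e (p', y) \<le> ddir e (p, y)" if "e \<in> Basis" "(p, y) \<in> \<Gamma>" "(p', y) \<in> \<Gamma>" for e p p'
    proof (rule ccontr)
      assume "\<not> ddir e (p', y) \<le> ddir e (p, y)"
      then obtain n where "1 / real (Suc n) < ddir e (p', y) - ddir e (p, y)"
        using nat_approx_posE[of "ddir e (p', y) - ddir e (p, y)"] by auto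
      then have "y \<in> branch_set \<Gamma> e (1 / real (Suc n))" unfolding branch_set_def using that by fastforce
      then show False using z(3) that(1) by (auto simp: N_def)
    qed
    have eq: "ddir e (x, y) = ddir e (x', y)" if "e \<in> Basis" for e
      using le[OF that z(1,2)] le[OF that z(2,1)] by simp
    have "(\<lambda>h. D (y, x) (h, 0)) = (\<lambda>h. D (y, x') (h, 0))"
    proof (rule linear_eq_stdbasis)
      show "linear (\<lambda>h. D (y, x) (h, 0))" "linear (\<lambda>h. D (y, x') (h, 0))"
        using partial_deriv[of x y] partial_deriv[of x' y] has_derivative_linear by blast+
      fix b :: 'a assume "b \<in> Basis"
      then show "D (y, x) (b, 0) = D (y, x') (b, 0)" using eq by (simp add: ddir_def)
    qed
    then have "frechet_derivative (\<lambda>z. c z x) (at y) = frechet_derivative (\<lambda>z. c z x') (at y)"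
      using frechet_derivative_at[OF partial_deriv[of x y]] frechet_derivative_at[OF partial_deriv[of x' y]] by simp
    then show "x = x'" using twist[of y] by (simp add: inj_def)
  qed
  ultimately show ?thesis using that by blast
qed

end

text \<open>Off \<open>N\<close>, the set \<Gamma> is a graph over the second coordinate, so a
  measure on it is determined by its second marginal. Testing on closed \<open>C\<close> keeps
  everything Borel: the second coordinates that \<Gamma> pairs with \<open>C\<close> form the
  projection of a compact set.\<close>

lemma graph_marginals_eq:
  fixes g0 g1 :: "('a::euclidean_space \<times> 'a) measure"
  assumes s: "sets g0 = sets borel" "sets g1 = sets borel"
    and \<Gamma>: "compact \<Gamma>" "AE z in g0. z \<in> \<Gamma>" "AE z in g1. z \<in> \<Gamma>"
    and N: "N \<in> sets borel" "\<And>x x' y. (x, y) \<in> \<Gamma> \<Longrightarrow> (x', y) \<in> \<Gamma> \<Longrightarrow> y \<notin> N \<Longrightarrow> x = x'"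
    and Y: "Ym g0 = Ym g1" "emeasure (Ym g0) N = 0" and fin: "emeasure g0 UNIV < \<infinity>"
  shows "Xm g0 = Xm g1"
proof (rule measure_eqI_closed)
  show "emeasure (Xm g0) UNIV < \<infinity>" using fin s by (simp add: emeasure_Xm)
  fix C :: "'a set" assume C: "closed C"
  define P where "P = snd ` (\<Gamma> \<inter> (C \<times> UNIV))"
  have "compact P" unfolding P_def using \<Gamma>(1) C
    by (intro compact_continuous_image compact_Int_closed continuous_intros closed_Times) auto
  then have P: "P \<in> sets borel" by (simp add: borel_closed compact_imp_closed)
  have key: "emeasure (Xm g) C = emeasure (Ym g) P"
    if g: "sets g = sets borel" "AE z in g. z \<in> \<Gamma>" "emeasure (Ym g) N = 0" for g
  proof -
    have "emeasure g (UNIV \<times> N) = 0" using g N by (simp add: emeasure_Ym)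
    then have "UNIV \<times> N \<in> null_sets g" using g N by (auto simp: null_sets_def intro!: Times_borel)
    from AE_not_in[OF this] g(2) have "AE z in g. z \<in> C \<times> UNIV \<longleftrightarrow> z \<in> UNIV \<times> P"
    proof eventually_elim
      case (elim z)
      obtain x y where z: "z = (x, y)" by (cases z)
      have "x \<in> C \<longleftrightarrow> y \<in> P"
      proof
        assume "x \<in> C"
        then have "(x, y) \<in> \<Gamma> \<inter> (C \<times> UNIV)" using elim z by simp
        then show "y \<in> P" unfolding P_def by (metis imageI snd_conv)
      next
        assume "y \<in> P"
        then obtain x' where "(x', y) \<in> \<Gamma>" "x' \<in> C" unfolding P_def by auto
        moreover have "x = x'" using N(2)[of x y x'] elim z calculation by simp
        ultimately show "x \<in> C" by simp
      qed
      then show ?case using z by simp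
    qed
    then have "emeasure g (C \<times> UNIV) = emeasure g (UNIV \<times> P)"
      using g P C by (intro emeasure_eq_AE) (auto intro!: Times_borel)
    then show ?thesis using g P C by (simp add: emeasure_Xm emeasure_Ym)
  qed
  show "emeasure (Xm g0) C = emeasure (Xm g1) C"
    using key[OF s(1) \<Gamma>(2) Y(2)] key[OF s(2) \<Gamma>(3)] Y by simp
qed simp_all

section \<open>Transporting densities back and forth\<close>

text \<open>Radon-Nikodym for the image under \<psi> of the measure with density \<open>h\<close>
  with respect to \<open>p\<close>. This image is at most k times \<nu>, so its density is at most k
  almost everywhere. Cutting it off at k makes the bound hold everywhere, which lets
  \<open>transport_resolvent\<close> iterate.\<close>

lemma bounded_density:
  fixes p :: "'z::topological_space measure" and \<nu> :: "'b::topological_space measure" and k :: real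
  assumes p: "sets p = sets borel" "emeasure p UNIV < \<infinity>" and \<nu>: "sets \<nu> = sets borel" "emeasure \<nu> UNIV < \<infinity>"
    and \<psi> [measurable]: "\<psi> \<in> borel \<rightarrow>\<^sub>M borel" and h [measurable]: "h \<in> borel_measurable borel" and hk: "\<And>z. h z \<le> ennreal k"
    and le: "\<And>A. A \<in> sets borel \<Longrightarrow> emeasure (distr p borel \<psi>) A \<le> emeasure \<nu> A"
  shows "\<exists>u. u \<in> borel_measurable borel \<and> (\<forall>x. u x \<le> ennreal k) \<and>
    (\<forall>q \<in> borel_measurable borel. (\<integral>\<^sup>+z. h z * q (\<psi> z) \<partial>p) = (\<integral>\<^sup>+x. u x * q x \<partial>\<nu>))"
proof -
  have sp: "space p = UNIV" "space \<nu> = UNIV" using sets_eq_imp_space_eq[OF p(1)] sets_eq_imp_space_eq[OF \<nu>(1)] by simp_all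
  interpret \<nu>: finite_measure \<nu> using \<nu> sp by (intro finite_measureI) simp
  have mp: "f \<in> borel_measurable borel \<Longrightarrow> f \<in> borel_measurable p" for f :: "'z \<Rightarrow> ennreal"
    by (rule sets_eq_borel_measurableI[OF p(1)])
  have m\<nu>: "f \<in> borel_measurable borel \<Longrightarrow> f \<in> borel_measurable \<nu>" for f :: "'b \<Rightarrow> ennreal"
    by (rule sets_eq_borel_measurableI[OF \<nu>(1)])
  have \<psi>p: "\<psi> \<in> p \<rightarrow>\<^sub>M borel" by (rule sets_eq_borel_measurableI[OF p(1) \<psi>])
  define M where "M = distr (density p h) borel \<psi>"
  have \<psi>d: "\<psi> \<in> density p h \<rightarrow>\<^sub>M borel" using \<psi>p by simp
  have I: "(\<integral>\<^sup>+x. q x \<partial>M) = (\<integral>\<^sup>+z. h z * q (\<psi> z) \<partial>p)" if q [measurable]: "q \<in> borel_measurable borel" for q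
    unfolding M_def
    using q by (subst nn_integral_distr[OF \<psi>d], simp, subst nn_integral_density) (auto intro!: mp)
  have MA: "emeasure M A \<le> ennreal k * emeasure \<nu> A" if A: "A \<in> sets borel" for A
  proof -
    have iA [measurable]: "(indicator A :: 'b \<Rightarrow> ennreal) \<in> borel_measurable borel" using A by simp
    have "emeasure M A = (\<integral>\<^sup>+x. indicator A x \<partial>M)" using A by (simp add: M_def)
    also have "\<dots> = (\<integral>\<^sup>+z. h z * indicator A (\<psi> z) \<partial>p)" by (rule I[OF iA])
    also have "\<dots> \<le> (\<integral>\<^sup>+z. ennreal k * indicator A (\<psi> z) \<partial>p)"
      by (intro nn_integral_mono mult_right_mono hk) simp
    also have "\<dots> = ennreal k * (\<integral>\<^sup>+z. indicator A (\<psi> z) \<partial>p)"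
      by (rule nn_integral_cmult) (rule mp, measurable)
    also have "(\<integral>\<^sup>+z. indicator A (\<psi> z) \<partial>p) = (\<integral>\<^sup>+x. indicator A x \<partial>distr p borel \<psi>)"
      using A by (subst nn_integral_distr[OF \<psi>p]) simp_all
    also have "\<dots> = emeasure (distr p borel \<psi>) A" using A by simp
    finally show ?thesis using le[OF A] by (meson mult_left_mono order_trans zero_le)
  qed
  have "absolutely_continuous \<nu> M"
    unfolding absolutely_continuous_def
  proof
    fix A assume "A \<in> null_sets \<nu>"
    then have "A \<in> sets borel" "emeasure \<nu> A = 0" using \<nu>(1) by (auto simp: null_sets_def)
    then show "A \<in> null_sets M" using MA[of A] by (simp add: null_sets_def M_def)
  qed
  moreover have "sets M = sets \<nu>" by (simp add: M_def \<nu>(1))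
  ultimately obtain u' where u'0: "u' \<in> borel_measurable \<nu>" "density \<nu> u' = M"
    using \<nu>.Radon_Nikodym by blast
  have u'm [measurable]: "u' \<in> borel_measurable borel" using u'0(1) \<nu>(1) by (simp cong: measurable_cong_sets)
  \<comment> \<open>The image gives \<open>A\<close> a mass of at most k times that of \<nu>, so the
    excess of the density over k integrates to 0 there.\<close>
  define A where "A = {x. u' x > ennreal k}"
  have A [measurable]: "A \<in> sets borel" unfolding A_def by measurable
  have iA [measurable]: "(indicator A :: 'b \<Rightarrow> ennreal) \<in> borel_measurable borel" using A by simp
  have "(\<integral>\<^sup>+x. (u' x - ennreal k) * indicator A x \<partial>\<nu>) + (\<integral>\<^sup>+x. ennreal k * indicator A x \<partial>\<nu>)
      = (\<integral>\<^sup>+x. (u' x - ennreal k) * indicator A x + ennreal k * indicator A x \<partial>\<nu>)"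
    by (rule nn_integral_add[symmetric]; rule m\<nu>; measurable)
  also have "\<dots> = (\<integral>\<^sup>+x. u' x * indicator A x \<partial>\<nu>)"
    by (intro nn_integral_cong) (auto simp: A_def indicator_def diff_add_cancel_ennreal less_imp_le)
  also have "\<dots> = emeasure (density \<nu> u') A" using u'0(1) A \<nu>(1) by (intro emeasure_density[symmetric]) simp_all
  also have "\<dots> \<le> ennreal k * emeasure \<nu> A" using MA[OF A] u'0(2) by simp
  also have "\<dots> = 0 + (\<integral>\<^sup>+x. ennreal k * indicator A x \<partial>\<nu>)"
    using A \<nu>(1) by (simp add: nn_integral_cmult_indicator)
  finally have le0: "(\<integral>\<^sup>+x. (u' x - ennreal k) * indicator A x \<partial>\<nu>) + (\<integral>\<^sup>+x. ennreal k * indicator A x \<partial>\<nu>)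
     \<le> 0 + (\<integral>\<^sup>+x. ennreal k * indicator A x \<partial>\<nu>)" .
  have "(\<integral>\<^sup>+x. ennreal k * indicator A x \<partial>\<nu>) < \<infinity>"
    using A \<nu>(1) \<nu>.emeasure_finite[of A]
    by (simp add: nn_integral_cmult_indicator ennreal_mult_eq_top_iff less_top[symmetric])
  then have "(\<integral>\<^sup>+x. (u' x - ennreal k) * indicator A x \<partial>\<nu>) = 0"
    using le0[unfolded add.commute[of _ "\<integral>\<^sup>+x. ennreal k * indicator A x \<partial>\<nu>"] ennreal_add_left_cancel_le] by auto
  then have "AE x in \<nu>. (u' x - ennreal k) * indicator A x = 0"
    by (subst (asm) nn_integral_0_iff_AE) (rule m\<nu>, measurable)
  then have AE: "AE x in \<nu>. min (u' x) (ennreal k) = u' x"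
  proof (rule AE_mp, intro AE_I2 impI)
    fix x assume "(u' x - ennreal k) * indicator A x = 0"
    then show "min (u' x) (ennreal k) = u' x"
      by (auto simp: A_def indicator_def ennreal_minus_eq_0 min_def split: if_splits)
  qed
  show ?thesis
  proof (intro exI[of _ "\<lambda>x. min (u' x) (ennreal k)"] conjI allI ballI)
    fix q :: "'b \<Rightarrow> ennreal" assume q [measurable]: "q \<in> borel_measurable borel"
    have "(\<integral>\<^sup>+x. min (u' x) (ennreal k) * q x \<partial>\<nu>) = (\<integral>\<^sup>+x. u' x * q x \<partial>\<nu>)"
      by (rule nn_integral_cong_AE) (use AE in \<open>auto elim!: eventually_mono\<close>)
    also have "\<dots> = (\<integral>\<^sup>+x. q x \<partial>density \<nu> u')" by (rule nn_integral_density[symmetric]; rule m\<nu>; measurable)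
    also have "\<dots> = (\<integral>\<^sup>+z. h z * q (\<psi> z) \<partial>p)" unfolding u'0(2) by (rule I[OF q])
    finally show "(\<integral>\<^sup>+z. h z * q (\<psi> z) \<partial>p) = (\<integral>\<^sup>+x. min (u' x) (ennreal k) * q x \<partial>\<nu>)" ..
  qed auto
qed

lemma suminf_mult_swap:
  fixes q :: ennreal
  shows "(\<Sum>n. A n * (q * h n)) = (\<Sum>n. A n * h n) * q"
proof -
  have "(\<Sum>n. A n * (q * h n)) = (\<Sum>n. A n * h n * q)" by (simp only: ac_simps)
  then show ?thesis by (simp only: ennreal_suminf_multc)
qed

lemma geometric_ennreal_le:
  fixes F :: "nat \<Rightarrow> ennreal"
  assumes "\<And>n. F n \<le> 1"
  shows "(\<Sum>n. F n * ennreal ((1/2)^n)) \<le> 2"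
proof -
  have "(\<Sum>n. F n * ennreal ((1/2)^n)) \<le> (\<Sum>n. ennreal ((1/2)^n))"
    using mult_right_mono[OF assms, of "ennreal ((1/2)^n)" for n] by (intro suminf_le) auto
  also have "\<dots> = ennreal (\<Sum>n. (1/2)^n)"
    by (rule suminf_ennreal2) (auto intro!: summable_geometric)
  also have "(\<Sum>n. (1/2::real)^n) = 2" by (simp add: suminf_geometric)
  finally show ?thesis by simp
qed

text \<open>The Neumann series \<open>f = F + T F / 2 + T\<^sup>2 F / 4 + \<dots>\<close>, where \<open>T\<close> transports a density on the first
  marginal along \<open>p1\<close> to the second marginal and back along \<open>p0\<close>. Hence \<open>f = F + T f / 2\<close>.\<close>

lemma transport_resolvent:
  fixes p0 p1 :: "('a::second_countable_topology \<times> 'b::second_countable_topology) measure"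
  assumes p0: "sets p0 = sets borel" "emeasure p0 UNIV < \<infinity>" and p1: "sets p1 = sets borel" "emeasure p1 UNIV < \<infinity>"
    and \<mu>: "sets \<mu> = sets borel" "emeasure \<mu> UNIV < \<infinity>" "\<And>A. A \<in> sets borel \<Longrightarrow> emeasure (Xm p0) A \<le> emeasure \<mu> A"
    and \<nu>: "sets \<nu> = sets borel" "emeasure \<nu> UNIV < \<infinity>" "\<And>A. A \<in> sets borel \<Longrightarrow> emeasure (Ym p1) A \<le> emeasure \<nu> A"
    and F: "F \<in> borel_measurable borel" "\<And>x. F x \<le> 1"
  obtains f u f' where "f \<in> borel_measurable borel" "u \<in> borel_measurable borel" "f' \<in> borel_measurable borel"
    "\<And>x. f x \<le> 2" "\<And>y. u y \<le> 2" "\<And>x. f x = F x + f' x * ennreal (1/2)"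
    "\<And>q. q \<in> borel_measurable borel \<Longrightarrow> (\<integral>\<^sup>+z. f (fst z) * q (snd z) \<partial>p1) = (\<integral>\<^sup>+y. u y * q y \<partial>\<nu>)"
    "\<And>q. q \<in> borel_measurable borel \<Longrightarrow> (\<integral>\<^sup>+z. u (snd z) * q (fst z) \<partial>p0) = (\<integral>\<^sup>+x. f' x * q x \<partial>\<mu>)"
proof -
  define okf where "okf f \<longleftrightarrow> f \<in> borel_measurable borel \<and> (\<forall>x. f x \<le> 1)" for f :: "'a \<Rightarrow> ennreal"
  define oku where "oku u \<longleftrightarrow> u \<in> borel_measurable borel \<and> (\<forall>x. u x \<le> 1)" for u :: "'b \<Rightarrow> ennreal"
  \<comment> \<open>The premise sits inside the existential so that choice yields an operator
    defined on all functions.\<close>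
  have "\<exists>u. okf f \<longrightarrow> oku u \<and> (\<forall>q\<in>borel_measurable borel. (\<integral>\<^sup>+z. f (fst z) * q (snd z) \<partial>p1) = (\<integral>\<^sup>+y. u y * q y \<partial>\<nu>))" for f
  proof (cases "okf f")
    case True
    then have [measurable]: "f \<in> borel_measurable borel" by (simp add: okf_def)
    show ?thesis
      using bounded_density[OF p1 \<nu>(1,2) snd_borel, of "\<lambda>z. f (fst z)" 1] True \<nu>(3) by (auto simp: okf_def oku_def)
  qed simp
  then obtain U where U: "\<And>f. okf f \<Longrightarrow> oku (U f)"
    "\<And>f q. okf f \<Longrightarrow> q \<in> borel_measurable borel \<Longrightarrow> (\<integral>\<^sup>+z. f (fst z) * q (snd z) \<partial>p1) = (\<integral>\<^sup>+y. U f y * q y \<partial>\<nu>)"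
    by metis
  have "\<exists>f. oku u \<longrightarrow> okf f \<and> (\<forall>q\<in>borel_measurable borel. (\<integral>\<^sup>+z. u (snd z) * q (fst z) \<partial>p0) = (\<integral>\<^sup>+x. f x * q x \<partial>\<mu>))" for u
  proof (cases "oku u")
    case True
    then have [measurable]: "u \<in> borel_measurable borel" by (simp add: oku_def)
    show ?thesis
      using bounded_density[OF p0 \<mu>(1,2) fst_borel, of "\<lambda>z. u (snd z)" 1] True \<mu>(3) by (auto simp: okf_def oku_def)
  qed simp
  then obtain V where V: "\<And>u. oku u \<Longrightarrow> okf (V u)"
    "\<And>u q. oku u \<Longrightarrow> q \<in> borel_measurable borel \<Longrightarrow> (\<integral>\<^sup>+z. u (snd z) * q (fst z) \<partial>p0) = (\<integral>\<^sup>+x. V u x * q x \<partial>\<mu>)"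
    by metis
  define Fn where "Fn n = ((V \<circ> U) ^^ n) F" for n
  have Fn0: "Fn 0 = F" and FnS: "Fn (Suc n) = V (U (Fn n))" for n by (simp_all add: Fn_def)
  have okF: "okf (Fn n)" for n
    by (induction n) (use F U V in \<open>auto simp: Fn0 FnS okf_def[of F]\<close>)
  have okU: "oku (U (Fn n))" for n using U okF by blast
  note [measurable] = okF[unfolded okf_def, THEN conjunct1] okU[unfolded oku_def, THEN conjunct1]
  define h where "h n = ennreal ((1/2)^n)" for n :: nat
  \<comment> \<open>\<open>f'\<close> is the image of \<open>f\<close> under the round trip, taken
    term by term; hence the index shifted by one.\<close>
  define f u f' where "f = (\<lambda>x. \<Sum>n. Fn n x * h n)" and "u = (\<lambda>y. \<Sum>n. U (Fn n) y * h n)"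
    and "f' = (\<lambda>x. \<Sum>n. Fn (Suc n) x * h n)"
  have fm: "f \<in> borel_measurable borel" "u \<in> borel_measurable borel" "f' \<in> borel_measurable borel"
    unfolding f_def u_def f'_def by measurable
  have mp0: "q \<in> borel_measurable borel \<Longrightarrow> q \<in> borel_measurable p0" for q :: "'a \<times> 'b \<Rightarrow> ennreal"
    by (rule sets_eq_borel_measurableI[OF p0(1)])
  have mp1: "q \<in> borel_measurable borel \<Longrightarrow> q \<in> borel_measurable p1" for q :: "'a \<times> 'b \<Rightarrow> ennreal"
    by (rule sets_eq_borel_measurableI[OF p1(1)])
  have m\<mu>: "q \<in> borel_measurable borel \<Longrightarrow> q \<in> borel_measurable \<mu>" for q :: "'a \<Rightarrow> ennreal"
    by (rule sets_eq_borel_measurableI[OF \<mu>(1)])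
  have m\<nu>: "q \<in> borel_measurable borel \<Longrightarrow> q \<in> borel_measurable \<nu>" for q :: "'b \<Rightarrow> ennreal"
    by (rule sets_eq_borel_measurableI[OF \<nu>(1)])
  show ?thesis
  proof (rule that[of f u f'])
    show "f x \<le> 2" for x
      unfolding f_def h_def using okF by (intro geometric_ennreal_le) (auto simp: okf_def)
    show "u y \<le> 2" for y
      unfolding u_def h_def using okU by (intro geometric_ennreal_le) (auto simp: oku_def)
    show "f x = F x + f' x * ennreal (1/2)" for x
    proof -
      have hS: "h (Suc n) = h n * ennreal (1/2)" for n
        unfolding h_def by (subst ennreal_mult'[symmetric]) (simp_all add: mult.commute)
      have "f x = (\<Sum>n. Fn (Suc n) x * h (Suc n)) + Fn 0 x * h 0"
        unfolding f_def by (subst suminf_offset[of _ 1]) (auto simp: add.commute)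
      also have "(\<Sum>n. Fn (Suc n) x * h (Suc n)) = f' x * ennreal (1/2)"
        unfolding f'_def hS by (simp add: mult.assoc[symmetric])
      finally show ?thesis by (simp add: Fn0 h_def add.commute)
    qed
    fix q :: "'b \<Rightarrow> ennreal" assume q [measurable]: "q \<in> borel_measurable borel"
    have "(\<integral>\<^sup>+z. f (fst z) * q (snd z) \<partial>p1) = (\<integral>\<^sup>+z. (\<Sum>n. Fn n (fst z) * (q (snd z) * h n)) \<partial>p1)"
      unfolding f_def by (intro nn_integral_cong) (simp only: suminf_mult_swap)
    also have "\<dots> = (\<Sum>n. \<integral>\<^sup>+z. Fn n (fst z) * (q (snd z) * h n) \<partial>p1)"
      by (rule nn_integral_suminf) (rule mp1, measurable)
    also have "\<dots> = (\<Sum>n. \<integral>\<^sup>+y. U (Fn n) y * (q y * h n) \<partial>\<nu>)"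
      by (intro suminf_cong U(2)[of _ "\<lambda>y. q y * h n" for n] okF) measurable
    also have "\<dots> = (\<integral>\<^sup>+y. (\<Sum>n. U (Fn n) y * (q y * h n)) \<partial>\<nu>)"
      by (rule nn_integral_suminf[symmetric]) (rule m\<nu>, measurable)
    also have "\<dots> = (\<integral>\<^sup>+y. u y * q y \<partial>\<nu>)"
      unfolding u_def by (intro nn_integral_cong) (simp only: suminf_mult_swap)
    finally show "(\<integral>\<^sup>+z. f (fst z) * q (snd z) \<partial>p1) = (\<integral>\<^sup>+y. u y * q y \<partial>\<nu>)" .
  next
    fix q :: "'a \<Rightarrow> ennreal" assume q [measurable]: "q \<in> borel_measurable borel"
    have "(\<integral>\<^sup>+z. u (snd z) * q (fst z) \<partial>p0) = (\<integral>\<^sup>+z. (\<Sum>n. U (Fn n) (snd z) * (q (fst z) * h n)) \<partial>p0)"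
      unfolding u_def by (intro nn_integral_cong) (simp only: suminf_mult_swap)
    also have "\<dots> = (\<Sum>n. \<integral>\<^sup>+z. U (Fn n) (snd z) * (q (fst z) * h n) \<partial>p0)"
      by (rule nn_integral_suminf) (rule mp0, measurable)
    also have "\<dots> = (\<Sum>n. \<integral>\<^sup>+x. Fn (Suc n) x * (q x * h n) \<partial>\<mu>)"
      unfolding FnS by (intro suminf_cong V(2)[of _ "\<lambda>y. q y * h n" for n] okU) measurable
    also have "\<dots> = (\<integral>\<^sup>+x. (\<Sum>n. Fn (Suc n) x * (q x * h n)) \<partial>\<mu>)"
      by (rule nn_integral_suminf[symmetric]) (rule m\<mu>, measurable)
    also have "\<dots> = (\<integral>\<^sup>+x. f' x * q x \<partial>\<mu>)"
      unfolding f'_def by (intro nn_integral_cong) (simp only: suminf_mult_swap)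
    finally show "(\<integral>\<^sup>+z. u (snd z) * q (fst z) \<partial>p0) = (\<integral>\<^sup>+x. f' x * q x \<partial>\<mu>)" .
  qed (fact fm)+
qed

section \<open>Exchanging fractions\<close>

lemma finite_partition_small:
  fixes K :: "'a::euclidean_space set"
  assumes K: "compact K" and \<delta>: "0 < \<delta>"
  obtains N :: nat and P where "\<And>n. P n \<in> sets borel" "disjoint_family P" "(\<Union>n<N. P n) = K"
    "\<And>n x x'. x \<in> P n \<Longrightarrow> x' \<in> P n \<Longrightarrow> dist x x' < \<delta>"
proof -
  obtain C where C: "C \<subseteq> K" "finite C" "K \<subseteq> (\<Union>d\<in>C. ball d (\<delta>/2))"
  proof (rule compactE_image[OF K, of K "\<lambda>d. ball d (\<delta>/2)"])
    show "K \<subseteq> (\<Union>d\<in>K. ball d (\<delta>/2))" using \<delta> by auto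
  qed auto
  obtain d where d: "bij_betw d {0..<card C} C" using ex_bij_betw_nat_finite[OF C(2)] by blast
  define B where "B n = (if n < card C then ball (d n) (\<delta>/2) \<inter> K else {})" for n
  have Bb: "B n \<in> sets borel" for n
    using K by (auto simp: B_def borel_closed compact_imp_closed)
  show ?thesis
  proof (rule that[of "disjointed B" "card C"])
    show "disjointed B n \<in> sets borel" for n
      unfolding disjointed_def using Bb by auto
    show "disjoint_family (disjointed B)" by (rule disjoint_family_disjointed)
    have "disjointed B n = {}" if "\<not> n < card C" for n
      using disjointed_subset[of B n] that by (auto simp: B_def)
    then have "(\<Union>n<card C. disjointed B n) = (\<Union>n. disjointed B n)" by blast
    also have "\<dots> = (\<Union>n. B n)" by (rule UN_disjointed_eq)
    also have "\<dots> = K"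
    proof
      show "(\<Union>n. B n) \<subseteq> K" by (auto simp: B_def split: if_splits)
      show "K \<subseteq> (\<Union>n. B n)"
      proof
        fix x assume x: "x \<in> K"
        then obtain y where "y \<in> C" "x \<in> ball y (\<delta>/2)" using C(3) by blast
        moreover from \<open>y \<in> C\<close> obtain n where "n < card C" "y = d n"
          using bij_betw_imp_surj_on[OF d] by (metis atLeastLessThan_iff imageE)
        ultimately have "x \<in> B n" using x by (simp add: B_def)
        then show "x \<in> (\<Union>n. B n)" by blast
      qed
    qed
    finally show "(\<Union>n<card C. disjointed B n) = K" .
    fix n x x' assume "x \<in> disjointed B n" "x' \<in> disjointed B n"
    then have "x \<in> B n" "x' \<in> B n" using disjointed_subset[of B n] by blast+
    then have "dist (d n) x < \<delta>/2" "dist (d n) x' < \<delta>/2" by (auto simp: B_def split: if_splits)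
    then show "dist x x' < \<delta>" by (metis dist_commute dist_triangle_half_l)
  qed
qed

text \<open>Cut \<open>P\<close> by balls about the origin. The mass inside radius \<open>r\<close>
  is continuous in \<open>r\<close> because spheres are null, so the intermediate value theorem
  reaches every \<beta>. This is where nonatomicity turns fractions into sets.\<close>

lemma subset_with_integral:
  fixes h :: "'a::euclidean_space \<Rightarrow> ennreal"
  assumes h [measurable]: "h \<in> borel_measurable borel" and P [measurable]: "P \<in> sets borel" and bd: "bounded P"
    and fin: "(\<integral>\<^sup>+x. h x * indicator P x \<partial>lborel) < \<infinity>" and \<beta>: "\<beta> \<le> (\<integral>\<^sup>+x. h x * indicator P x \<partial>lborel)"
  obtains S where "S \<in> sets borel" "S \<subseteq> P" "(\<integral>\<^sup>+x. h x * indicator S x \<partial>lborel) = \<beta>"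
proof -
  define M where "M = density lborel (\<lambda>x. h x * indicator P x)"
  have Ms: "sets M = sets borel" by (simp add: M_def)
  have MA: "emeasure M A = (\<integral>\<^sup>+x. h x * indicator (P \<inter> A) x \<partial>lborel)" if "A \<in> sets borel" for A
    unfolding M_def using that by (subst emeasure_density) (auto intro!: nn_integral_cong simp: indicator_def)
  have Mf: "emeasure M UNIV < \<infinity>" using MA[of UNIV] fin by simp
  obtain R where R: "\<And>x. x \<in> P \<Longrightarrow> norm x \<le> R" using bd by (auto simp: bounded_iff)
  have nm: "norm \<in> M \<rightarrow>\<^sub>M (borel :: real measure)"
    by (rule sets_eq_borel_measurableI[OF Ms]) measurable
  define D where "D = distr M borel (norm :: 'a \<Rightarrow> real)"
  have DA: "emeasure D A = emeasure M (norm -` A)" if "A \<in> sets borel" for A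
    unfolding D_def using nm that by (subst emeasure_distr) (auto simp: M_def)
  interpret D: finite_measure D
    using Mf DA[of UNIV] by (intro finite_measureI) (simp add: D_def less_top[symmetric])
  interpret D: finite_borel_measure D by standard (simp_all add: D_def)
  have vm: "(norm :: 'a \<Rightarrow> real) -` A \<in> sets borel" if "A \<in> sets borel" for A
    using measurable_sets[of norm "borel :: 'a measure" borel A] that by simp
  have "emeasure D {r} = 0" for r
  proof -
    have "(norm :: 'a \<Rightarrow> real) -` {r} = sphere 0 r" by (auto simp: dist_norm)
    moreover have "sphere (0::'a) r \<in> null_sets lborel"
      using negligible_sphere[of "0::'a" r] by (simp add: negligible_iff_null_sets null_sets_completion_iff)
    then have "emeasure M (sphere 0 r) = 0"
      unfolding M_def by (auto intro!: absolutely_continuousI_density[unfolded absolutely_continuous_def, THEN subsetD, THEN null_setsD1])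
    ultimately show ?thesis by (simp add: DA)
  qed
  then have cont: "isCont (cdf D) r" for r by (simp add: D.isCont_cdf measure_def)
  have neg: "cdf D (-1) = 0"
  proof -
    have "\<not> norm x \<le> -1" for x :: 'a using norm_ge_zero[of x] by linarith
    then have "(norm :: 'a \<Rightarrow> real) -` {..-1} = {}" by auto
    then show ?thesis by (simp add: cdf_def measure_def DA)
  qed
  \<comment> \<open>\<open>R\<close> may be negative when \<open>P\<close> is empty, but the
    interval for the intermediate value theorem starts at -1.\<close>
  define R' where "R' = max R 0"
  have "ennreal (cdf D R') = emeasure M (norm -` {..R'})"
    using DA[of "{..R'}"] by (simp add: cdf_def D.emeasure_eq_measure)
  also have "\<dots> = (\<integral>\<^sup>+x. h x * indicator P x \<partial>lborel)"
  proof -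
    have "P \<inter> norm -` {..R'} = P" using R by (force simp: R'_def)
    then show ?thesis by (subst MA) (auto intro!: vm)
  qed
  finally have top: "ennreal (cdf D R') = (\<integral>\<^sup>+x. h x * indicator P x \<partial>lborel)" .
  obtain b where b: "\<beta> = ennreal b" "0 \<le> b"
    using \<beta> fin by (metis ennreal_cases infinity_ennreal_def not_less top_unique)
  have "b \<le> cdf D R'" using \<beta> unfolding top[symmetric] b(1) by (simp add: D.cdf_nonneg)
  then obtain r where r: "cdf D r = b"
    using IVT[of "cdf D" "-1" b R'] neg b cont max.cobounded2[of 0 R] by (auto simp: R'_def simp del: max.cobounded2)
  show ?thesis
  proof (rule that[of "P \<inter> norm -` {..r}"])
    show "P \<inter> norm -` {..r} \<in> sets borel" using P vm[of "{..r}"] by auto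
    have "(\<integral>\<^sup>+x. h x * indicator (P \<inter> norm -` {..r}) x \<partial>lborel) = emeasure D {..r}"
      by (subst DA, simp, subst MA) (auto intro!: vm)
    also have "\<dots> = ennreal (cdf D r)" by (simp add: cdf_def D.emeasure_eq_measure)
    finally show "(\<integral>\<^sup>+x. h x * indicator (P \<inter> norm -` {..r}) x \<partial>lborel) = \<beta>" by (simp add: r b)
  qed simp
qed

text \<open>Within a cell the new plan keeps how much mass arrives where, but lets it start
  according to \<open>\<mu>'\<close> instead of \<mu>, by means of a product measure. Starting
  points of one cell have nearly equal costs, so each unit of mass pays at most \<epsilon>
  more.\<close>

lemma recouple:
  fixes q :: "('a::euclidean_space \<times> 'a) measure" and N :: nat
  assumes q: "coupling \<mu> \<nu> q" "emeasure q UNIV < \<infinity>" and \<mu>': "sets \<mu>' = sets borel"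
    and P: "\<And>n. P n \<in> sets borel" "disjoint_family P"
    and null: "emeasure \<mu> (- (\<Union>n<N. P n)) = 0" "emeasure \<mu>' (- (\<Union>n<N. P n)) = 0"
    and K: "K \<in> sets borel" "emeasure \<nu> (- K) = 0"
    and mass: "\<And>n. n < N \<Longrightarrow> emeasure \<mu>' (P n) = emeasure \<mu> (P n)"
    and c: "c \<in> borel_measurable borel" and \<epsilon>: "0 \<le> \<epsilon>"
    and osc: "\<And>n x x' y. n < N \<Longrightarrow> x \<in> P n \<Longrightarrow> x' \<in> P n \<Longrightarrow> y \<in> K \<Longrightarrow> c (x, y) \<le> c (x', y) + ennreal \<epsilon>"
  obtains q' where "coupling \<mu>' \<nu> q'" "(\<integral>\<^sup>+z. c z \<partial>q') \<le> (\<integral>\<^sup>+z. c z \<partial>q) + ennreal \<epsilon> * emeasure q UNIV"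
proof -
  note [measurable] = P(1) K(1) c
  have qs: "sets q = sets borel" and X: "Xm q = \<mu>" and Y: "Ym q = \<nu>" using q by (auto simp: coupling_def)
  have mq: "f \<in> borel_measurable borel \<Longrightarrow> f \<in> borel_measurable q" for f :: "'a \<times> 'a \<Rightarrow> ennreal"
    by (rule sets_eq_borel_measurableI[OF qs])
  have m\<mu>: "f \<in> borel_measurable borel \<Longrightarrow> f \<in> borel_measurable \<mu>'" for f :: "'a \<Rightarrow> ennreal"
    by (rule sets_eq_borel_measurableI[OF \<mu>'])
  define \<alpha> where "\<alpha> n = density \<mu>' (indicator (P n))" for n
  define \<kappa> where "\<kappa> n = density q (indicator (P n \<times> UNIV))" for n
  have s: "sets (\<alpha> n) = sets borel" "sets (\<kappa> n) = sets borel" for n by (auto simp: \<alpha>_def \<kappa>_def \<mu>' qs)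
  have sp: "space (\<alpha> n) = UNIV" "space (\<kappa> n) = UNIV" for n
    using sets_eq_imp_space_eq[OF s(1)] sets_eq_imp_space_eq[OF s(2)] by simp_all
  have PT: "P n \<times> (UNIV :: 'a set) \<in> sets borel" for n by (rule Times_borel[OF P(1) space_in_borel])
  have \<alpha>A: "emeasure (\<alpha> n) A = emeasure \<mu>' (P n \<inter> A)" if "A \<in> sets borel" for n A
    unfolding \<alpha>_def using that P(1) \<mu>' by (intro emeasure_restricted) simp_all
  have \<kappa>A: "emeasure (\<kappa> n) A = emeasure q ((P n \<times> UNIV) \<inter> A)" if "A \<in> sets borel" for n A
    unfolding \<kappa>_def using that PT qs by (intro emeasure_restricted) simp_all
  have m: "emeasure (\<alpha> n) UNIV = emeasure (\<kappa> n) UNIV" if "n < N" for n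
    using mass[OF that] emeasure_Xm[OF qs P(1), of n] X \<alpha>A[of UNIV] \<kappa>A[of UNIV] by simp
  have \<kappa>f: "emeasure (\<kappa> n) UNIV < \<infinity>" for n
    using emeasure_mono[of "P n \<times> UNIV" UNIV q] q(2) \<kappa>A[of UNIV n] qs by simp
  have YU: "emeasure (Ym (\<kappa> n)) UNIV = emeasure (\<kappa> n) UNIV" for n by (simp add: emeasure_Ym s)
  have C: "coupling (\<alpha> n) (Ym (\<kappa> n)) (nprod (\<alpha> n) (Ym (\<kappa> n)))" if "n < N" for n
    using m[OF that] \<kappa>f[of n] by (intro coupling_nprod) (simp_all add: s YU)
  define Q where "Q n = nprod (\<alpha> n) (Ym (\<kappa> n))" for n
  have Qs: "n \<in> {..<N} \<Longrightarrow> sets (Q n) = sets borel" for n using C by (simp add: Q_def coupling_def)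
  define q' where "q' = msum {..<N} Q"
  have qs': "sets q' = sets borel" by (simp add: q'_def)
  have QX: "emeasure (Q n) (A \<times> UNIV) = emeasure \<mu>' (P n \<inter> A)"
    and QY: "emeasure (Q n) (UNIV \<times> A) = emeasure q (P n \<times> A)" if A: "A \<in> sets borel" and n: "n < N" for n A
  proof -
    have "emeasure (Q n) (A \<times> UNIV) = emeasure (Xm (Q n)) A" using Qs n A by (simp add: emeasure_Xm)
    then show "emeasure (Q n) (A \<times> UNIV) = emeasure \<mu>' (P n \<inter> A)" using C[OF n] A \<alpha>A by (simp add: coupling_def Q_def)
    have "emeasure (Q n) (UNIV \<times> A) = emeasure (Ym (Q n)) A" using Qs n A by (simp add: emeasure_Ym)
    also have "\<dots> = emeasure (Ym (\<kappa> n)) A" using C[OF n] by (simp add: coupling_def Q_def)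
    also have "\<dots> = emeasure (\<kappa> n) (UNIV \<times> A)" using A s by (simp add: emeasure_Ym)
    also have "\<dots> = emeasure q ((P n \<times> UNIV) \<inter> (UNIV \<times> A))" using A by (intro \<kappa>A Times_borel) simp_all
    also have "(P n \<times> UNIV) \<inter> (UNIV \<times> A) = P n \<times> A" by auto
    finally show "emeasure (Q n) (UNIV \<times> A) = emeasure q (P n \<times> A)" .
  qed
  define U where "U = (\<Union>n<N. P n)"
  have U: "U \<in> sets borel" unfolding U_def using P(1) by auto
  have "Xm q' = \<mu>'"
  proof (rule measure_eqI)
    fix A assume "A \<in> sets (Xm q')"
    then have A [measurable]: "A \<in> sets borel" by simp
    have "emeasure (Xm q') A = emeasure q' (A \<times> UNIV)" by (rule emeasure_Xm[OF qs' A])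
    also have "\<dots> = (\<Sum>n<N. emeasure (Q n) (A \<times> UNIV))"
      unfolding q'_def using Qs A by (intro emeasure_msum Times_borel) auto
    also have "\<dots> = (\<Sum>n<N. emeasure \<mu>' (P n \<inter> A))" using QX[OF A] by simp
    also have "\<dots> = emeasure \<mu>' (\<Union>n<N. P n \<inter> A)"
      using P \<mu>' by (intro sum_emeasure) (auto simp: disjoint_family_on_def)
    also have "(\<Union>n<N. P n \<inter> A) = U \<inter> A" by (auto simp: U_def)
    also have "emeasure \<mu>' (U \<inter> A) = emeasure \<mu>' A"
    proof (rule emeasure_eq_AE)
      have "- U \<in> null_sets \<mu>'" using null(2)[folded U_def] borel_comp[OF U] \<mu>' by (simp only: null_sets_def mem_Collect_eq simp_thms)
      from AE_not_in[OF this] show "AE x in \<mu>'. x \<in> U \<inter> A \<longleftrightarrow> x \<in> A" by eventually_elim auto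
    qed (use A U \<mu>' in auto)
    finally show "emeasure (Xm q') A = emeasure \<mu>' A" .
  qed (simp add: \<mu>')
  moreover have "Ym q' = \<nu>"
  proof (rule measure_eqI)
    fix A assume "A \<in> sets (Ym q')"
    then have A [measurable]: "A \<in> sets borel" by simp
    have "emeasure (Ym q') A = emeasure q' (UNIV \<times> A)" by (rule emeasure_Ym[OF qs' A])
    also have "\<dots> = (\<Sum>n<N. emeasure (Q n) (UNIV \<times> A))"
      unfolding q'_def using Qs A by (intro emeasure_msum Times_borel) auto
    also have "\<dots> = (\<Sum>n<N. emeasure q (P n \<times> A))" using QY[OF A] by simp
    also have "\<dots> = emeasure q (\<Union>n<N. P n \<times> A)"
      using P qs A by (intro sum_emeasure) (auto simp: disjoint_family_on_def intro!: Times_borel)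
    also have "(\<Union>n<N. P n \<times> A) = U \<times> A" by (auto simp: U_def)
    also have "emeasure q (U \<times> A) = emeasure q (UNIV \<times> A)"
    proof (rule emeasure_eq_AE)
      have "emeasure q ((- U) \<times> UNIV) = 0" using null(1)[folded U_def] X emeasure_Xm[OF qs borel_comp[OF U]] by simp
      then have "(- U) \<times> UNIV \<in> null_sets q" using U qs by (auto simp: null_sets_def intro!: Times_borel)
      from AE_not_in[OF this] show "AE x in q. x \<in> U \<times> A \<longleftrightarrow> x \<in> UNIV \<times> A" by eventually_elim auto
    qed (use A U qs in \<open>auto intro!: Times_borel\<close>)
    also have "\<dots> = emeasure \<nu> A" using emeasure_Ym[OF qs A] Y by simp
    finally show "emeasure (Ym q') A = emeasure \<nu> A" .
  qed (use Y in auto)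
  ultimately have "coupling \<mu>' \<nu> q'" using qs' by (simp add: coupling_def)
  moreover have "(\<integral>\<^sup>+z. c z \<partial>q') \<le> (\<integral>\<^sup>+z. c z \<partial>q) + ennreal \<epsilon> * emeasure q UNIV"
  proof -
    \<comment> \<open>For every single starting point in the cell, the cost of the arriving mass is
      at most the old cost plus \<epsilon> per unit. Averaging over \<open>\<alpha> n\<close>
      preserves the bound, since its mass cancels the normalization in \<open>nprod\<close>.\<close>
    have piece: "(\<integral>\<^sup>+z. c z \<partial>Q n) \<le> (\<integral>\<^sup>+z. (c z + ennreal \<epsilon>) * indicator (P n) (fst z) \<partial>q)" (is "_ \<le> ?I n") if n: "n < N" for n
    proof -
      have Ys: "sets (Ym (\<kappa> n)) = sets borel" by simp
      interpret Y: finite_measure "Ym (\<kappa> n)" using YU \<kappa>f[of n] by (intro finite_measureI) simp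
      have cm: "c \<in> borel_measurable (\<alpha> n \<Otimes>\<^sub>M Ym (\<kappa> n))"
        using c by (subst measurable_cong_sets[OF sets_pair_measure_cong[OF s(1) Ys] refl]) (simp add: borel_prod)
      have "(\<integral>\<^sup>+y. c (x, y) \<partial>Ym (\<kappa> n)) \<le> ?I n" if x: "x \<in> P n" for x
      proof -
        have cx [measurable]: "(\<lambda>y. c (x, y)) \<in> borel_measurable borel"
          using measurable_compose[OF _ c, of "\<lambda>y. (x, y)" borel] by simp
        have "(\<integral>\<^sup>+y. c (x, y) \<partial>Ym (\<kappa> n)) = (\<integral>\<^sup>+z. c (x, snd z) \<partial>\<kappa> n)" by (rule nn_integral_Ym[OF s(2) cx])
        also have "\<dots> = (\<integral>\<^sup>+z. indicator (P n \<times> UNIV) z * c (x, snd z) \<partial>q)"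
          unfolding \<kappa>_def by (rule nn_integral_density; rule mq; measurable)
        also have "\<dots> \<le> ?I n"
        proof (rule nn_integral_mono_AE)
          have "emeasure q (UNIV \<times> (- K)) = 0" using K Y emeasure_Ym[OF qs, of "- K"] by simp
          then have "UNIV \<times> (- K) \<in> null_sets q" using K qs by (auto simp: null_sets_def intro!: Times_borel)
          from AE_not_in[OF this]
          show "AE z in q. indicator (P n \<times> UNIV) z * c (x, snd z) \<le> (c z + ennreal \<epsilon>) * indicator (P n) (fst z)"
            by eventually_elim (use osc[OF n x] in \<open>auto simp: indicator_def\<close>)
        qed
        finally show ?thesis .
      qed
      moreover have "AE x in \<alpha> n. x \<in> P n"
        unfolding \<alpha>_def by (subst AE_density) (auto simp: indicator_def intro!: m\<mu>)
      ultimately have "(\<integral>\<^sup>+x. \<integral>\<^sup>+y. c (x, y) \<partial>Ym (\<kappa> n) \<partial>\<alpha> n) \<le> (\<integral>\<^sup>+x. ?I n \<partial>\<alpha> n)"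
        by (intro nn_integral_mono_AE) (auto elim: eventually_mono)
      then have le: "(\<integral>\<^sup>+x. \<integral>\<^sup>+y. c (x, y) \<partial>Ym (\<kappa> n) \<partial>\<alpha> n) \<le> ?I n * emeasure (\<alpha> n) UNIV" by (simp add: sp)
      have "(\<integral>\<^sup>+z. c z \<partial>Q n) = inverse (emeasure (\<alpha> n) UNIV) * (\<integral>\<^sup>+z. c z \<partial>(\<alpha> n \<Otimes>\<^sub>M Ym (\<kappa> n)))"
        unfolding Q_def nprod_def by (rule nn_integral_scale_measure[OF cm])
      also have "\<dots> = inverse (emeasure (\<alpha> n) UNIV) * (\<integral>\<^sup>+x. \<integral>\<^sup>+y. c (x, y) \<partial>Ym (\<kappa> n) \<partial>\<alpha> n)"
        by (simp add: Y.nn_integral_fst[OF cm])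
      also have "\<dots> \<le> inverse (emeasure (\<alpha> n) UNIV) * (?I n * emeasure (\<alpha> n) UNIV)"
        by (rule mult_left_mono[OF le]) simp
      also have "\<dots> \<le> ?I n"
      proof (cases "emeasure (\<alpha> n) UNIV = 0")
        case False
        have "inverse (emeasure (\<alpha> n) UNIV) * emeasure (\<alpha> n) UNIV = 1"
          using False m[OF n] \<kappa>f[of n] ennreal_divide_self[of "emeasure (\<alpha> n) UNIV"]
          by (simp add: divide_ennreal_def mult.commute less_top)
        moreover have "inverse (emeasure (\<alpha> n) UNIV) * (?I n * emeasure (\<alpha> n) UNIV)
            = ?I n * (inverse (emeasure (\<alpha> n) UNIV) * emeasure (\<alpha> n) UNIV)"
          by (rule mult.left_commute)
        ultimately show ?thesis by simp
      qed simp
      finally show ?thesis .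
    qed
    have "(\<integral>\<^sup>+z. c z \<partial>q') = (\<Sum>n<N. \<integral>\<^sup>+z. c z \<partial>Q n)"
      unfolding q'_def by (rule nn_integral_msum[OF Qs c]) simp
    also have "\<dots> \<le> (\<Sum>n<N. \<integral>\<^sup>+z. (c z + ennreal \<epsilon>) * indicator (P n) (fst z) \<partial>q)"
      by (rule sum_mono) (use piece in simp)
    also have "\<dots> = (\<integral>\<^sup>+z. (\<Sum>n<N. (c z + ennreal \<epsilon>) * indicator (P n) (fst z)) \<partial>q)"
      by (rule nn_integral_sum[symmetric]; rule mq; measurable)
    also have "\<dots> \<le> (\<integral>\<^sup>+z. c z + ennreal \<epsilon> \<partial>q)"
    proof (rule nn_integral_mono)
      fix z :: "'a \<times> 'a"
      have "(\<Sum>n<N. indicator (P n) (fst z)) \<le> (1 :: ennreal)"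
      proof (cases "fst z \<in> (\<Union>n<N. P n)")
        case True
        then obtain k where k: "k < N" "fst z \<in> P k" by auto
        have "(\<Sum>n<N. indicator (P n) (fst z)) = (\<Sum>n<N. if n = k then 1 else 0 :: ennreal)"
          using k P(2) by (intro sum.cong) (auto simp: indicator_def disjoint_family_on_def)
        then show ?thesis using k by simp
      next
        case False then have "(\<Sum>n<N. indicator (P n) (fst z)) = (0 :: ennreal)" by (intro sum.neutral) (auto simp: indicator_def)
        then show ?thesis by simp
      qed
      then show "(\<Sum>n<N. (c z + ennreal \<epsilon>) * indicator (P n) (fst z)) \<le> c z + ennreal \<epsilon>"
        unfolding sum_distrib_left[symmetric] by (metis mult.right_neutral mult_left_mono zero_le)
    qed
    also have "\<dots> = (\<integral>\<^sup>+z. c z \<partial>q) + ennreal \<epsilon> * emeasure q UNIV"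
      using sets_eq_imp_space_eq[OF qs] by (subst nn_integral_add) (auto intro!: mq c)
    finally show ?thesis .
  qed
  ultimately show ?thesis using that by blast
qed

lemma diff_eq_0_of_le_ennreal: "a \<le> b \<Longrightarrow> a < \<top> \<Longrightarrow> a - b = (0::ennreal)"
  by (cases a b rule: ennreal2_cases) (auto simp: ennreal_minus ennreal_neg)

lemma add_diff_swap_ennreal: "a < \<top> \<Longrightarrow> b < \<top> \<Longrightarrow> a + (b - a) = b + (a - b :: ennreal)"
  by (cases "a \<le> b") (simp_all add: add_diff_inverse_ennreal diff_eq_0_of_le_ennreal not_le less_imp_le)

text \<open>The swap over \<open>S\<close> adds \<open>a1 - a0\<close> and removes
  \<open>a0 - a1\<close> on \<open>P \<inter> S\<close>, and these have the same integrals as the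
  fractions \<open>b\<close> and \<open>t\<close> on \<open>P\<close>. Differences are truncated in
  \<open>ennreal\<close>, so removals are written on the opposite side and cancelled at the
  end.\<close>

lemma cell_mass:
  fixes a0 a1 a' b t :: "'a::euclidean_space \<Rightarrow> ennreal"
  assumes [measurable]: "a0 \<in> borel_measurable borel" "a1 \<in> borel_measurable borel" "a' \<in> borel_measurable borel"
      "b \<in> borel_measurable borel" "t \<in> borel_measurable borel" "S \<in> sets borel" "P \<in> sets borel"
    and afin: "\<And>x. a0 x < \<top>" "\<And>x. a1 x < \<top>"
    and up: "(\<integral>\<^sup>+x. (a1 x - a0 x) * indicator (P \<inter> S) x \<partial>lborel) = (\<integral>\<^sup>+x. b x * indicator P x \<partial>lborel)"
    and down: "(\<integral>\<^sup>+x. (a0 x - a1 x) * indicator (P \<inter> S) x \<partial>lborel) = (\<integral>\<^sup>+x. t x * indicator P x \<partial>lborel)"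
    and eq: "\<And>x. a' x + t x = a0 x + b x" and fin: "(\<integral>\<^sup>+x. t x * indicator P x \<partial>lborel) < \<infinity>"
  shows "(\<integral>\<^sup>+x. (if x \<in> S then a1 x else a0 x) * indicator P x \<partial>lborel) = (\<integral>\<^sup>+x. a' x * indicator P x \<partial>lborel)"
proof -
  let ?a = "\<lambda>x. if x \<in> S then a1 x else a0 x"
  have "(\<integral>\<^sup>+x. ?a x * indicator P x \<partial>lborel) + (\<integral>\<^sup>+x. t x * indicator P x \<partial>lborel)
      = (\<integral>\<^sup>+x. ?a x * indicator P x + (a0 x - a1 x) * indicator (P \<inter> S) x \<partial>lborel)"
    unfolding down[symmetric] by (rule nn_integral_add[symmetric]) measurable
  also have "\<dots> = (\<integral>\<^sup>+x. a0 x * indicator P x + (a1 x - a0 x) * indicator (P \<inter> S) x \<partial>lborel)"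
  proof (rule nn_integral_cong)
    fix x
    have "a1 x + (a0 x - a1 x) = a0 x + (a1 x - a0 x)"
      by (rule add_diff_swap_ennreal[OF afin(2,1)])
    then show "?a x * indicator P x + (a0 x - a1 x) * indicator (P \<inter> S) x = a0 x * indicator P x + (a1 x - a0 x) * indicator (P \<inter> S) x"
      by (auto simp: indicator_def)
  qed
  also have "\<dots> = (\<integral>\<^sup>+x. a0 x * indicator P x \<partial>lborel) + (\<integral>\<^sup>+x. b x * indicator P x \<partial>lborel)"
    unfolding up[symmetric] by (rule nn_integral_add) measurable
  also have "\<dots> = (\<integral>\<^sup>+x. a0 x * indicator P x + b x * indicator P x \<partial>lborel)"
    by (rule nn_integral_add[symmetric]) measurable
  also have "\<dots> = (\<integral>\<^sup>+x. a' x * indicator P x + t x * indicator P x \<partial>lborel)"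
    by (simp add: eq flip: distrib_right)
  also have "\<dots> = (\<integral>\<^sup>+x. a' x * indicator P x \<partial>lborel) + (\<integral>\<^sup>+x. t x * indicator P x \<partial>lborel)"
    by (rule nn_integral_add) measurable
  finally show ?thesis
    using fin unfolding add.commute[of _ "\<integral>\<^sup>+x. t x * indicator P x \<partial>lborel"] ennreal_add_left_cancel by auto
qed

text \<open>If exchanging whole parts of \<open>a0\<close> and \<open>a1\<close> over Borel sets cannot lower the cost below \<open>V\<close>, then neither can
  exchanging fractions of the excesses: in each cell of a fine partition, a suitable set has the same masses as the fractions.\<close>

theorem relaxed_exchange:
  fixes a0 a1 :: "'a::euclidean_space \<Rightarrow> ennreal"
  assumes a [measurable]: "a0 \<in> borel_measurable borel" "a1 \<in> borel_measurable borel"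
    and afin: "\<And>x. a0 x < \<top>" "\<And>x. a1 x < \<top>"
    and fin: "(\<integral>\<^sup>+x. a0 x \<partial>lborel) < \<infinity>" "(\<integral>\<^sup>+x. a1 x \<partial>lborel) < \<infinity>"
    and K: "compact K" "\<And>x. x \<notin> K \<Longrightarrow> a0 x = 0" "\<And>x. x \<notin> K \<Longrightarrow> a1 x = 0" "emeasure \<nu>0 (- K) = 0" "emeasure \<nu>1 (- K) = 0"
    and c: "continuous_on UNIV (\<lambda>z. c (fst z) (snd z))" "\<And>x y. 0 \<le> c x y"
    and V: "\<And>S r0 r1. S \<in> sets borel \<Longrightarrow> coupling (density lborel (\<lambda>x. if x \<in> S then a1 x else a0 x)) \<nu>0 r0 \<Longrightarrow>
        coupling (density lborel (\<lambda>x. if x \<in> S then a0 x else a1 x)) \<nu>1 r1 \<Longrightarrow> V \<le> cost c r0 + cost c r1"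
    and bt [measurable]: "b \<in> borel_measurable borel" "t \<in> borel_measurable borel"
    and bt_le: "\<And>x. b x \<le> a1 x - a0 x" "\<And>x. t x \<le> a0 x - a1 x"
    and a' [measurable]: "a0' \<in> borel_measurable borel" "a1' \<in> borel_measurable borel"
    and eq: "\<And>x. a0' x + t x = a0 x + b x" "\<And>x. a1' x + b x = a1 x + t x"
    and q: "coupling (density lborel a0') \<nu>0 q0" "coupling (density lborel a1') \<nu>1 q1"
  shows "V \<le> cost c q0 + cost c q1"
proof -
  have Kb [measurable]: "K \<in> sets borel" using K(1) by (simp add: borel_closed compact_imp_closed)
  have btle': "b x \<le> a1 x" "t x \<le> a0 x" for x using bt_le[of x] diff_le_self_ennreal order_trans by blast+
  have a'le: "a0' x \<le> a0 x + a1 x" "a1' x \<le> a0 x + a1 x" for x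
  proof -
    have "a0' x \<le> a0' x + t x" "a1' x \<le> a1' x + b x" by simp_all
    then show "a0' x \<le> a0 x + a1 x" "a1' x \<le> a0 x + a1 x"
      using btle'[of x] eq[of x] by (metis add.commute add_left_mono order_trans)+
  qed
  have fin2: "(\<integral>\<^sup>+x. a0 x + a1 x \<partial>lborel) < \<infinity>" using fin by (subst nn_integral_add) auto
  have le_fin: "(\<integral>\<^sup>+x. f x \<partial>lborel) < \<infinity>" if "\<And>x. f x \<le> a0 x + a1 x" for f :: "'a \<Rightarrow> ennreal"
    using nn_integral_mono[of lborel f "\<lambda>x. a0 x + a1 x"] that fin2 by (meson le_less_trans)
  have le_finP: "(\<integral>\<^sup>+x. f x * indicator P x \<partial>lborel) < \<infinity>" if "\<And>x. f x \<le> a0 x + a1 x" for f :: "'a \<Rightarrow> ennreal" and P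
    using that by (intro le_fin) (auto simp: indicator_def)
  have qfin: "emeasure q0 UNIV < \<infinity>" "emeasure q1 UNIV < \<infinity>"
    using coupling_mass(1)[OF q(1)] coupling_mass(1)[OF q(2)] le_fin[OF a'le(1)] le_fin[OF a'le(2)] by (simp_all add: emeasure_density)
  define m where "m = enn2real (emeasure q0 UNIV + emeasure q1 UNIV)"
  have m: "emeasure q0 UNIV + emeasure q1 UNIV = ennreal m" "0 \<le> m" using qfin by (auto simp: m_def)
  show ?thesis
  proof (rule ennreal_le_epsilon)
    fix \<epsilon>0 :: real assume \<epsilon>0: "0 < \<epsilon>0"
    \<comment> \<open>Over the total mass \<open>m\<close> the errors then add up to at most
      \<open>\<epsilon>0\<close>; the 1 allows for \<open>m = 0\<close>.\<close>
    define \<epsilon> where "\<epsilon> = \<epsilon>0 / (m + 1)"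
    have \<epsilon>: "0 < \<epsilon>" "\<epsilon> * m \<le> \<epsilon>0" using \<epsilon>0 m by (auto simp: \<epsilon>_def field_simps)
    have "uniformly_continuous_on (K \<times> K) (\<lambda>z. c (fst z) (snd z))"
      using K(1) c(1) by (intro compact_uniformly_continuous compact_Times continuous_on_subset[OF c(1)]) auto
    then obtain \<delta> where \<delta>: "\<delta> > 0" "\<And>z z'. z \<in> K \<times> K \<Longrightarrow> z' \<in> K \<times> K \<Longrightarrow> dist z' z < \<delta> \<Longrightarrow>
        dist (c (fst z') (snd z')) (c (fst z) (snd z)) < \<epsilon>"
      using \<epsilon>(1) unfolding uniformly_continuous_on_def by metis
    obtain N :: nat and P where P: "\<And>n. P n \<in> sets borel" "disjoint_family P" "(\<Union>n<N. P n) = K"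
      "\<And>n x x'. x \<in> P n \<Longrightarrow> x' \<in> P n \<Longrightarrow> dist x x' < \<delta>"
      using finite_partition_small[OF K(1) \<delta>(1)] by metis
    note [measurable] = P(1)
    have PK: "P n \<subseteq> K" if "n < N" for n using that P(3) by auto
    define good where "good n S \<longleftrightarrow> S \<in> sets borel \<and> S \<subseteq> P n \<and>
        (\<integral>\<^sup>+x. (a1 x - a0 x) * indicator S x \<partial>lborel) = (\<integral>\<^sup>+x. b x * indicator (P n) x \<partial>lborel) \<and>
        (\<integral>\<^sup>+x. (a0 x - a1 x) * indicator S x \<partial>lborel) = (\<integral>\<^sup>+x. t x * indicator (P n) x \<partial>lborel)" for n S
    have "\<exists>S. good n S" if n: "n < N" for n
    proof -
      have bd: "bounded (P n)" using bounded_subset[OF compact_imp_bounded[OF K(1)] PK[OF n]] .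
      have d: "a1 x - a0 x \<le> a0 x + a1 x" "a0 x - a1 x \<le> a0 x + a1 x" for x
        by (meson diff_le_self_ennreal add_increasing add_increasing2 order_refl zero_le)+
      obtain S1 where S1: "S1 \<in> sets borel" "S1 \<subseteq> P n"
        "(\<integral>\<^sup>+x. (a1 x - a0 x) * indicator S1 x \<partial>lborel) = (\<integral>\<^sup>+x. b x * indicator (P n) x \<partial>lborel)"
      proof (rule subset_with_integral[OF _ P(1) bd])
        show "(\<integral>\<^sup>+x. (a1 x - a0 x) * indicator (P n) x \<partial>lborel) < \<infinity>" by (rule le_finP[OF d(1)])
        show "(\<integral>\<^sup>+x. b x * indicator (P n) x \<partial>lborel) \<le> (\<integral>\<^sup>+x. (a1 x - a0 x) * indicator (P n) x \<partial>lborel)"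
          by (intro nn_integral_mono mult_right_mono bt_le) simp
      qed measurable
      obtain S2 where S2: "S2 \<in> sets borel" "S2 \<subseteq> P n"
        "(\<integral>\<^sup>+x. (a0 x - a1 x) * indicator S2 x \<partial>lborel) = (\<integral>\<^sup>+x. t x * indicator (P n) x \<partial>lborel)"
      proof (rule subset_with_integral[OF _ P(1) bd])
        show "(\<integral>\<^sup>+x. (a0 x - a1 x) * indicator (P n) x \<partial>lborel) < \<infinity>" by (rule le_finP[OF d(2)])
        show "(\<integral>\<^sup>+x. t x * indicator (P n) x \<partial>lborel) \<le> (\<integral>\<^sup>+x. (a0 x - a1 x) * indicator (P n) x \<partial>lborel)"
          by (intro nn_integral_mono mult_right_mono bt_le) simp
      qed measurable
      \<comment> \<open>\<open>S1\<close> realizes the fraction \<open>b\<close> and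
        \<open>S2\<close> the fraction \<open>t\<close>. Each is cut down to the region where its
        excess lives, so that neither disturbs the other.\<close>
      define S where "S = (S1 \<inter> {x. a0 x < a1 x}) \<union> (S2 \<inter> {x. a1 x < a0 x})"
      have "{x. a0 x < a1 x} \<in> sets borel" "{x. a1 x < a0 x} \<in> sets borel" by measurable
      then have "S \<in> sets borel" unfolding S_def using S1 S2 by auto
      moreover have "S \<subseteq> P n" using S1 S2 by (auto simp: S_def)
      moreover have "(a1 x - a0 x) * indicator S x = (a1 x - a0 x) * indicator S1 x" for x
        by (cases "a0 x < a1 x") (auto simp: S_def indicator_def not_less diff_eq_0_of_le_ennreal afin)
      moreover have "(a0 x - a1 x) * indicator S x = (a0 x - a1 x) * indicator S2 x" for x
        by (cases "a1 x < a0 x") (auto simp: S_def indicator_def not_less diff_eq_0_of_le_ennreal afin)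
      ultimately show ?thesis using S1(3) S2(3) by (intro exI[of _ S]) (simp add: good_def)
    qed
    then have "\<forall>n\<in>{..<N}. \<exists>S. good n S" by simp
    from bchoice[OF this] obtain Sn where "\<forall>n\<in>{..<N}. good n (Sn n)" by blast
    then have Sn: "Sn n \<in> sets borel" "Sn n \<subseteq> P n"
        "(\<integral>\<^sup>+x. (a1 x - a0 x) * indicator (Sn n) x \<partial>lborel) = (\<integral>\<^sup>+x. b x * indicator (P n) x \<partial>lborel)"
        "(\<integral>\<^sup>+x. (a0 x - a1 x) * indicator (Sn n) x \<partial>lborel) = (\<integral>\<^sup>+x. t x * indicator (P n) x \<partial>lborel)"
      if "n < N" for n
      using that by (simp_all add: good_def)
    define S where "S = (\<Union>n<N. Sn n)"
    have S [measurable]: "S \<in> sets borel" unfolding S_def using Sn(1) by auto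
    have PS: "P n \<inter> S = Sn n" if "n < N" for n
    proof
      show "Sn n \<subseteq> P n \<inter> S" using Sn(2) that by (auto simp: S_def)
      show "P n \<inter> S \<subseteq> Sn n"
      proof
        fix x assume "x \<in> P n \<inter> S"
        then obtain k where k: "k < N" "x \<in> Sn k" "x \<in> P n" by (auto simp: S_def)
        then have "x \<in> P k" using Sn(2) by auto
        then have "k = n" using k P(2) by (auto simp: disjoint_family_on_def)
        then show "x \<in> Sn n" using k by simp
      qed
    qed
    define e0 where "e0 = (\<lambda>x. if x \<in> S then a1 x else a0 x)"
    define e1 where "e1 = (\<lambda>x. if x \<in> S then a0 x else a1 x)"
    have em [measurable]: "e0 \<in> borel_measurable borel" "e1 \<in> borel_measurable borel"
      unfolding e0_def e1_def by measurable
    have btf: "b x \<le> a0 x + a1 x" "t x \<le> a0 x + a1 x" for x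
      using btle'[of x] by (auto intro: add_increasing add_increasing2)
    have mass0: "emeasure (density lborel e0) (P n) = emeasure (density lborel a0') (P n)" if n: "n < N" for n
      using cell_mass[OF a a'(1) bt S P(1) afin Sn(3)[OF n, folded PS[OF n]] Sn(4)[OF n, folded PS[OF n]] eq(1) le_finP[OF btf(2)]] P(1)
      by (simp add: emeasure_density e0_def)
    have mass1: "emeasure (density lborel e1) (P n) = emeasure (density lborel a1') (P n)" if n: "n < N" for n
      using cell_mass[OF a(2,1) a'(2) bt(2,1) S P(1) afin(2,1) Sn(4)[OF n, folded PS[OF n]] Sn(3)[OF n, folded PS[OF n]] eq(2) le_finP[OF btf(1)]] P(1)
      by (simp add: emeasure_density e1_def)
    have null: "emeasure (density lborel f) (- (\<Union>n<N. P n)) = 0"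
      if "f \<in> borel_measurable borel" "\<And>x. f x \<le> a0 x + a1 x" for f
      unfolding P(3)
    proof (rule emeasure_density_eq_0[OF that(1)])
      fix x assume "x \<in> - K" then show "f x = 0" using that(2)[of x] K(2,3)[of x] by simp
    qed (simp add: borel_comp Kb)
    have e_le: "e0 x \<le> a0 x + a1 x" "e1 x \<le> a0 x + a1 x" for x by (auto simp: e0_def e1_def)
    let ?c = "\<lambda>z. ennreal (c (fst z) (snd z))"
    have cm: "?c \<in> borel_measurable borel"
      by (rule measurable_compose[OF borel_measurable_continuous_onI[OF c(1)] measurable_ennreal])
    have osc: "?c (x, y) \<le> ?c (x', y) + ennreal \<epsilon>" if "n < N" "x \<in> P n" "x' \<in> P n" "y \<in> K" for n x x' y
    proof -
      have "dist (c x y) (c x' y) < \<epsilon>"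
        using \<delta>(2)[of "(x', y)" "(x, y)"] that PK[of n] P(4)[of x n x'] by (auto simp: dist_Pair_Pair)
      then have "c x y \<le> c x' y + \<epsilon>" by (simp add: dist_real_def)
      then show ?thesis using c(2) \<epsilon>(1) by (simp add: ennreal_plus[symmetric] del: ennreal_plus)
    qed
    \<comment> \<open>The swapped density has the cell masses of \<open>a0'\<close>, so
      \<open>q0\<close> can be coupled anew to it at small extra cost, and \<open>V\<close> applies
      to the result.\<close>
    obtain r0 where r0: "coupling (density lborel e0) \<nu>0 r0" "(\<integral>\<^sup>+z. ?c z \<partial>r0) \<le> (\<integral>\<^sup>+z. ?c z \<partial>q0) + ennreal \<epsilon> * emeasure q0 UNIV"
    proof (rule recouple[OF q(1) qfin(1) _ P(1,2) _ _ Kb K(4) _ cm _ osc])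
      show "emeasure (density lborel a0') (- (\<Union>n<N. P n)) = 0" by (rule null[OF a'(1) a'le(1)])
      show "emeasure (density lborel e0) (- (\<Union>n<N. P n)) = 0" by (rule null[OF em(1) e_le(1)])
    qed (use \<epsilon> mass0 in auto)
    obtain r1 where r1: "coupling (density lborel e1) \<nu>1 r1" "(\<integral>\<^sup>+z. ?c z \<partial>r1) \<le> (\<integral>\<^sup>+z. ?c z \<partial>q1) + ennreal \<epsilon> * emeasure q1 UNIV"
    proof (rule recouple[OF q(2) qfin(2) _ P(1,2) _ _ Kb K(5) _ cm _ osc])
      show "emeasure (density lborel a1') (- (\<Union>n<N. P n)) = 0" by (rule null[OF a'(2) a'le(2)])
      show "emeasure (density lborel e1) (- (\<Union>n<N. P n)) = 0" by (rule null[OF em(2) e_le(2)])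
    qed (use \<epsilon> mass1 in auto)
    have "V \<le> cost c r0 + cost c r1"
      using V[OF S r0(1)[unfolded e0_def] r1(1)[unfolded e1_def]] .
    also have "\<dots> \<le> (cost c q0 + ennreal \<epsilon> * emeasure q0 UNIV) + (cost c q1 + ennreal \<epsilon> * emeasure q1 UNIV)"
      unfolding cost_def by (rule add_mono[OF r0(2) r1(2)])
    also have "\<dots> = cost c q0 + cost c q1 + ennreal \<epsilon> * (emeasure q0 UNIV + emeasure q1 UNIV)"
      by (simp add: distrib_left ac_simps)
    also have "ennreal \<epsilon> * (emeasure q0 UNIV + emeasure q1 UNIV) \<le> ennreal \<epsilon>0"
      using \<epsilon> m by (simp add: ennreal_mult'[symmetric] ennreal_leI)
    finally show "V \<le> cost c q0 + cost c q1 + ennreal \<epsilon>0" by (simp add: add_left_mono)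
  qed
qed

section \<open>Contraction for optimal plans\<close>

text \<open>Takes an eighth of the piece \<open>w p\<close> out of \<open>p\<close> and brings in an
  eighth of \<open>w' p'\<close>. For weights up to 4 the removed share is at most one half, so
  \<open>p\<close> is absolutely continuous with respect to the result.\<close>

definition exch :: "'z::topological_space measure \<Rightarrow> ('z \<Rightarrow> ennreal) \<Rightarrow> 'z measure \<Rightarrow> ('z \<Rightarrow> ennreal) \<Rightarrow> 'z measure" where
  "exch p w p' w' = msum {0, 1::nat} (\<lambda>i. if i = 0 then density p (\<lambda>z. 1 - w z * ennreal (1/8)) else density p' (\<lambda>z. w' z * ennreal (1/8)))"

lemma sets_exch [simp]: "sets (exch p w p' w') = sets borel"
  by (simp add: exch_def)

lemma nn_integral_exch:
  assumes s: "sets p = sets borel" "sets p' = sets borel"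
    and w [measurable]: "w \<in> borel_measurable borel" "w' \<in> borel_measurable borel" and q [measurable]: "q \<in> borel_measurable borel"
  shows "(\<integral>\<^sup>+z. q z \<partial>exch p w p' w') = (\<integral>\<^sup>+z. (1 - w z * ennreal (1/8)) * q z \<partial>p) + (\<integral>\<^sup>+z. w' z * ennreal (1/8) * q z \<partial>p')"
proof -
  have m: "r \<in> borel_measurable borel \<Longrightarrow> r \<in> borel_measurable p" "r \<in> borel_measurable borel \<Longrightarrow> r \<in> borel_measurable p'"
    for r :: "'a \<Rightarrow> ennreal"
    using sets_eq_borel_measurableI[OF s(1)] sets_eq_borel_measurableI[OF s(2)] by blast+
  show ?thesis unfolding exch_def
    by (subst nn_integral_msum) (auto simp: s nn_integral_density m)
qed

text \<open>The bound on \<open>w\<close> keeps the subtraction in \<open>exch\<close> from being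
  truncated. The removed part stays on the left, so that no integrals need to be subtracted.\<close>

lemma nn_integral_exch_add:
  assumes s: "sets p = sets borel" "sets p' = sets borel"
    and w [measurable]: "w \<in> borel_measurable borel" "w' \<in> borel_measurable borel" and q [measurable]: "q \<in> borel_measurable borel"
    and le: "\<And>z. w z \<le> 4"
  shows "(\<integral>\<^sup>+z. q z \<partial>exch p w p' w') + (\<integral>\<^sup>+z. w z * ennreal (1/8) * q z \<partial>p)
    = (\<integral>\<^sup>+z. q z \<partial>p) + (\<integral>\<^sup>+z. w' z * ennreal (1/8) * q z \<partial>p')"
proof -
  have m: "r \<in> borel_measurable borel \<Longrightarrow> r \<in> borel_measurable p" for r :: "'a \<Rightarrow> ennreal"
    using sets_eq_borel_measurableI[OF s(1)] by blast
  have w1: "w z * ennreal (1/8) \<le> 1" for z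
  proof -
    have "w z * ennreal (1/8) \<le> ennreal 4 * ennreal (1/8)" using le by (intro mult_right_mono) simp_all
    also have "\<dots> = ennreal (1/2)" by (subst ennreal_mult'[symmetric]) simp_all
    also have "\<dots> \<le> ennreal 1" by (rule ennreal_leI) simp
    finally show ?thesis by simp
  qed
  have "(\<integral>\<^sup>+z. q z \<partial>p) = (\<integral>\<^sup>+z. (1 - w z * ennreal (1/8)) * q z + w z * ennreal (1/8) * q z \<partial>p)"
    by (intro nn_integral_cong) (simp add: diff_add_cancel_ennreal[OF w1] flip: distrib_right)
  also have "\<dots> = (\<integral>\<^sup>+z. (1 - w z * ennreal (1/8)) * q z \<partial>p) + (\<integral>\<^sup>+z. w z * ennreal (1/8) * q z \<partial>p)"
    by (rule nn_integral_add; rule m; measurable)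
  finally show ?thesis unfolding nn_integral_exch[OF s w q] by (simp add: ac_simps)
qed

text \<open>The exchange changes the first marginal by \<open>(k' - k) / 8\<close>, which by the
  first balance equation is \<open>t - b\<close>. Finiteness lets the terms moved across be
  cancelled.\<close>

lemma Xm_exch:
  fixes p p' :: "('a::euclidean_space \<times> 'a) measure"
  assumes s: "sets p = sets borel" "sets p' = sets borel"
    and w [measurable]: "w \<in> borel_measurable borel" "w' \<in> borel_measurable borel" and le: "\<And>z. w z \<le> 4"
    and [measurable]: "a \<in> borel_measurable borel" "a' \<in> borel_measurable borel" "b \<in> borel_measurable borel"
      "t \<in> borel_measurable borel" "k \<in> borel_measurable borel" "k' \<in> borel_measurable borel"
    and X: "Xm p = density lborel a"
    and W: "\<And>q. q \<in> borel_measurable borel \<Longrightarrow> (\<integral>\<^sup>+z. w z * q (fst z) \<partial>p) = (\<integral>\<^sup>+x. k x * q x \<partial>lborel)"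
    and W': "\<And>q. q \<in> borel_measurable borel \<Longrightarrow> (\<integral>\<^sup>+z. w' z * q (fst z) \<partial>p') = (\<integral>\<^sup>+x. k' x * q x \<partial>lborel)"
    and eq: "\<And>x. k x * ennreal (1/8) + t x = k' x * ennreal (1/8) + b x" "\<And>x. a' x + b x = a x + t x"
    and fin: "(\<integral>\<^sup>+x. k x \<partial>lborel) < \<infinity>" "(\<integral>\<^sup>+x. b x \<partial>lborel) < \<infinity>"
  shows "Xm (exch p w p' w') = density lborel a'"
proof (rule measure_eqI)
  fix A assume "A \<in> sets (Xm (exch p w p' w'))"
  then have A [measurable]: "A \<in> sets borel" by simp
  have iA [measurable]: "(indicator A :: 'a \<Rightarrow> ennreal) \<in> borel_measurable borel" by simp
  let ?e = "ennreal (1/8)" and ?i = "indicator A :: 'a \<Rightarrow> ennreal"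
  define k8 where "k8 = (\<lambda>x. k x * ?e)"
  define k8' where "k8' = (\<lambda>x. k' x * ?e)"
  have [measurable]: "k8 \<in> borel_measurable borel" "k8' \<in> borel_measurable borel"
    unfolding k8_def k8'_def by measurable
  have k8f: "(\<integral>\<^sup>+x. k8 x * ?i x \<partial>lborel) < \<infinity>" and bf: "(\<integral>\<^sup>+x. b x * ?i x \<partial>lborel) < \<infinity>"
  proof -
    have "(\<integral>\<^sup>+x. k8 x * ?i x \<partial>lborel) \<le> (\<integral>\<^sup>+x. k x * ?e \<partial>lborel)"
      unfolding k8_def by (intro nn_integral_mono) (simp add: indicator_def)
    also have "\<dots> = (\<integral>\<^sup>+x. k x \<partial>lborel) * ?e" by (rule nn_integral_multc) measurable
    also have "\<dots> < \<infinity>" using fin(1) by (simp add: ennreal_mult_less_top)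
    finally show "(\<integral>\<^sup>+x. k8 x * ?i x \<partial>lborel) < \<infinity>" .
    have "(\<integral>\<^sup>+x. b x * ?i x \<partial>lborel) \<le> (\<integral>\<^sup>+x. b x \<partial>lborel)"
      by (intro nn_integral_mono) (simp add: indicator_def)
    then show "(\<integral>\<^sup>+x. b x * ?i x \<partial>lborel) < \<infinity>" using fin(2) by (rule le_less_trans)
  qed
  note e = emeasure_Xm_nn_integral[OF _ A]
  have ia: "emeasure (density lborel f) A = (\<integral>\<^sup>+x. f x * ?i x \<partial>lborel)" if "f \<in> borel_measurable borel" for f
    using that by (subst emeasure_density) auto
  have w1: "(\<integral>\<^sup>+z. w z * ?e * ?i (fst z) \<partial>p) = (\<integral>\<^sup>+x. k8 x * ?i x \<partial>lborel)"
    using W[of "\<lambda>x. ?e * ?i x"] by (simp add: k8_def mult.assoc)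
  have w2: "(\<integral>\<^sup>+z. w' z * ?e * ?i (fst z) \<partial>p') = (\<integral>\<^sup>+x. k8' x * ?i x \<partial>lborel)"
    using W'[of "\<lambda>x. ?e * ?i x"] by (simp add: k8'_def mult.assoc)
  have im: "(\<lambda>z :: 'a \<times> 'a. ?i (fst z)) \<in> borel_measurable borel" by measurable
  let ?X = "emeasure (Xm (exch p w p' w')) A"
  have main: "?X + (\<integral>\<^sup>+x. k8 x * ?i x \<partial>lborel) = (\<integral>\<^sup>+x. a x * ?i x \<partial>lborel) + (\<integral>\<^sup>+x. k8' x * ?i x \<partial>lborel)"
    using nn_integral_exch_add[OF s w im le] unfolding w1 w2 e[OF sets_exch, symmetric] e[OF s(1), symmetric] X
    by (simp add: ia)
  have add: "(\<integral>\<^sup>+x. f x * ?i x \<partial>lborel) + (\<integral>\<^sup>+x. g x * ?i x \<partial>lborel) = (\<integral>\<^sup>+x. (f x + g x) * ?i x \<partial>lborel)"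
    if [measurable]: "f \<in> borel_measurable borel" "g \<in> borel_measurable borel" for f g
    by (subst nn_integral_add[symmetric]) (auto simp: distrib_right)
  have kb: "(\<integral>\<^sup>+x. k8' x * ?i x \<partial>lborel) + (\<integral>\<^sup>+x. b x * ?i x \<partial>lborel)
      = (\<integral>\<^sup>+x. t x * ?i x \<partial>lborel) + (\<integral>\<^sup>+x. k8 x * ?i x \<partial>lborel)"
    using eq(1) by (simp add: add k8_def k8'_def add.commute)
  have "?X + (\<integral>\<^sup>+x. b x * ?i x \<partial>lborel) + (\<integral>\<^sup>+x. k8 x * ?i x \<partial>lborel)
      = (\<integral>\<^sup>+x. a x * ?i x \<partial>lborel) + ((\<integral>\<^sup>+x. k8' x * ?i x \<partial>lborel) + (\<integral>\<^sup>+x. b x * ?i x \<partial>lborel))"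
    using main by (simp add: ac_simps)
  also have "\<dots> = (\<integral>\<^sup>+x. a x * ?i x \<partial>lborel) + (\<integral>\<^sup>+x. t x * ?i x \<partial>lborel) + (\<integral>\<^sup>+x. k8 x * ?i x \<partial>lborel)"
    unfolding kb by (simp add: ac_simps)
  finally have "?X + (\<integral>\<^sup>+x. b x * ?i x \<partial>lborel) = (\<integral>\<^sup>+x. a x * ?i x \<partial>lborel) + (\<integral>\<^sup>+x. t x * ?i x \<partial>lborel)"
    using k8f unfolding add.commute[of _ "\<integral>\<^sup>+x. k8 x * ?i x \<partial>lborel"] ennreal_add_left_cancel by auto
  also have "\<dots> = (\<integral>\<^sup>+x. a' x * ?i x \<partial>lborel) + (\<integral>\<^sup>+x. b x * ?i x \<partial>lborel)"
    by (simp add: add eq(2))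
  finally have "?X = (\<integral>\<^sup>+x. a' x * ?i x \<partial>lborel)"
    using bf unfolding add.commute[of _ "\<integral>\<^sup>+x. b x * ?i x \<partial>lborel"] ennreal_add_left_cancel by auto
  then show "?X = emeasure (density lborel a') A" by (simp add: ia)
qed simp

lemma Ym_exch:
  fixes p p' :: "('a::euclidean_space \<times> 'a) measure"
  assumes s: "sets p = sets borel" "sets p' = sets borel"
    and w [measurable]: "w \<in> borel_measurable borel" "w' \<in> borel_measurable borel" and le: "\<And>z. w z \<le> 4"
    and fin: "emeasure p UNIV < \<infinity>"
    and W: "\<And>q. q \<in> borel_measurable borel \<Longrightarrow> (\<integral>\<^sup>+z. w z * q (snd z) \<partial>p) = (\<integral>\<^sup>+z. w' z * q (snd z) \<partial>p')"
  shows "Ym (exch p w p' w') = Ym p"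
proof (rule measure_eqI)
  fix A assume "A \<in> sets (Ym (exch p w p' w'))"
  then have A [measurable]: "A \<in> sets borel" by simp
  have iA [measurable]: "(indicator A :: 'a \<Rightarrow> ennreal) \<in> borel_measurable borel" by simp
  let ?e = "ennreal (1/8)" and ?i = "indicator A :: 'a \<Rightarrow> ennreal"
  note e = emeasure_Ym_nn_integral[OF _ A]
  have im: "(\<lambda>z :: 'a \<times> 'a. ?i (snd z)) \<in> borel_measurable borel" by measurable
  have ww: "(\<integral>\<^sup>+z. w' z * ?e * ?i (snd z) \<partial>p') = (\<integral>\<^sup>+z. w z * ?e * ?i (snd z) \<partial>p)"
    using W[of "\<lambda>x. ?e * ?i x"] by (simp add: mult.assoc)
  have "(\<integral>\<^sup>+z. w z * ?e * ?i (snd z) \<partial>p) \<le> (\<integral>\<^sup>+z. 4 \<partial>p)"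
  proof (rule nn_integral_mono)
    fix z
    have "w z * ?e \<le> 4 * 1" by (intro mult_mono le) auto
    then show "w z * ?e * ?i (snd z) \<le> 4" by (simp add: indicator_def)
  qed
  also have "\<dots> < \<infinity>" using fin sets_eq_imp_space_eq[OF s(1)] by (simp add: ennreal_mult_less_top)
  finally have f: "(\<integral>\<^sup>+z. w z * ?e * ?i (snd z) \<partial>p) < \<infinity>" .
  show "emeasure (Ym (exch p w p' w')) A = emeasure (Ym p) A"
    using nn_integral_exch_add[OF s w im le] f
    unfolding ww e[OF sets_exch, symmetric] e[OF s(1), symmetric]
      add.commute[of _ "\<integral>\<^sup>+z. w z * ?e * ?i (snd z) \<partial>p"] ennreal_add_left_cancel by auto
qed simp

context smooth_cost
begin

text \<open>An optimal plan lies on the graph of a map over its absolutely continuous second marginal. So two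
  pieces of it with equal second marginals have equal first marginals.\<close>

lemma optimal_exch_marginals_eq:
  assumes s: "sets p = sets borel" "sets p' = sets borel"
    and w [measurable]: "w \<in> borel_measurable borel" "w' \<in> borel_measurable borel"
    and le: "\<And>z. w z \<le> 4" "\<And>z. w' z \<le> 4"
    and fin: "emeasure p UNIV < \<infinity>"
    and W: "\<And>q. q \<in> borel_measurable borel \<Longrightarrow> (\<integral>\<^sup>+z. w z * q (snd z) \<partial>p) = (\<integral>\<^sup>+z. w' z * q (snd z) \<partial>p')"
    and Y: "Ym p = density lborel \<sigma>" "\<sigma> \<in> borel_measurable borel"
    and K: "compact K" "emeasure (exch p w p' w') (- (K \<times> K)) = 0"
    and opt: "optimal c (exch p w p' w')" "emeasure (exch p w p' w') UNIV < \<infinity>" "cost c (exch p w p' w') < \<infinity>"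
    and q: "q \<in> borel_measurable borel"
  shows "(\<integral>\<^sup>+z. w z * q (fst z) \<partial>p) = (\<integral>\<^sup>+z. w' z * q (fst z) \<partial>p')"
proof -
  let ?e = "ennreal (1/8)" and ?P = "exch p w p' w'"
  have m: "r \<in> borel_measurable borel \<Longrightarrow> r \<in> borel_measurable p" "r \<in> borel_measurable borel \<Longrightarrow> r \<in> borel_measurable p'"
    for r :: "'a \<times> 'a \<Rightarrow> ennreal"
    using sets_eq_borel_measurableI[OF s(1)] sets_eq_borel_measurableI[OF s(2)] by blast+
  \<comment> \<open>Intersecting with \<open>K \<times> K\<close> makes the support compact, as the
    branching and graph arguments require.\<close>
  define \<Gamma> where "\<Gamma> = (K \<times> K) \<inter> msupport ?P"
  have \<Gamma>: "compact \<Gamma>" unfolding \<Gamma>_def using K(1) closed_msupport by (intro compact_Int_closed compact_Times)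
  then have \<Gamma>b: "- \<Gamma> \<in> sets borel" by (intro borel_comp borel_closed compact_imp_closed)
  have KK: "K \<times> K \<in> sets borel" using K(1) by (intro borel_closed compact_imp_closed compact_Times)
  have "AE z in ?P. z \<in> msupport ?P" by (rule AE_msupport) simp
  moreover have "- (K \<times> K) \<in> null_sets ?P" using K(2) borel_comp[OF KK] by (simp add: null_sets_def)
  from AE_not_in[OF this] have "AE z in ?P. z \<in> K \<times> K" by eventually_elim simp
  ultimately have AE: "AE z in ?P. z \<in> \<Gamma>" by eventually_elim (simp add: \<Gamma>_def)
  have "emeasure ?P (- \<Gamma>) = 0"
    using AE \<Gamma>b sets_eq_imp_space_eq[OF sets_exch, of p w p' w'] by (subst AE_iff_measurable[symmetric, of "- \<Gamma>" _ "\<lambda>z. z \<in> \<Gamma>"]) auto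
  then have "(\<integral>\<^sup>+z. indicator (- \<Gamma>) z \<partial>?P) = 0" using \<Gamma>b by simp
  moreover have i\<Gamma> [measurable]: "(indicator (- \<Gamma>) :: 'a \<times> 'a \<Rightarrow> ennreal) \<in> borel_measurable borel" using \<Gamma>b by simp
  ultimately have z: "(\<integral>\<^sup>+z. (1 - w z * ?e) * indicator (- \<Gamma>) z \<partial>p) = 0" "(\<integral>\<^sup>+z. w' z * ?e * indicator (- \<Gamma>) z \<partial>p') = 0"
    using nn_integral_exch[OF s w i\<Gamma>] by simp_all
  have half: "w z * ?e \<le> ennreal (1/2)" for z
  proof -
    have "w z * ?e \<le> ennreal 4 * ?e" using le by (intro mult_right_mono) simp_all
    also have "\<dots> = ennreal (1/2)" by (subst ennreal_mult'[symmetric]) simp_all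
    finally show ?thesis .
  qed
  have "AE z in p. (1 - w z * ?e) * indicator (- \<Gamma>) z = 0"
    using z(1) by (subst (asm) nn_integral_0_iff_AE) (rule m, measurable)
  \<comment> \<open>At least half of \<open>p\<close> survives the exchange, so \<open>p\<close>
    itself lies on \<Gamma> almost everywhere. Of \<open>p'\<close> only the transferred part, where
    \<open>w'\<close> is positive, is known to lie there.\<close>
  then have A0: "AE z in p. z \<in> \<Gamma>"
  proof eventually_elim
    case (elim z)
    have "1 - w z * ?e \<noteq> 0"
    proof
      assume "1 - w z * ?e = 0"
      then have "1 \<le> w z * ?e" by (rule ennreal_minus_eq_0)
      also have "\<dots> \<le> ennreal (1/2)" by (rule half)
      finally have "ennreal 1 \<le> ennreal (1/2)" by simp
      then show False by (subst (asm) ennreal_le_iff) simp_all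
    qed
    then show ?case using elim by (simp add: indicator_def split: if_splits)
  qed
  have "AE z in p'. w' z * ?e * indicator (- \<Gamma>) z = 0"
    using z(2) by (subst (asm) nn_integral_0_iff_AE) (rule m, measurable)
  then have A1: "AE z in p'. w' z > 0 \<longrightarrow> z \<in> \<Gamma>"
    by eventually_elim (auto simp: indicator_def split: if_splits)
  have mono: "c x y + c x' y' \<le> c x y' + c x' y" if "(x, y) \<in> \<Gamma>" "(x', y') \<in> \<Gamma>" for x y x' y'
    using optimal_two_monotone[OF opt c_cont c_nonneg] that by (simp add: \<Gamma>_def)
  obtain N where N: "N \<in> sets borel" "emeasure lborel N = 0"
    "\<And>x x' y. (x, y) \<in> \<Gamma> \<Longrightarrow> (x', y) \<in> \<Gamma> \<Longrightarrow> y \<notin> N \<Longrightarrow> x = x'"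
    using branching_null[OF \<Gamma> mono] by metis
  define g1 where "g1 = density p w"
  define g0 where "g0 = density p' w'"
  have gs: "sets g0 = sets borel" "sets g1 = sets borel" by (simp_all add: g0_def g1_def s)
  have gI: "(\<integral>\<^sup>+z. r z \<partial>g1) = (\<integral>\<^sup>+z. w z * r z \<partial>p)" "(\<integral>\<^sup>+z. r z \<partial>g0) = (\<integral>\<^sup>+z. w' z * r z \<partial>p')"
    if "r \<in> borel_measurable borel" for r
    unfolding g0_def g1_def using that by (auto intro!: nn_integral_density m)
  have Yg: "Ym g1 = Ym g0"
  proof (rule measure_eqI)
    fix A assume "A \<in> sets (Ym g1)"
    then have A: "A \<in> sets borel" by simp
    have iA [measurable]: "(indicator A :: 'a \<Rightarrow> ennreal) \<in> borel_measurable borel" using A by simp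
    have r: "(\<lambda>z :: 'a \<times> 'a. indicator A (snd z) :: ennreal) \<in> borel_measurable borel" by measurable
    show "emeasure (Ym g1) A = emeasure (Ym g0) A"
      unfolding emeasure_Ym_nn_integral[OF gs(1) A] emeasure_Ym_nn_integral[OF gs(2) A] gI[OF r] by (rule W[OF iA])
  qed simp
  have YN: "emeasure (Ym g1) N = 0"
  proof -
    have N0: "N \<in> null_sets lborel" using N by (simp add: null_sets_def)
    have "emeasure (Ym p) N = 0"
      unfolding Y(1) using absolutely_continuousI_density[of \<sigma> lborel] Y(2) N0
      by (auto simp: absolutely_continuous_def null_sets_def)
    then have "emeasure p (UNIV \<times> N) = 0" using emeasure_Ym[OF s(1) N(1)] by simp
    then have "UNIV \<times> N \<in> null_sets p" using N(1) s by (auto simp: null_sets_def intro!: Times_borel)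
    then have "UNIV \<times> N \<in> null_sets g1"
      unfolding g1_def using absolutely_continuousI_density[of w p] m(1)[OF w(1)] by (auto simp: absolutely_continuous_def)
    then show ?thesis using emeasure_Ym[OF gs(2) N(1)] by (simp add: null_sets_def)
  qed
  have gfin: "emeasure g1 UNIV < \<infinity>"
  proof -
    have "emeasure g1 UNIV = (\<integral>\<^sup>+z. w z \<partial>p)" unfolding g1_def using m(1)[OF w(1)] s by (subst emeasure_density) (simp_all add: sets_eq_imp_space_eq[OF s(1)])
    also have "\<dots> \<le> (\<integral>\<^sup>+z. 4 \<partial>p)" by (intro nn_integral_mono le)
    also have "\<dots> < \<infinity>" using fin sets_eq_imp_space_eq[OF s(1)] by (simp add: ennreal_mult_less_top)
    finally show ?thesis .
  qed
  have "Xm g1 = Xm g0"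
  proof (rule graph_marginals_eq[OF gs(2,1) \<Gamma> _ _ N(1,3) Yg YN gfin])
    show "AE z in g1. z \<in> \<Gamma>" unfolding g1_def using A0 m(1)[OF w(1)] by (subst AE_density) auto
    show "AE z in g0. z \<in> \<Gamma>" unfolding g0_def using A1 m(2)[OF w(2)] by (subst AE_density) auto
  qed
  then have "(\<integral>\<^sup>+x. q x \<partial>Xm g1) = (\<integral>\<^sup>+x. q x \<partial>Xm g0)" by simp
  moreover have r: "(\<lambda>z :: 'a \<times> 'a. q (fst z)) \<in> borel_measurable borel" using q by measurable
  ultimately show ?thesis
    unfolding nn_integral_Xm[OF gs(1) q] nn_integral_Xm[OF gs(2) q] gI[OF r] by simp
qed

end

text \<open>Where \<open>a + b = 0\<close> the quotient is \<open>0 * inverse 0\<close>, which is 0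
  in \<open>ennreal\<close>, so both claims persist there.\<close>

lemma relative_excess:
  fixes a b :: ennreal
  assumes "a < \<top>" "b < \<top>"
  shows "(a - b) / (a + b) \<le> 1" and "(a - b) / (a + b) * (a + b) = a - b"
proof -
  have "a - b \<le> a + b" by (meson diff_le_self_ennreal add_increasing2 order_refl zero_le)
  then show "(a - b) / (a + b) \<le> 1"
    using assms divide_right_mono_ennreal[of "a - b" "a + b" "a + b"]
    by (cases "a + b = 0") (auto simp: ennreal_divide_self)
  show "(a - b) / (a + b) * (a + b) = a - b"
  proof (cases "a + b = 0")
    case False
    then show ?thesis using assms
      by (metis ennreal_add_less_top ennreal_times_divide mult.commute mult_divide_eq_ennreal less_irrefl)
  qed simp
qed

text \<open>By the two resolvent equations both sides equal
  \<open>f * g * m * ennreal (1/4)\<close>. The damping 1/2 is what relates the share 1/8 of the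
  transported parts to the share 1/4 of the excesses.\<close>

lemma resolvent_balance:
  fixes F G f g f' g' m :: ennreal
  assumes "f = F + f' * ennreal (1/2)" "g = G + g' * ennreal (1/2)"
  shows "f * g' * m * ennreal (1/8) + f * G * m * ennreal (1/4) = g * f' * m * ennreal (1/8) + g * F * m * ennreal (1/4)"
proof -
  have e8: "ennreal (1/8) = ennreal (1/2) * ennreal (1/4)" by (subst ennreal_mult'[symmetric]) simp_all
  have "f * g' * m * ennreal (1/8) + f * G * m * ennreal (1/4) = f * (G + g' * ennreal (1/2)) * m * ennreal (1/4)"
    unfolding e8 by (simp only: distrib_left distrib_right ac_simps)
  also have "\<dots> = g * (F + f' * ennreal (1/2)) * m * ennreal (1/4)"
    unfolding assms[symmetric] by (simp only: ac_simps)
  also have "\<dots> = g * f' * m * ennreal (1/8) + g * F * m * ennreal (1/4)"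
    unfolding e8 by (simp only: distrib_left distrib_right ac_simps)
  finally show ?thesis .
qed

lemma mult_two_two_le: "x \<le> 2 \<Longrightarrow> y \<le> 2 \<Longrightarrow> x * y \<le> (4::ennreal)"
  using mult_mono[of x 2 y 2] by simp

context smooth_cost
begin

text \<open>Everything used about the minimizers is gathered in \<open>V\<close>; energies no longer
  appear, and the claim concerns two plans and their densities.\<close>

theorem plan_contraction:
  fixes a0 a1 s0 s1 :: "'a \<Rightarrow> ennreal"
  assumes m [measurable]: "a0 \<in> borel_measurable borel" "a1 \<in> borel_measurable borel" "s0 \<in> borel_measurable borel" "s1 \<in> borel_measurable borel"
    and afin: "\<And>x. a0 x < \<top>" "\<And>x. a1 x < \<top>" and sfin: "\<And>x. s0 x < \<top>" "\<And>x. s1 x < \<top>"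
    and K: "compact K" "\<And>x. x \<notin> K \<Longrightarrow> a0 x = 0" "\<And>x. x \<notin> K \<Longrightarrow> a1 x = 0" "\<And>x. x \<notin> K \<Longrightarrow> s0 x = 0" "\<And>x. x \<notin> K \<Longrightarrow> s1 x = 0"
    and p: "coupling (density lborel a0) (density lborel s0) p0" "coupling (density lborel a1) (density lborel s1) p1"
    and fin: "(\<integral>\<^sup>+x. a0 x \<partial>lborel) < \<infinity>" "(\<integral>\<^sup>+x. a1 x \<partial>lborel) < \<infinity>" "cost c p0 < \<infinity>" "cost c p1 < \<infinity>"
    and V: "\<And>S r0 r1. S \<in> sets borel \<Longrightarrow> coupling (density lborel (\<lambda>x. if x \<in> S then a1 x else a0 x)) (density lborel s0) r0 \<Longrightarrow>
        coupling (density lborel (\<lambda>x. if x \<in> S then a0 x else a1 x)) (density lborel s1) r1 \<Longrightarrow> cost c p0 + cost c p1 \<le> cost c r0 + cost c r1"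
  shows "(\<integral>\<^sup>+x. a1 x - a0 x \<partial>lborel) \<le> (\<integral>\<^sup>+x. s1 x - s0 x \<partial>lborel)"
proof -
  have ps: "sets p0 = sets borel" "sets p1 = sets borel" and X: "Xm p0 = density lborel a0" "Xm p1 = density lborel a1"
    and Y: "Ym p0 = density lborel s0" "Ym p1 = density lborel s1" using p by (auto simp: coupling_def)
  have mp: "r \<in> borel_measurable borel \<Longrightarrow> r \<in> borel_measurable p0" "r \<in> borel_measurable borel \<Longrightarrow> r \<in> borel_measurable p1"
    for r :: "'a \<times> 'a \<Rightarrow> ennreal"
    using sets_eq_borel_measurableI[OF ps(1)] sets_eq_borel_measurableI[OF ps(2)] by blast+
  have ms: "emeasure p0 UNIV = (\<integral>\<^sup>+x. a0 x \<partial>lborel)" "emeasure p1 UNIV = (\<integral>\<^sup>+x. a1 x \<partial>lborel)"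
    "emeasure p0 UNIV = (\<integral>\<^sup>+x. s0 x \<partial>lborel)" "emeasure p1 UNIV = (\<integral>\<^sup>+x. s1 x \<partial>lborel)"
    using coupling_mass[OF p(1)] coupling_mass[OF p(2)] by (simp_all add: emeasure_density)
  have pf: "emeasure p0 UNIV < \<infinity>" "emeasure p1 UNIV < \<infinity>" using fin ms by simp_all
  have Kb: "K \<in> sets borel" using K(1) by (intro borel_closed compact_imp_closed)
  have nK: "emeasure (density lborel r) (- K) = 0" if "\<And>x. x \<notin> K \<Longrightarrow> r x = 0" "r \<in> borel_measurable borel" for r
    using that Kb by (intro emeasure_density_eq_0) (auto intro: borel_comp)
  \<comment> \<open>The sum of both densities dominates either first marginal, so transported
    densities relative to it stay bounded, and relative to it the excesses have densities
    \<open>F\<close> and \<open>G\<close> of at most 1.\<close>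
  define ma where "ma x = a0 x + a1 x" for x
  define F where "F x = (a1 x - a0 x) / ma x" for x
  define G where "G x = (a0 x - a1 x) / ma x" for x
  have [measurable]: "ma \<in> borel_measurable borel" "F \<in> borel_measurable borel" "G \<in> borel_measurable borel"
    unfolding ma_def F_def G_def by measurable
  have FG1: "F x \<le> 1" "G x \<le> 1" and Fm: "F x * ma x = a1 x - a0 x" and Gm: "G x * ma x = a0 x - a1 x" for x
    using relative_excess[OF afin(1)[of x] afin(2)[of x]] relative_excess[OF afin(2)[of x] afin(1)[of x]]
    by (simp_all add: F_def G_def ma_def add.commute)
  define \<mu> where "\<mu> = density lborel ma"
  define \<nu> where "\<nu> = density lborel (\<lambda>x. s0 x + s1 x)"
  have \<mu>s: "sets \<mu> = sets borel" "sets \<nu> = sets borel" by (simp_all add: \<mu>_def \<nu>_def)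
  have \<mu>f: "emeasure \<mu> UNIV < \<infinity>" "emeasure \<nu> UNIV < \<infinity>"
    using pf ms by (simp_all add: \<mu>_def \<nu>_def ma_def emeasure_density nn_integral_add)
  have \<mu>le: "emeasure (Xm p0) A \<le> emeasure \<mu> A" "emeasure (Xm p1) A \<le> emeasure \<mu> A"
    "emeasure (Ym p0) A \<le> emeasure \<nu> A" "emeasure (Ym p1) A \<le> emeasure \<nu> A" if "A \<in> sets borel" for A
    using that unfolding X Y \<mu>_def \<nu>_def ma_def
    by (auto simp: emeasure_density intro!: nn_integral_mono mult_right_mono)
  obtain f u f' where fm [measurable]: "f \<in> borel_measurable borel" "u \<in> borel_measurable borel" "f' \<in> borel_measurable borel"
    and f2: "\<And>x. f x \<le> 2" "\<And>y. u y \<le> 2" and feq: "\<And>x. f x = F x + f' x * ennreal (1/2)"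
    and fI: "\<And>q. q \<in> borel_measurable borel \<Longrightarrow> (\<integral>\<^sup>+z. f (fst z) * q (snd z) \<partial>p1) = (\<integral>\<^sup>+y. u y * q y \<partial>\<nu>)"
      "\<And>q. q \<in> borel_measurable borel \<Longrightarrow> (\<integral>\<^sup>+z. u (snd z) * q (fst z) \<partial>p0) = (\<integral>\<^sup>+x. f' x * q x \<partial>\<mu>)"
  proof (rule transport_resolvent[OF ps(1) pf(1) ps(2) pf(2) \<mu>s(1) \<mu>f(1) \<mu>le(1) \<mu>s(2) \<mu>f(2) \<mu>le(4), of F])
    show "F \<in> borel_measurable borel" by measurable
    show "F x \<le> 1" for x by (rule FG1)
  qed (assumption, assumption, rule that)
  obtain g v g' where gm [measurable]: "g \<in> borel_measurable borel" "v \<in> borel_measurable borel" "g' \<in> borel_measurable borel"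
    and g2: "\<And>x. g x \<le> 2" "\<And>y. v y \<le> 2" and geq: "\<And>x. g x = G x + g' x * ennreal (1/2)"
    and gI: "\<And>q. q \<in> borel_measurable borel \<Longrightarrow> (\<integral>\<^sup>+z. g (fst z) * q (snd z) \<partial>p0) = (\<integral>\<^sup>+y. v y * q y \<partial>\<nu>)"
      "\<And>q. q \<in> borel_measurable borel \<Longrightarrow> (\<integral>\<^sup>+z. v (snd z) * q (fst z) \<partial>p1) = (\<integral>\<^sup>+x. g' x * q x \<partial>\<mu>)"
  proof (rule transport_resolvent[OF ps(2) pf(2) ps(1) pf(1) \<mu>s(1) \<mu>f(1) \<mu>le(2) \<mu>s(2) \<mu>f(2) \<mu>le(3), of G])
    show "G \<in> borel_measurable borel" by measurable
    show "G x \<le> 1" for x by (rule FG1)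
  qed (assumption, assumption, rule that)
  \<comment> \<open>The weights are crossed on purpose. Transporting \<open>f\<close> along
    \<open>p1\<close> gives \<open>u\<close>, and \<open>g\<close> along \<open>p0\<close> gives
    \<open>v\<close>, so the second marginals of both pieces have density \<open>u * v\<close> with
    respect to \<nu>.\<close>
  define w1 where "w1 z = f (fst z) * v (snd z)" for z
  define w0 where "w0 z = g (fst z) * u (snd z)" for z
  have wm [measurable]: "w0 \<in> borel_measurable borel" "w1 \<in> borel_measurable borel"
    unfolding w0_def w1_def by measurable
  have w4: "w0 z \<le> 4" "w1 z \<le> 4" for z
    unfolding w0_def w1_def using f2 g2 by (auto intro!: mult_two_two_le)
  \<comment> \<open>Densities of the first marginals of the pieces: \<open>v\<close> sent back along
    \<open>p1\<close> is \<open>g'\<close>, and \<open>u\<close> sent back along \<open>p0\<close>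
    is \<open>f'\<close>.\<close>
  define k1 where "k1 x = f x * g' x * ma x" for x
  define k0 where "k0 x = g x * f' x * ma x" for x
  have km [measurable]: "k0 \<in> borel_measurable borel" "k1 \<in> borel_measurable borel"
    unfolding k0_def k1_def by measurable
  have I\<mu>: "(\<integral>\<^sup>+x. r x \<partial>\<mu>) = (\<integral>\<^sup>+x. ma x * r x \<partial>lborel)" if "r \<in> borel_measurable borel" for r
    unfolding \<mu>_def using that by (subst nn_integral_density) auto
  have W1: "(\<integral>\<^sup>+z. w1 z * q (fst z) \<partial>p1) = (\<integral>\<^sup>+x. k1 x * q x \<partial>lborel)" if [measurable]: "q \<in> borel_measurable borel" for q
  proof -
    have "(\<integral>\<^sup>+z. w1 z * q (fst z) \<partial>p1) = (\<integral>\<^sup>+z. v (snd z) * (f (fst z) * q (fst z)) \<partial>p1)"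
      by (intro nn_integral_cong) (simp only: w1_def ac_simps)
    also have "\<dots> = (\<integral>\<^sup>+x. g' x * (f x * q x) \<partial>\<mu>)" by (rule gI(2)) measurable
    also have "\<dots> = (\<integral>\<^sup>+x. k1 x * q x \<partial>lborel)"
      by (subst I\<mu>, measurable) (intro nn_integral_cong, simp only: k1_def ac_simps)
    finally show ?thesis .
  qed
  have W0: "(\<integral>\<^sup>+z. w0 z * q (fst z) \<partial>p0) = (\<integral>\<^sup>+x. k0 x * q x \<partial>lborel)" if [measurable]: "q \<in> borel_measurable borel" for q
  proof -
    have "(\<integral>\<^sup>+z. w0 z * q (fst z) \<partial>p0) = (\<integral>\<^sup>+z. u (snd z) * (g (fst z) * q (fst z)) \<partial>p0)"
      by (intro nn_integral_cong) (simp only: w0_def ac_simps)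
    also have "\<dots> = (\<integral>\<^sup>+x. f' x * (g x * q x) \<partial>\<mu>)" by (rule fI(2)) measurable
    also have "\<dots> = (\<integral>\<^sup>+x. k0 x * q x \<partial>lborel)"
      by (subst I\<mu>, measurable) (intro nn_integral_cong, simp only: k0_def ac_simps)
    finally show ?thesis .
  qed
  have WY: "(\<integral>\<^sup>+z. w1 z * q (snd z) \<partial>p1) = (\<integral>\<^sup>+z. w0 z * q (snd z) \<partial>p0)" if [measurable]: "q \<in> borel_measurable borel" for q
  proof -
    have "(\<integral>\<^sup>+z. w1 z * q (snd z) \<partial>p1) = (\<integral>\<^sup>+z. f (fst z) * (v (snd z) * q (snd z)) \<partial>p1)"
      by (intro nn_integral_cong) (simp only: w1_def ac_simps)
    also have "\<dots> = (\<integral>\<^sup>+y. u y * (v y * q y) \<partial>\<nu>)" by (rule fI(1)) measurable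
    also have "\<dots> = (\<integral>\<^sup>+y. v y * (u y * q y) \<partial>\<nu>)" by (simp only: ac_simps)
    also have "\<dots> = (\<integral>\<^sup>+z. g (fst z) * (u (snd z) * q (snd z)) \<partial>p0)" by (rule gI(1)[symmetric]) measurable
    also have "\<dots> = (\<integral>\<^sup>+z. w0 z * q (snd z) \<partial>p0)"
      by (intro nn_integral_cong) (simp only: w0_def ac_simps)
    finally show ?thesis .
  qed
  have w_fin: "(\<integral>\<^sup>+z. w0 z \<partial>p0) < \<infinity>" "(\<integral>\<^sup>+z. w1 z \<partial>p1) < \<infinity>"
  proof -
    have "(\<integral>\<^sup>+z. w0 z \<partial>p0) \<le> (\<integral>\<^sup>+z. 4 \<partial>p0)" "(\<integral>\<^sup>+z. w1 z \<partial>p1) \<le> (\<integral>\<^sup>+z. 4 \<partial>p1)"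
      by (intro nn_integral_mono w4)+
    moreover have "(\<integral>\<^sup>+z. 4 \<partial>p0) < \<infinity>" "(\<integral>\<^sup>+z. 4 \<partial>p1) < \<infinity>"
      using pf sets_eq_imp_space_eq[OF ps(1)] sets_eq_imp_space_eq[OF ps(2)] by (simp_all add: ennreal_mult_less_top)
    ultimately show "(\<integral>\<^sup>+z. w0 z \<partial>p0) < \<infinity>" "(\<integral>\<^sup>+z. w1 z \<partial>p1) < \<infinity>" by (meson le_less_trans)+
  qed
  have kfin: "(\<integral>\<^sup>+x. k0 x \<partial>lborel) < \<infinity>" "(\<integral>\<^sup>+x. k1 x \<partial>lborel) < \<infinity>"
    using W0[of "\<lambda>_. 1"] W1[of "\<lambda>_. 1"] w_fin by simp_all
  \<comment> \<open>\<open>b\<close> and \<open>t\<close> are the two excesses multiplied by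
    \<open>g / 4\<close> and \<open>f / 4\<close>. As \<open>f\<close> and \<open>g\<close> are at
    most 2, at most half of each excess moves; the 1/4 is the factor that
    \<open>resolvent_balance\<close> requires.\<close>
  define b where "b x = g x * F x * ma x * ennreal (1/4)" for x
  define t where "t x = f x * G x * ma x * ennreal (1/4)" for x
  have btm [measurable]: "b \<in> borel_measurable borel" "t \<in> borel_measurable borel"
    unfolding b_def t_def by measurable
  have quarter: "h * d * ennreal (1/4) \<le> d" if "h \<le> 2" for h d :: ennreal
  proof -
    have "h * ennreal (1/4) \<le> ennreal 2 * ennreal (1/4)" using that by (intro mult_right_mono) simp_all
    also have "\<dots> = ennreal (1/2)" by (subst ennreal_mult'[symmetric]) simp_all
    also have "\<dots> \<le> ennreal 1" by (rule ennreal_leI) simp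
    finally have "d * (h * ennreal (1/4)) \<le> d * 1" by (intro mult_left_mono) simp_all
    then show ?thesis by (simp add: ac_simps)
  qed
  have bt_le: "b x \<le> a1 x - a0 x" "t x \<le> a0 x - a1 x" for x
    using quarter[OF g2(1)[of x], of "a1 x - a0 x"] quarter[OF f2(1)[of x], of "a0 x - a1 x"]
    unfolding b_def t_def by (simp_all add: mult.assoc[of _ _ "ma x"] Fm Gm)
  have bt_le': "b x \<le> a1 x" "t x \<le> a0 x" for x using bt_le[of x] diff_le_self_ennreal order_trans by blast+
  have bt_fin: "(\<integral>\<^sup>+x. b x \<partial>lborel) < \<infinity>" "(\<integral>\<^sup>+x. t x \<partial>lborel) < \<infinity>"
    using nn_integral_mono[of lborel b a1] nn_integral_mono[of lborel t a0] bt_le' fin(1,2) by (meson le_less_trans)+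
  have bal: "k1 x * ennreal (1/8) + t x = k0 x * ennreal (1/8) + b x" for x
    unfolding k1_def k0_def t_def b_def by (rule resolvent_balance[OF feq geq])
  define a0' where "a0' x = a0 x + b x - t x" for x
  define a1' where "a1' x = a1 x + t x - b x" for x
  have am' [measurable]: "a0' \<in> borel_measurable borel" "a1' \<in> borel_measurable borel"
    unfolding a0'_def a1'_def by measurable
  have aeq: "a0' x + t x = a0 x + b x" "a1' x + b x = a1 x + t x" for x
    unfolding a0'_def a1'_def using bt_le'[of x] by (auto intro!: diff_add_cancel_ennreal intro: add_increasing2)
  define q1 where "q1 = exch p1 w1 p0 w0"
  define q0 where "q0 = exch p0 w0 p1 w1"
  have "Xm q1 = density lborel a1'"
    unfolding q1_def
    by (rule Xm_exch[OF ps(2,1) wm(2,1) w4(2) m(2) am'(2) btm(1,2) km(2,1) X(2) W1 W0 bal aeq(2) kfin(2) bt_fin(1)])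
  moreover have "Ym q1 = density lborel s1"
    unfolding q1_def Y(2)[symmetric] by (rule Ym_exch[OF ps(2,1) wm(2,1) w4(2) pf(2) WY])
  ultimately have c1: "coupling (density lborel a1') (density lborel s1) q1" by (simp add: coupling_def q1_def)
  have "Xm q0 = density lborel a0'"
    unfolding q0_def
    by (rule Xm_exch[OF ps(1,2) wm(1,2) w4(1) m(1) am'(1) btm(2,1) km(1,2) X(1) W0 W1 bal[symmetric] aeq(1) kfin(1) bt_fin(2)])
  moreover have "Ym q0 = density lborel s0"
    unfolding q0_def Y(1)[symmetric] by (rule Ym_exch[OF ps(1,2) wm(1,2) w4(1) pf(1) WY[symmetric]])
  ultimately have c0: "coupling (density lborel a0') (density lborel s0) q0" by (simp add: coupling_def q0_def)
  let ?c = "\<lambda>z. ennreal (c (fst z) (snd z))"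
  have cm: "?c \<in> borel_measurable borel"
    by (rule measurable_compose[OF borel_measurable_continuous_onI[OF c_cont] measurable_ennreal])
  define J0 where "J0 = (\<integral>\<^sup>+z. w0 z * ennreal (1/8) * ?c z \<partial>p0)"
  define J1 where "J1 = (\<integral>\<^sup>+z. w1 z * ennreal (1/8) * ?c z \<partial>p1)"
  have e1: "cost c q1 + J1 = cost c p1 + J0" unfolding cost_def q1_def J0_def J1_def
    by (rule nn_integral_exch_add[OF ps(2,1) wm(2,1) cm w4(2)])
  have e0: "cost c q0 + J0 = cost c p0 + J1" unfolding cost_def q0_def J0_def J1_def
    by (rule nn_integral_exch_add[OF ps(1,2) wm(1,2) cm w4(1)])
  have Jf: "J0 < \<infinity>" "J1 < \<infinity>"
  proof -
    have le: "x \<le> 4 \<Longrightarrow> x * ennreal (1/8) * y \<le> 4 * y" for x y :: ennreal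
      by (intro mult_right_mono order_trans[OF mult_mono[of x 4 "ennreal (1/8)" 1]]) simp_all
    have "J0 \<le> (\<integral>\<^sup>+z. 4 * ?c z \<partial>p0)" "J1 \<le> (\<integral>\<^sup>+z. 4 * ?c z \<partial>p1)"
      unfolding J0_def J1_def by (intro nn_integral_mono le w4)+
    moreover have "(\<integral>\<^sup>+z. 4 * ?c z \<partial>p0) = 4 * cost c p0" "(\<integral>\<^sup>+z. 4 * ?c z \<partial>p1) = 4 * cost c p1"
      unfolding cost_def by (rule nn_integral_cmult; rule mp; rule cm)+
    moreover have "4 * cost c p0 < \<infinity>" "4 * cost c p1 < \<infinity>" using fin by (simp_all add: ennreal_mult_less_top)
    ultimately show "J0 < \<infinity>" "J1 < \<infinity>" by (metis le_less_trans)+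
  qed
  \<comment> \<open>What one plan gives away the other receives, at unchanged pairs of
    points.\<close>
  have sum: "cost c q0 + cost c q1 = cost c p0 + cost c p1"
  proof -
    have "(J0 + J1) + (cost c q0 + cost c q1) = (cost c q0 + J0) + (cost c q1 + J1)" by (simp only: ac_simps)
    also have "\<dots> = (J0 + J1) + (cost c p0 + cost c p1)" unfolding e0 e1 by (simp only: ac_simps)
    finally show ?thesis using Jf unfolding ennreal_add_left_cancel by auto
  qed
  have qf: "cost c q0 < \<infinity>" "cost c q1 < \<infinity>" using sum fin(3,4) by (auto simp: less_top[symmetric]) (metis add_top top_add ennreal_add_eq_top)+
  \<comment> \<open>By \<open>relaxed_exchange\<close> no coupling of these marginals beats the
    total cost that \<open>q0\<close> and \<open>q1\<close> attain. Keeping \<open>q0\<close> and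
    replacing \<open>q1\<close> by a competitor gives optimality of \<open>q1\<close> alone.\<close>
  have opt1: "optimal c q1"
    unfolding optimal_def
  proof (intro conjI allI impI)
    fix r1 assume "coupling (Xm q1) (Ym q1) r1"
    then have r1: "coupling (density lborel a1') (density lborel s1) r1" using c1 by (simp add: coupling_def)
    have "cost c p0 + cost c p1 \<le> cost c q0 + cost c r1"
      by (rule relaxed_exchange[OF m(1,2) afin fin(1,2) K(1-3) nK[OF K(4) m(3)] nK[OF K(5) m(4)] c_cont c_nonneg V btm bt_le am' aeq c0 r1])
    then have "cost c q0 + cost c q1 \<le> cost c q0 + cost c r1" using sum by simp
    then show "cost c q1 \<le> cost c r1" using qf(1) unfolding ennreal_add_left_cancel_le by auto
  qed (simp add: q1_def)
  have a1'K: "a1' x = 0" if "x \<notin> K" for x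
    using K(2,3)[OF that] bt_le'[of x] by (simp add: a1'_def)
  have q1K: "emeasure q1 (- (K \<times> K)) = 0"
    by (rule coupling_concentrated[OF c1 Kb nK[OF a1'K am'(2)] Kb nK[OF K(5) m(4)]])
  have q1f: "emeasure q1 UNIV < \<infinity>" using coupling_mass(2)[OF c1] ms(4) pf(2) by (simp add: emeasure_density)
  have key: "(\<integral>\<^sup>+x. k1 x * q x \<partial>lborel) = (\<integral>\<^sup>+x. k0 x * q x \<partial>lborel)" if q: "q \<in> borel_measurable borel" for q
    using optimal_exch_marginals_eq[OF ps(2,1) wm(2,1) w4(2,1) pf(2) WY Y(2) m(4) K(1) _ _ _ _ q] q1K q1f opt1 qf(2) W0[OF q] W1[OF q]
    by (simp add: q1_def)
  have fG: "AE x in lborel. f x * G x * ma x = 0"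
  proof -
    \<comment> \<open>On \<open>A\<close> the excess \<open>F\<close> vanishes, so \<open>f\<close>
      is half of \<open>f'\<close> there, and \<open>key\<close> leaves no room for
      \<open>f * G * ma\<close>.\<close>
    define A where "A = {x. G x > 0}"
    have A [measurable]: "A \<in> sets borel" unfolding A_def by measurable
    have iA [measurable]: "(indicator A :: 'a \<Rightarrow> ennreal) \<in> borel_measurable borel" by simp
    have F0: "F x = 0" if "x \<in> A" for x
    proof -
      have "a0 x - a1 x \<noteq> 0" using that by (auto simp: A_def G_def)
      then have "\<not> a0 x \<le> a1 x" using diff_eq_0_of_le_ennreal[of "a0 x" "a1 x"] afin by auto
      then show ?thesis using diff_eq_0_of_le_ennreal[of "a1 x" "a0 x"] afin by (simp add: F_def)
    qed
    let ?h = "ennreal (1/2)"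
    have "(\<integral>\<^sup>+x. k1 x * (?h * indicator A x) \<partial>lborel) + (\<integral>\<^sup>+x. f x * G x * ma x * indicator A x \<partial>lborel)
      = (\<integral>\<^sup>+x. k1 x * (?h * indicator A x) + f x * G x * ma x * indicator A x \<partial>lborel)"
      by (rule nn_integral_add[symmetric]) measurable
    also have "\<dots> = (\<integral>\<^sup>+x. k0 x * (?h * indicator A x) \<partial>lborel)"
    proof (rule nn_integral_cong)
      fix x
      show "k1 x * (?h * indicator A x) + f x * G x * ma x * indicator A x = k0 x * (?h * indicator A x)"
      proof (cases "x \<in> A")
        case True
        have "k1 x * ?h + f x * G x * ma x = f x * (G x + g' x * ?h) * ma x"
          by (simp only: k1_def distrib_left distrib_right ac_simps)
        also have "\<dots> = f x * g x * ma x" by (simp only: geq[symmetric])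
        also have "\<dots> = k0 x * ?h" using feq[of x] F0[OF True] by (simp add: k0_def ac_simps)
        finally show ?thesis using True by simp
      qed simp
    qed
    also have "\<dots> = (\<integral>\<^sup>+x. k1 x * (?h * indicator A x) \<partial>lborel)" by (rule key[symmetric]) measurable
    finally have eq: "(\<integral>\<^sup>+x. k1 x * (?h * indicator A x) \<partial>lborel) + (\<integral>\<^sup>+x. f x * G x * ma x * indicator A x \<partial>lborel)
      = (\<integral>\<^sup>+x. k1 x * (?h * indicator A x) \<partial>lborel) + 0" by simp
    have "(\<integral>\<^sup>+x. k1 x * (?h * indicator A x) \<partial>lborel) \<le> (\<integral>\<^sup>+x. k1 x \<partial>lborel)"
    proof (rule nn_integral_mono)
      fix x :: 'a
      have "?h \<le> ennreal 1" by (rule ennreal_leI) simp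
      then have "?h * indicator A x \<le> 1" by (simp add: indicator_def)
      then show "k1 x * (?h * indicator A x) \<le> k1 x" using mult_left_mono[of "?h * indicator A x" 1 "k1 x"] by simp
    qed
    then have "(\<integral>\<^sup>+x. k1 x * (?h * indicator A x) \<partial>lborel) < \<infinity>" using kfin(2) by (rule le_less_trans)
    then have "(\<integral>\<^sup>+x. f x * G x * ma x * indicator A x \<partial>lborel) = 0" using eq unfolding ennreal_add_left_cancel by auto
    then have "AE x in lborel. f x * G x * ma x * indicator A x = 0"
      by (subst (asm) nn_integral_0_iff_AE) measurable
    then show ?thesis
    proof eventually_elim
      case (elim x) then show ?case by (cases "x \<in> A") (auto simp: A_def)
    qed
  qed
  define S where "S = {x. f x > 0}"
  define H where "H = {y. u y > 0}"
  have SH [measurable]: "S \<in> sets borel" "H \<in> sets borel" unfolding S_def H_def by measurable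
  have iS [measurable]: "(indicator S :: 'a \<Rightarrow> ennreal) \<in> borel_measurable borel" "(indicator H :: 'a \<Rightarrow> ennreal) \<in> borel_measurable borel"
      "(indicator (- S) :: 'a \<Rightarrow> ennreal) \<in> borel_measurable borel" "(indicator (- H) :: 'a \<Rightarrow> ennreal) \<in> borel_measurable borel"
    using SH by (auto intro!: borel_measurable_indicator borel_comp)
  have "(\<integral>\<^sup>+z. f (fst z) * indicator (- H) (snd z) \<partial>p1) = (\<integral>\<^sup>+y. u y * indicator (- H) y \<partial>\<nu>)" by (rule fI(1)[OF iS(4)])
  also have "\<dots> = (\<integral>\<^sup>+y. 0 \<partial>\<nu>)" by (intro nn_integral_cong) (auto simp: H_def indicator_def)
  finally have I1: "(\<integral>\<^sup>+z. f (fst z) * indicator (- H) (snd z) \<partial>p1) = 0" by simp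
  have "(\<lambda>z. f (fst z) * indicator (- H) (snd z)) \<in> borel_measurable borel"
    by (intro borel_measurable_times_ennreal measurable_compose[OF fst_borel fm(1)] measurable_compose[OF snd_borel iS(4)])
  from nn_integral_0_iff_AE[OF mp(2)[OF this]] I1 have "AE z in p1. f (fst z) * indicator (- H) (snd z) = 0" by simp
  then have AE1: "AE z in p1. fst z \<in> S \<longrightarrow> snd z \<in> H"
    by eventually_elim (auto simp: S_def indicator_def split: if_splits)
  have "(\<integral>\<^sup>+z. u (snd z) * indicator (- S) (fst z) \<partial>p0) = (\<integral>\<^sup>+x. f' x * indicator (- S) x \<partial>\<mu>)" by (rule fI(2)[OF iS(3)])
  \<comment> \<open>\<open>f\<close> dominates half of \<open>f'\<close>, so \<open>f'\<close>
    vanishes off \<open>S\<close>: what \<open>p0\<close> carries into \<open>H\<close> cannot start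
    outside \<open>S\<close>.\<close>
  also have "\<dots> = (\<integral>\<^sup>+x. 0 \<partial>\<mu>)"
  proof (rule nn_integral_cong)
    fix x show "f' x * indicator (- S) x = 0"
      using feq[of x] by (cases "x \<in> S") (auto simp: S_def)
  qed
  finally have I0: "(\<integral>\<^sup>+z. u (snd z) * indicator (- S) (fst z) \<partial>p0) = 0" by simp
  have "(\<lambda>z. u (snd z) * indicator (- S) (fst z)) \<in> borel_measurable borel"
    by (intro borel_measurable_times_ennreal measurable_compose[OF snd_borel fm(2)] measurable_compose[OF fst_borel iS(3)])
  from nn_integral_0_iff_AE[OF mp(1)[OF this]] I0 have "AE z in p0. u (snd z) * indicator (- S) (fst z) = 0" by simp
  then have AE0: "AE z in p0. snd z \<in> H \<longrightarrow> fst z \<in> S"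
    by eventually_elim (auto simp: H_def indicator_def split: if_splits)
  have eX: "(\<integral>\<^sup>+x. a x * indicator A x \<partial>lborel) = (\<integral>\<^sup>+z. indicator A (fst z) \<partial>r)"
    if "Xm r = density lborel a" "sets r = sets borel" "A \<in> sets borel" "a \<in> borel_measurable borel" for a A and r :: "('a \<times> 'a) measure"
    using emeasure_Xm_nn_integral[OF that(2,3)] that by (simp add: emeasure_density)
  have eY: "(\<integral>\<^sup>+x. a x * indicator A x \<partial>lborel) = (\<integral>\<^sup>+z. indicator A (snd z) \<partial>r)"
    if "Ym r = density lborel a" "sets r = sets borel" "A \<in> sets borel" "a \<in> borel_measurable borel" for a A and r :: "('a \<times> 'a) measure"
    using emeasure_Ym_nn_integral[OF that(2,3)] that by (simp add: emeasure_density)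
  have le1: "(\<integral>\<^sup>+x. a1 x * indicator S x \<partial>lborel) \<le> (\<integral>\<^sup>+x. s1 x * indicator H x \<partial>lborel)"
    unfolding eX[OF X(2) ps(2) SH(1) m(2)] eY[OF Y(2) ps(2) SH(2) m(4)]
    by (rule nn_integral_mono_AE) (use AE1 in \<open>eventually_elim, auto simp: indicator_def\<close>)
  have le0: "(\<integral>\<^sup>+x. s0 x * indicator H x \<partial>lborel) \<le> (\<integral>\<^sup>+x. a0 x * indicator S x \<partial>lborel)"
    unfolding eX[OF X(1) ps(1) SH(1) m(1)] eY[OF Y(1) ps(1) SH(2) m(3)]
    by (rule nn_integral_mono_AE) (use AE0 in \<open>eventually_elim, auto simp: indicator_def\<close>)
  have "(\<integral>\<^sup>+x. a0 x * indicator S x \<partial>lborel) + (\<integral>\<^sup>+x. a1 x - a0 x \<partial>lborel)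
    = (\<integral>\<^sup>+x. a0 x * indicator S x + (a1 x - a0 x) \<partial>lborel)"
    by (rule nn_integral_add[symmetric]) measurable
  \<comment> \<open>On \<open>S\<close> the fact \<open>fG\<close> excludes \<open>a0 > a1\<close>
    almost everywhere. Off \<open>S\<close> the function \<open>F\<close>, which \<open>f\<close>
    dominates, vanishes, so the excess of \<open>a1\<close> lives on \<open>S\<close>.\<close>
  also have "\<dots> = (\<integral>\<^sup>+x. a1 x * indicator S x \<partial>lborel)"
  proof (rule nn_integral_cong_AE)
    show "AE x in lborel. a0 x * indicator S x + (a1 x - a0 x) = a1 x * indicator S x"
      using fG
    proof eventually_elim
      case (elim x)
      show ?case
      proof (cases "x \<in> S")
        case True
        then have "G x * ma x = 0" using elim by (auto simp: S_def)
        then have "a0 x - a1 x = 0" by (simp add: Gm)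
        then have "a0 x \<le> a1 x" by (rule ennreal_minus_eq_0)
        then show ?thesis using True by (simp add: add_diff_inverse_ennreal)
      next
        case False
        then have "F x = 0" using feq[of x] by (auto simp: S_def)
        then have "a1 x - a0 x = 0" using Fm[of x] by simp
        then show ?thesis using False by simp
      qed
    qed
  qed
  also have "\<dots> \<le> (\<integral>\<^sup>+x. s1 x * indicator H x \<partial>lborel)" by (rule le1)
  also have "\<dots> \<le> (\<integral>\<^sup>+x. s0 x * indicator H x + (s1 x - s0 x) \<partial>lborel)"
  proof (rule nn_integral_mono)
    fix x
    have "s1 x \<le> s0 x + (s1 x - s0 x)"
      by (cases "s0 x \<le> s1 x") (auto simp: add_diff_inverse_ennreal intro: add_increasing2)
    then show "s1 x * indicator H x \<le> s0 x * indicator H x + (s1 x - s0 x)" by (simp add: indicator_def)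
  qed
  also have "\<dots> = (\<integral>\<^sup>+x. s0 x * indicator H x \<partial>lborel) + (\<integral>\<^sup>+x. s1 x - s0 x \<partial>lborel)"
    by (rule nn_integral_add) measurable
  also have "\<dots> \<le> (\<integral>\<^sup>+x. a0 x * indicator S x \<partial>lborel) + (\<integral>\<^sup>+x. s1 x - s0 x \<partial>lborel)"
    by (rule add_right_mono[OF le0])
  finally have fin_le: "(\<integral>\<^sup>+x. a0 x * indicator S x \<partial>lborel) + (\<integral>\<^sup>+x. a1 x - a0 x \<partial>lborel)
      \<le> (\<integral>\<^sup>+x. a0 x * indicator S x \<partial>lborel) + (\<integral>\<^sup>+x. s1 x - s0 x \<partial>lborel)" .
  have "(\<integral>\<^sup>+x. a0 x * indicator S x \<partial>lborel) \<le> (\<integral>\<^sup>+x. a0 x \<partial>lborel)"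
    by (intro nn_integral_mono) (simp add: indicator_def)
  then have "(\<integral>\<^sup>+x. a0 x * indicator S x \<partial>lborel) < \<infinity>" using fin(1) by (rule le_less_trans)
  then show ?thesis using fin_le unfolding ennreal_add_left_cancel_le by auto
qed

end

section \<open>Energies and minimizers\<close>

text \<open>The energy density need not be measurable in \<open>x\<close>, so its integral is only a lower integral. That is
  additive over measurable sets, though not in the integrand.\<close>

lemma nn_integral_split_set:
  assumes S: "S \<in> sets M"
  shows "(\<integral>\<^sup>+x. f x \<partial>M) = (\<integral>\<^sup>+x. f x * indicator S x \<partial>M) + (\<integral>\<^sup>+x. f x * indicator (- S) x \<partial>M)"
proof (rule antisym)
  show "(\<integral>\<^sup>+x. f x \<partial>M) \<le> (\<integral>\<^sup>+x. f x * indicator S x \<partial>M) + (\<integral>\<^sup>+x. f x * indicator (- S) x \<partial>M)"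
    unfolding nn_integral_def[of M f]
  proof (rule SUP_least)
    fix g assume "g \<in> {g. simple_function M g \<and> g \<le> f}"
    then have g: "simple_function M g" "\<And>x. g x \<le> f x" by (auto simp: le_fun_def)
    have [measurable]: "g \<in> borel_measurable M" using g(1) by (rule borel_measurable_simple_function)
    have C: "(\<lambda>x. g x * indicator (- S) x) \<in> borel_measurable M"
    proof -
      have "(\<lambda>x. g x * indicator (space M - S) x) \<in> borel_measurable M" using S by measurable
      then show ?thesis by (rule measurable_cong[THEN iffD1, rotated]) (auto simp: indicator_def)
    qed
    have "integral\<^sup>S M g = (\<integral>\<^sup>+x. g x \<partial>M)" by (rule nn_integral_eq_simple_integral[OF g(1), symmetric])
    also have "\<dots> = (\<integral>\<^sup>+x. g x * indicator S x + g x * indicator (- S) x \<partial>M)"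
      by (intro nn_integral_cong) (auto simp: indicator_def)
    also have "\<dots> = (\<integral>\<^sup>+x. g x * indicator S x \<partial>M) + (\<integral>\<^sup>+x. g x * indicator (- S) x \<partial>M)"
      using S C by (intro nn_integral_add) auto
    also have "\<dots> \<le> (\<integral>\<^sup>+x. f x * indicator S x \<partial>M) + (\<integral>\<^sup>+x. f x * indicator (- S) x \<partial>M)"
      using g(2) by (intro add_mono nn_integral_mono mult_right_mono) auto
    finally show "integral\<^sup>S M g \<le> (\<integral>\<^sup>+x. f x * indicator S x \<partial>M) + (\<integral>\<^sup>+x. f x * indicator (- S) x \<partial>M)" .
  qed
  let ?G = "\<lambda>h. {g. simple_function M g \<and> g \<le> h}"
  \<comment> \<open>Addition distributes over suprema of nonempty families only.\<close>
  have ne: "?G h \<noteq> {}" for h :: "'a \<Rightarrow> ennreal"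
  proof -
    have "(\<lambda>_. 0) \<in> ?G h" by (auto simp: le_fun_def)
    then show ?thesis by blast
  qed
  have pair: "integral\<^sup>S M g + integral\<^sup>S M h \<le> (\<integral>\<^sup>+x. f x \<partial>M)"
    if g: "g \<in> ?G (\<lambda>x. f x * indicator S x)" and h: "h \<in> ?G (\<lambda>x. f x * indicator (- S) x)" for g h
  proof -
    have sf: "simple_function M g" "simple_function M h" using g h by auto
    then have "integral\<^sup>S M g + integral\<^sup>S M h = (\<integral>\<^sup>+x. g x + h x \<partial>M)"
      by (subst nn_integral_add) (auto simp: nn_integral_eq_simple_integral intro: borel_measurable_simple_function)
    also have "\<dots> \<le> (\<integral>\<^sup>+x. f x \<partial>M)"
    proof (rule nn_integral_mono)
      fix x
      have "g x + h x \<le> f x * indicator S x + f x * indicator (- S) x"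
        using g h by (intro add_mono) (auto simp: le_fun_def)
      also have "\<dots> = f x" by (simp add: indicator_def)
      finally show "g x + h x \<le> f x" .
    qed
    finally show ?thesis .
  qed
  have "(\<integral>\<^sup>+x. f x * indicator S x \<partial>M) + (\<integral>\<^sup>+x. f x * indicator (- S) x \<partial>M)
    = (SUP g\<in>?G (\<lambda>x. f x * indicator S x). integral\<^sup>S M g + (SUP h\<in>?G (\<lambda>x. f x * indicator (- S) x). integral\<^sup>S M h))"
    unfolding nn_integral_def by (rule ennreal_SUP_add_left[OF ne, symmetric])
  also have "\<dots> = (SUP g\<in>?G (\<lambda>x. f x * indicator S x). SUP h\<in>?G (\<lambda>x. f x * indicator (- S) x). integral\<^sup>S M g + integral\<^sup>S M h)"
    by (simp add: ennreal_SUP_add_right[OF ne])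
  also have "\<dots> \<le> (\<integral>\<^sup>+x. f x \<partial>M)" by (intro SUP_least pair)
  finally show "(\<integral>\<^sup>+x. f x * indicator S x \<partial>M) + (\<integral>\<^sup>+x. f x * indicator (- S) x \<partial>M) \<le> (\<integral>\<^sup>+x. f x \<partial>M)" .
qed

text \<open>Both functions are arbitrary: only the split along \<open>S\<close> enters, never
  additivity in the integrand.\<close>

lemma nn_integral_swap_set:
  assumes S: "S \<in> sets M"
  shows "(\<integral>\<^sup>+x. (if x \<in> S then g x else f x) \<partial>M) + (\<integral>\<^sup>+x. (if x \<in> S then f x else g x) \<partial>M) = (\<integral>\<^sup>+x. f x \<partial>M) + (\<integral>\<^sup>+x. g x \<partial>M)"
proof -
  have i: "(\<integral>\<^sup>+x. (if x \<in> S then p x else q x) * indicator S x \<partial>M) = (\<integral>\<^sup>+x. p x * indicator S x \<partial>M)"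
    "(\<integral>\<^sup>+x. (if x \<in> S then p x else q x) * indicator (- S) x \<partial>M) = (\<integral>\<^sup>+x. q x * indicator (- S) x \<partial>M)" for p q :: "'a \<Rightarrow> ennreal"
    by (intro nn_integral_cong; simp add: indicator_def)+
  show ?thesis
    unfolding nn_integral_split_set[OF S, of "\<lambda>x. if x \<in> S then g x else f x"]
      nn_integral_split_set[OF S, of "\<lambda>x. if x \<in> S then f x else g x"] i
    unfolding nn_integral_split_set[OF S, of f] nn_integral_split_set[OF S, of g] by (simp only: ac_simps)
qed

section \<open>Densities on the domain and their transport cost\<close>

definition dens :: "'a set \<Rightarrow> ('a \<Rightarrow> real) \<Rightarrow> 'a \<Rightarrow> ennreal" where
  "dens \<Omega> \<rho> x = ennreal (indicator \<Omega> x *\<^sub>R \<rho> x)"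

lemma dens_eq: "dens \<Omega> \<rho> x = ennreal (\<rho> x) * indicator \<Omega> x"
  by (simp add: dens_def indicator_def)

lemma dens_finite: "dens \<Omega> \<rho> x < \<top>"
  by (simp add: dens_def)

text \<open>\<open>\<rho>\<close> itself may fail to be Borel off \<Omega>; integrability speaks
  only of its product with the indicator, which is therefore the form used inside
  \<open>dens\<close>.\<close>

lemma dens_measurable:
  "set_integrable lborel \<Omega> \<rho> \<Longrightarrow> dens \<Omega> \<rho> \<in> borel_measurable (borel :: 'a::euclidean_space measure)"
proof -
  assume "set_integrable lborel \<Omega> \<rho>"
  then have "integrable lborel (\<lambda>x. indicator \<Omega> x *\<^sub>R \<rho> x)" by (simp add: set_integrable_def)
  then have "(\<lambda>x. indicator \<Omega> x *\<^sub>R \<rho> x) \<in> borel_measurable lborel" by (rule borel_measurable_integrable)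
  then have "(\<lambda>x. indicator \<Omega> x *\<^sub>R \<rho> x) \<in> borel_measurable borel" by simp
  from measurable_compose[OF this measurable_ennreal] show ?thesis by (simp add: dens_def[abs_def])
qed

lemma dens_integral_finite:
  assumes "set_integrable lborel \<Omega> (\<rho> :: 'a::euclidean_space \<Rightarrow> real)"
  shows "(\<integral>\<^sup>+x. dens \<Omega> \<rho> x \<partial>lborel) < \<infinity>"
proof -
  have I: "integrable lborel (\<lambda>x. indicator \<Omega> x *\<^sub>R \<rho> x)" using assms by (simp add: set_integrable_def)
  have "(\<integral>\<^sup>+x. dens \<Omega> \<rho> x \<partial>lborel) \<le> (\<integral>\<^sup>+x. ennreal (norm (indicator \<Omega> x *\<^sub>R \<rho> x)) \<partial>lborel)"
    unfolding dens_def by (intro nn_integral_mono ennreal_leI) simp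
  also have "\<dots> < \<infinity>" using I by (simp add: integrable_iff_bounded)
  finally show ?thesis .
qed

text \<open>Plans here live on the whole space, whereas \<open>couplings\<close> consists of
  measures on the product of restricted sigma-algebras. A plan with these marginals does not charge
  the complement of \<open>\<Omega> \<times> \<Omega>\<close>, so it can be mapped into the
  subspace.\<close>

lemma transport_cost_le_cost:
  fixes \<Omega> :: "'a::euclidean_space set"
  assumes \<Omega>: "open \<Omega>" "x0 \<in> \<Omega>" and c: "continuous_on UNIV (\<lambda>z. c (fst z) (snd z))"
    and \<rho>: "set_integrable lborel \<Omega> \<rho>" and \<sigma>: "set_integrable lborel \<Omega> \<sigma>"
    and w: "coupling (density lborel (dens \<Omega> \<rho>)) (density lborel (dens \<Omega> \<sigma>)) w"
  shows "transport_cost \<Omega> c \<rho> \<sigma> \<le> cost c w"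
proof -
  note [measurable] = dens_measurable[OF \<rho>] dens_measurable[OF \<sigma>]
  have ws: "sets w = sets borel" using w by (simp add: coupling_def)
  have \<Omega>b [measurable]: "\<Omega> \<in> sets borel" using \<Omega>(1) by simp
  have n\<Omega>: "emeasure (density lborel (dens \<Omega> r)) (- \<Omega>) = 0" if "set_integrable lborel \<Omega> r" for r
    by (rule emeasure_density_eq_0[OF dens_measurable[OF that] borel_comp[OF \<Omega>b]]) (simp add: dens_eq)
  have AE: "AE z in w. z \<in> \<Omega> \<times> \<Omega>"
    by (rule coupling_concentrated_AE[OF w \<Omega>b n\<Omega>[OF \<rho>] \<Omega>b n\<Omega>[OF \<sigma>]])
  let ?R = "restrict_space borel \<Omega>" and ?P = "restrict_space borel \<Omega> \<Otimes>\<^sub>M restrict_space borel \<Omega>"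
  \<comment> \<open>Off the domain lies a null set, where any value will do; \<open>x0\<close> makes
    \<open>h\<close> a map into the space of \<open>?P\<close>.\<close>
  define h where "h z = (if z \<in> \<Omega> \<times> \<Omega> then z else (x0, x0))" for z
  have h1: "(\<lambda>z. if z \<in> \<Omega> \<times> \<Omega> then f z else x0) \<in> borel \<rightarrow>\<^sub>M ?R" if "f = fst \<or> f = snd" for f :: "'a \<times> 'a \<Rightarrow> 'a"
  proof (rule measurable_restrict_space2)
    have "{z. z \<in> \<Omega> \<times> \<Omega>} \<in> sets borel" using Times_borel[OF \<Omega>b \<Omega>b] by simp
    then show "(\<lambda>z. if z \<in> \<Omega> \<times> \<Omega> then f z else x0) \<in> borel_measurable borel"
      using that by (intro measurable_If) auto
  qed (use that \<Omega>(2) in auto)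
  have "(\<lambda>z. (if z \<in> \<Omega> \<times> \<Omega> then fst z else x0, if z \<in> \<Omega> \<times> \<Omega> then snd z else x0)) \<in> borel \<rightarrow>\<^sub>M ?P"
    using h1 by (intro measurable_Pair) auto
  moreover have "(\<lambda>z. (if z \<in> \<Omega> \<times> \<Omega> then fst z else x0, if z \<in> \<Omega> \<times> \<Omega> then snd z else x0)) = h"
    by (auto simp: h_def fun_eq_iff)
  ultimately have hm: "h \<in> borel \<rightarrow>\<^sub>M ?P" by simp
  have hw: "h \<in> w \<rightarrow>\<^sub>M ?P" by (rule sets_eq_borel_measurableI[OF ws hm])
  define \<pi> where "\<pi> = distr w ?P h"
  have E: "emeasure \<pi> B = emeasure w (B' )"
    if "B \<in> sets ?P" "B' \<in> sets borel" "\<And>z. z \<in> \<Omega> \<times> \<Omega> \<Longrightarrow> z \<in> B \<longleftrightarrow> z \<in> B'" for B B'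
  proof -
    have "emeasure \<pi> B = emeasure w (h -` B \<inter> space w)" unfolding \<pi>_def by (rule emeasure_distr[OF hw that(1)])
    also have "\<dots> = emeasure w B'"
    proof (rule emeasure_eq_AE)
      show "AE z in w. z \<in> h -` B \<inter> space w \<longleftrightarrow> z \<in> B'"
        using AE AE_space by eventually_elim (use that(3) in \<open>auto simp: h_def\<close>)
    qed (use that hw ws in \<open>auto intro: measurable_sets\<close>)
    finally show ?thesis .
  qed
  have "\<pi> \<in> couplings \<Omega> \<rho> \<sigma>"
    unfolding couplings_def
  proof (intro CollectI conjI ballI)
    show "sets \<pi> = sets ?P" by (simp add: \<pi>_def)
    fix A assume A: "A \<in> sets ?R"
    then have Ab: "A \<in> sets borel" "A \<subseteq> \<Omega>" using \<Omega>b by (auto simp: sets_restrict_space_iff)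
    have \<Omega>R: "\<Omega> \<in> sets ?R" using \<Omega>b by (simp add: sets_restrict_space_iff)
    have "emeasure \<pi> (A \<times> \<Omega>) = emeasure w (A \<times> UNIV)"
      using A \<Omega>R Ab by (intro E pair_measureI Times_borel) auto
    also have "\<dots> = emeasure (density lborel (dens \<Omega> \<rho>)) A" using w emeasure_Xm[OF ws Ab(1)] by (simp add: coupling_def)
    also have "\<dots> = (\<integral>\<^sup>+x. dens \<Omega> \<rho> x * indicator A x \<partial>lborel)" using Ab by (subst emeasure_density) auto
    also have "\<dots> = (\<integral>\<^sup>+x. ennreal (\<rho> x) * indicator A x \<partial>lborel)"
      using Ab by (intro nn_integral_cong) (auto simp: dens_eq indicator_def)
    finally show "emeasure \<pi> (A \<times> \<Omega>) = (\<integral>\<^sup>+x. ennreal (\<rho> x) * indicator A x \<partial>lborel)" .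
    have "emeasure \<pi> (\<Omega> \<times> A) = emeasure w (UNIV \<times> A)"
      using A \<Omega>R Ab by (intro E pair_measureI Times_borel) auto
    also have "\<dots> = emeasure (density lborel (dens \<Omega> \<sigma>)) A" using w emeasure_Ym[OF ws Ab(1)] by (simp add: coupling_def)
    also have "\<dots> = (\<integral>\<^sup>+x. dens \<Omega> \<sigma> x * indicator A x \<partial>lborel)" using Ab by (subst emeasure_density) auto
    also have "\<dots> = (\<integral>\<^sup>+x. ennreal (\<sigma> x) * indicator A x \<partial>lborel)"
      using Ab by (intro nn_integral_cong) (auto simp: dens_eq indicator_def)
    finally show "emeasure \<pi> (\<Omega> \<times> A) = (\<integral>\<^sup>+x. ennreal (\<sigma> x) * indicator A x \<partial>lborel)" .
  qed
  then have "transport_cost \<Omega> c \<rho> \<sigma> \<le> (\<integral>\<^sup>+z. ennreal (c (fst z) (snd z)) \<partial>\<pi>)"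
    unfolding transport_cost_def by (rule INF_lower)
  also have "\<dots> = (\<integral>\<^sup>+z. ennreal (c (fst (h z)) (snd (h z))) \<partial>w)"
    unfolding \<pi>_def
  proof (rule nn_integral_distr[OF hw])
    have cm: "(\<lambda>z. ennreal (c (fst z) (snd z))) \<in> borel_measurable borel"
      by (rule measurable_compose[OF borel_measurable_continuous_onI[OF c] measurable_ennreal])
    have "(\<lambda>z. (fst z, snd z)) \<in> ?P \<rightarrow>\<^sub>M borel \<Otimes>\<^sub>M borel"
      by (intro measurable_Pair measurable_compose[OF measurable_fst] measurable_compose[OF measurable_snd]) (simp_all add: measurable_restrict_space1)
    then have "(\<lambda>z. z) \<in> ?P \<rightarrow>\<^sub>M borel" by (simp add: borel_prod)
    from measurable_compose[OF this cm] show "(\<lambda>z. ennreal (c (fst z) (snd z))) \<in> borel_measurable (distr w ?P h)" by simp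
  qed
  also have "\<dots> = cost c w"
    unfolding cost_def using AE by (intro nn_integral_cong_AE) (auto elim!: eventually_mono simp: h_def)
  finally show ?thesis .
qed

text \<open>The converse passage: a measure on the subspace is extended by zero, as its image under
  the inclusion.\<close>

lemma couplings_imp_coupling:
  fixes \<Omega> :: "'a::euclidean_space set"
  assumes \<Omega>: "open \<Omega>" and c: "continuous_on UNIV (\<lambda>z. c (fst z) (snd z))"
    and \<rho>: "set_integrable lborel \<Omega> \<rho>" and \<sigma>: "set_integrable lborel \<Omega> \<sigma>"
    and \<pi>: "\<pi> \<in> couplings \<Omega> \<rho> \<sigma>"
  obtains w where "coupling (density lborel (dens \<Omega> \<rho>)) (density lborel (dens \<Omega> \<sigma>)) w"
    "cost c w = (\<integral>\<^sup>+z. ennreal (c (fst z) (snd z)) \<partial>\<pi>)"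
proof -
  note [measurable] = dens_measurable[OF \<rho>] dens_measurable[OF \<sigma>]
  have \<Omega>b [measurable]: "\<Omega> \<in> sets borel" using \<Omega>(1) by simp
  let ?R = "restrict_space borel \<Omega>" and ?P = "restrict_space borel \<Omega> \<Otimes>\<^sub>M restrict_space borel \<Omega>"
  have s: "sets \<pi> = sets ?P" and E: "\<And>A. A \<in> sets ?R \<Longrightarrow> emeasure \<pi> (A \<times> \<Omega>) = (\<integral>\<^sup>+x. ennreal (\<rho> x) * indicator A x \<partial>lborel)"
    "\<And>A. A \<in> sets ?R \<Longrightarrow> emeasure \<pi> (\<Omega> \<times> A) = (\<integral>\<^sup>+x. ennreal (\<sigma> x) * indicator A x \<partial>lborel)"
    using \<pi> by (auto simp: couplings_def)
  have sp: "space \<pi> = \<Omega> \<times> \<Omega>" using sets_eq_imp_space_eq[OF s] by (simp add: space_pair_measure space_restrict_space)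
  have "(\<lambda>z. (fst z, snd z)) \<in> ?P \<rightarrow>\<^sub>M borel \<Otimes>\<^sub>M borel"
    by (intro measurable_Pair measurable_compose[OF measurable_fst] measurable_compose[OF measurable_snd]) (simp_all add: measurable_restrict_space1)
  then have "(\<lambda>z. z) \<in> ?P \<rightarrow>\<^sub>M borel" by (simp add: borel_prod)
  then have id: "(\<lambda>z. z) \<in> \<pi> \<rightarrow>\<^sub>M borel" using s by (simp cong: measurable_cong_sets)
  define w where "w = distr \<pi> borel (\<lambda>z. z)"
  have ws: "sets w = sets borel" by (simp add: w_def)
  have wE: "emeasure w B = emeasure \<pi> (B \<inter> \<Omega> \<times> \<Omega>)" if "B \<in> sets borel" for B
    unfolding w_def using emeasure_distr[OF id that] by (simp add: sp)
  have R: "A \<inter> \<Omega> \<in> sets ?R" if "A \<in> sets borel" for A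
    using that \<Omega>b by (auto simp: sets_restrict_space_iff)
  have "Xm w = density lborel (dens \<Omega> \<rho>)"
  proof (rule measure_eqI)
    fix A assume "A \<in> sets (Xm w)"
    then have A: "A \<in> sets borel" by simp
    have "emeasure (Xm w) A = emeasure \<pi> ((A \<times> UNIV) \<inter> \<Omega> \<times> \<Omega>)"
      unfolding emeasure_Xm[OF ws A] by (rule wE[OF Times_borel[OF A space_in_borel]])
    also have "(A \<times> UNIV) \<inter> \<Omega> \<times> \<Omega> = (A \<inter> \<Omega>) \<times> \<Omega>" by auto
    also have "emeasure \<pi> \<dots> = (\<integral>\<^sup>+x. ennreal (\<rho> x) * indicator (A \<inter> \<Omega>) x \<partial>lborel)" by (rule E(1)[OF R[OF A]])
    also have "\<dots> = (\<integral>\<^sup>+x. dens \<Omega> \<rho> x * indicator A x \<partial>lborel)"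
      by (intro nn_integral_cong) (auto simp: dens_eq indicator_def)
    also have "\<dots> = emeasure (density lborel (dens \<Omega> \<rho>)) A" using A by (subst emeasure_density) auto
    finally show "emeasure (Xm w) A = emeasure (density lborel (dens \<Omega> \<rho>)) A" .
  qed simp
  moreover have "Ym w = density lborel (dens \<Omega> \<sigma>)"
  proof (rule measure_eqI)
    fix A assume "A \<in> sets (Ym w)"
    then have A: "A \<in> sets borel" by simp
    have "emeasure (Ym w) A = emeasure \<pi> ((UNIV \<times> A) \<inter> \<Omega> \<times> \<Omega>)"
      unfolding emeasure_Ym[OF ws A] by (rule wE[OF Times_borel[OF space_in_borel A]])
    also have "(UNIV \<times> A) \<inter> \<Omega> \<times> \<Omega> = \<Omega> \<times> (A \<inter> \<Omega>)" by auto
    also have "emeasure \<pi> \<dots> = (\<integral>\<^sup>+x. ennreal (\<sigma> x) * indicator (A \<inter> \<Omega>) x \<partial>lborel)" by (rule E(2)[OF R[OF A]])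
    also have "\<dots> = (\<integral>\<^sup>+x. dens \<Omega> \<sigma> x * indicator A x \<partial>lborel)"
      by (intro nn_integral_cong) (auto simp: dens_eq indicator_def)
    also have "\<dots> = emeasure (density lborel (dens \<Omega> \<sigma>)) A" using A by (subst emeasure_density) auto
    finally show "emeasure (Ym w) A = emeasure (density lborel (dens \<Omega> \<sigma>)) A" .
  qed simp
  ultimately have "coupling (density lborel (dens \<Omega> \<rho>)) (density lborel (dens \<Omega> \<sigma>)) w" using ws by (simp add: coupling_def)
  moreover have "cost c w = (\<integral>\<^sup>+z. ennreal (c (fst z) (snd z)) \<partial>\<pi>)"
    unfolding cost_def w_def
    by (rule nn_integral_distr[OF id]) (simp add: measurable_compose[OF borel_measurable_continuous_onI[OF c] measurable_ennreal])
  ultimately show ?thesis using that by blast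
qed

section \<open>Energies, swaps and minimizers\<close>

definition energy_pos :: "'a::euclidean_space set \<Rightarrow> (real \<Rightarrow> 'a \<Rightarrow> ereal) \<Rightarrow> ('a \<Rightarrow> real) \<Rightarrow> ennreal" where
  "energy_pos \<Omega> s \<rho> = (\<integral>\<^sup>+x. e2ennreal (max (s (\<rho> x) x) 0) * indicator \<Omega> x \<partial>lborel)"

definition energy_neg :: "'a::euclidean_space set \<Rightarrow> (real \<Rightarrow> 'a \<Rightarrow> ereal) \<Rightarrow> ('a \<Rightarrow> real) \<Rightarrow> ennreal" where
  "energy_neg \<Omega> s \<rho> = (\<integral>\<^sup>+x. e2ennreal (max (- s (\<rho> x) x) 0) * indicator \<Omega> x \<partial>lborel)"

lemma energy_neg_finite:
  fixes \<Omega> :: "'a::euclidean_space set"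
  assumes s: "energy_density_ok \<Omega> s" and \<Omega>: "open \<Omega>" "bounded \<Omega>"
  shows "energy_neg \<Omega> s \<rho> < \<infinity>"
proof -
  have "\<exists>M::real. \<forall>z. \<forall>x\<in>\<Omega>. ereal M \<le> s z x" using s by (simp add: energy_density_ok_def)
  then obtain M :: real where M: "\<And>z x. x \<in> \<Omega> \<Longrightarrow> ereal M \<le> s z x" by blast
  have le: "e2ennreal (max (- s (\<rho> x) x) 0) * indicator \<Omega> x \<le> ennreal (max (- M) 0) * indicator \<Omega> x" for x
  proof (cases "x \<in> \<Omega>")
    case True
    have "- s (\<rho> x) x \<le> ereal (- M)" using M[OF True, of "\<rho> x"] by (metis ereal_minus_le_minus uminus_ereal.simps(1))
    then have "max (- s (\<rho> x) x) 0 \<le> ereal (max (- M) 0)" by (auto simp: max_def zero_ereal_def intro: order_trans)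
    then have "e2ennreal (max (- s (\<rho> x) x) 0) \<le> e2ennreal (ereal (max (- M) 0))" by (rule e2ennreal_mono)
    then have "e2ennreal (max (- s (\<rho> x) x) 0) \<le> ennreal (max (- M) 0)" by (simp only: e2ennreal_ereal)
    then show ?thesis using True by simp
  qed simp
  have "energy_neg \<Omega> s \<rho> \<le> (\<integral>\<^sup>+x. ennreal (max (- M) 0) * indicator \<Omega> x \<partial>lborel)"
    unfolding energy_neg_def by (intro nn_integral_mono le)
  also have "\<dots> = ennreal (max (- M) 0) * emeasure lborel \<Omega>" using \<Omega> by (intro nn_integral_cmult_indicator) simp
  also have "\<dots> < \<infinity>" using emeasure_bounded_finite[OF \<Omega>(2)] by (simp add: ennreal_mult_less_top)
  finally show ?thesis .
qed

text \<open>In \<open>ereal\<close> the difference \<open>\<infinity> - x\<close> is \<infinity> for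
  every \<open>x\<close>, so an infinite positive part makes the energy infinite whatever is
  subtracted.\<close>

lemma energy_pos_finite:
  fixes \<Omega> :: "'a::euclidean_space set"
  assumes "energy_density_ok \<Omega> s" "open \<Omega>" "bounded \<Omega>" and "energy \<Omega> s \<rho> < \<infinity>"
  shows "energy_pos \<Omega> s \<rho> < \<infinity>"
proof (rule ccontr)
  assume "\<not> energy_pos \<Omega> s \<rho> < \<infinity>"
  then have "energy_pos \<Omega> s \<rho> = \<top>" by (simp add: less_top[symmetric])
  then have "energy \<Omega> s \<rho> = \<infinity> - enn2ereal (energy_neg \<Omega> s \<rho>)"
    unfolding energy_def energy_pos_def energy_neg_def by simp
  then show False using assms(4) by simp
qed

lemma energy_real:
  fixes \<Omega> :: "'a::euclidean_space set"
  assumes "energy_pos \<Omega> s \<rho> < \<infinity>" "energy_neg \<Omega> s \<rho> < \<infinity>"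
  shows "energy \<Omega> s \<rho> = ereal (enn2real (energy_pos \<Omega> s \<rho>) - enn2real (energy_neg \<Omega> s \<rho>))"
proof -
  have "enn2ereal x = ereal (enn2real x)" if "x < \<infinity>" for x
    using that by (cases x rule: ennreal_cases) (simp_all add: enn2ereal_ennreal)
  then show ?thesis using assms unfolding energy_def energy_pos_def energy_neg_def by simp
qed

text \<open>\<open>s\<close> is infinite at negative arguments, so negativity on a set of positive
  measure would make \<open>energy_pos\<close> infinite.\<close>

lemma Xset_nonneg:
  fixes \<Omega> :: "'a::euclidean_space set"
  assumes s: "energy_density_ok \<Omega> s" and \<Omega>: "open \<Omega>" "bounded \<Omega>" and \<rho>: "\<rho> \<in> Xset \<Omega> s"
  shows "AE x in lborel. x \<in> \<Omega> \<longrightarrow> 0 \<le> \<rho> x"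
proof -
  have "integrable lborel (\<lambda>x. indicator \<Omega> x *\<^sub>R \<rho> x)" using \<rho> by (simp add: Xset_def set_integrable_def)
  then have [measurable]: "(\<lambda>x. indicator \<Omega> x *\<^sub>R \<rho> x) \<in> borel_measurable borel" by (auto dest: borel_measurable_integrable)
  define A where "A = {x. indicator \<Omega> x *\<^sub>R \<rho> x < 0}"
  have A: "A \<in> sets borel" unfolding A_def by measurable
  have AO: "x \<in> \<Omega> \<and> \<rho> x < 0" if "x \<in> A" for x using that by (cases "x \<in> \<Omega>") (auto simp: A_def)
  have le: "\<top> * indicator A x \<le> e2ennreal (max (s (\<rho> x) x) 0) * indicator \<Omega> x" for x
  proof (cases "x \<in> A")
    case True
    then have "s (\<rho> x) x = \<infinity>" "x \<in> \<Omega>" using AO s by (auto simp: energy_density_ok_def)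
    then show ?thesis by (simp add: e2ennreal_infty)
  qed simp
  have "\<top> * emeasure lborel A = (\<integral>\<^sup>+x. \<top> * indicator A x \<partial>lborel)" using A by (simp add: nn_integral_cmult_indicator)
  also have "\<dots> \<le> energy_pos \<Omega> s \<rho>" unfolding energy_pos_def by (intro nn_integral_mono le)
  also have "\<dots> < \<infinity>" using \<rho> by (intro energy_pos_finite[OF s \<Omega>]) (simp add: Xset_def)
  finally have "emeasure lborel A = 0" by (auto simp: ennreal_mult_less_top)
  then have "A \<in> null_sets lborel" using A by (simp add: null_sets_def)
  from AE_not_in[OF this] show ?thesis by eventually_elim (auto simp: A_def)
qed

text \<open>A swap redistributes the integrals over \<open>S\<close> and over its complement between
  the two functions. Positive and negative parts are treated apart, and their finiteness turns the
  two sums into an identity of real numbers.\<close>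

lemma energy_swap:
  fixes \<Omega> :: "'a::euclidean_space set" and S :: "'a set"
  assumes s: "energy_density_ok \<Omega> s" and \<Omega>: "open \<Omega>" "bounded \<Omega>" and \<rho>: "\<rho>0 \<in> Xset \<Omega> s" "\<rho>1 \<in> Xset \<Omega> s" and S: "S \<in> sets borel"
  defines "r0 \<equiv> \<lambda>x. if x \<in> S then \<rho>1 x else \<rho>0 x" and "r1 \<equiv> \<lambda>x. if x \<in> S then \<rho>0 x else \<rho>1 x"
  shows "r0 \<in> Xset \<Omega> s" "r1 \<in> Xset \<Omega> s" "energy \<Omega> s r0 + energy \<Omega> s r1 = energy \<Omega> s \<rho>0 + energy \<Omega> s \<rho>1"
proof -
  have Sl: "S \<in> sets lborel" using S by simp
  have if1: "q (if x \<in> S then \<rho>1 x else \<rho>0 x) x * i x = (if x \<in> S then q (\<rho>1 x) x * i x else q (\<rho>0 x) x * i x)"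
    "q (if x \<in> S then \<rho>0 x else \<rho>1 x) x * i x = (if x \<in> S then q (\<rho>0 x) x * i x else q (\<rho>1 x) x * i x)"
    for q :: "real \<Rightarrow> 'a \<Rightarrow> ennreal" and i x by simp_all
  have P: "energy_pos \<Omega> s r0 + energy_pos \<Omega> s r1 = energy_pos \<Omega> s \<rho>0 + energy_pos \<Omega> s \<rho>1"
    unfolding energy_pos_def r0_def r1_def
      if1[of "\<lambda>z x. e2ennreal (max (s z x) 0)"] by (rule nn_integral_swap_set[OF Sl])
  have N: "energy_neg \<Omega> s r0 + energy_neg \<Omega> s r1 = energy_neg \<Omega> s \<rho>0 + energy_neg \<Omega> s \<rho>1"
    unfolding energy_neg_def r0_def r1_def
      if1[of "\<lambda>z x. e2ennreal (max (- s z x) 0)"] by (rule nn_integral_swap_set[OF Sl])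
  have nf: "energy_neg \<Omega> s r < \<infinity>" for r by (rule energy_neg_finite[OF s \<Omega>])
  have pf: "energy_pos \<Omega> s \<rho>0 < \<infinity>" "energy_pos \<Omega> s \<rho>1 < \<infinity>"
    using energy_pos_finite[OF s \<Omega>, of \<rho>0] energy_pos_finite[OF s \<Omega>, of \<rho>1] \<rho> by (simp_all add: Xset_def)
  then have "energy_pos \<Omega> s r0 + energy_pos \<Omega> s r1 < \<infinity>" unfolding P by simp
  then have rf: "energy_pos \<Omega> s r0 < \<infinity>" "energy_pos \<Omega> s r1 < \<infinity>" by simp_all
  have E: "energy \<Omega> s r = ereal (enn2real (energy_pos \<Omega> s r) - enn2real (energy_neg \<Omega> s r))" if "energy_pos \<Omega> s r < \<infinity>" for r
    by (rule energy_real[OF that nf])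
  have I: "integrable lborel (\<lambda>x. indicator \<Omega> x *\<^sub>R \<rho>0 x)" "integrable lborel (\<lambda>x. indicator \<Omega> x *\<^sub>R \<rho>1 x)"
    using \<rho> by (auto simp: Xset_def set_integrable_def)
  have mix: "set_integrable lborel \<Omega> (\<lambda>x. if x \<in> S then q x else p x)"
    if "integrable lborel (\<lambda>x. indicator \<Omega> x *\<^sub>R p x)" "integrable lborel (\<lambda>x. indicator \<Omega> x *\<^sub>R q x)" for p q :: "'a \<Rightarrow> real"
  proof -
    have "integrable lborel (\<lambda>x. indicator S x *\<^sub>R (indicator \<Omega> x *\<^sub>R q x) + indicator (- S) x *\<^sub>R (indicator \<Omega> x *\<^sub>R p x))"
      using Bochner_Integration.integrable_add[OF integrable_mult_indicator[OF _ that(2), of S] integrable_mult_indicator[OF _ that(1), of "- S"]] S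
      by simp
    moreover have "(\<lambda>x. indicator S x *\<^sub>R (indicator \<Omega> x *\<^sub>R q x) + indicator (- S) x *\<^sub>R (indicator \<Omega> x *\<^sub>R p x))
        = (\<lambda>x. indicator \<Omega> x *\<^sub>R (if x \<in> S then q x else p x))"
      by (auto simp: indicator_def fun_eq_iff)
    ultimately show ?thesis by (simp add: set_integrable_def)
  qed
  show "r0 \<in> Xset \<Omega> s" "r1 \<in> Xset \<Omega> s"
    using mix I E[OF rf(1)] E[OF rf(2)] by (simp_all add: Xset_def r0_def r1_def)
  have split: "enn2real (x + y) = enn2real x + enn2real y" if "x < \<infinity>" "y < \<infinity>" for x y
    using that by (intro enn2real_plus) simp_all
  have "enn2real (energy_pos \<Omega> s r0) + enn2real (energy_pos \<Omega> s r1) = enn2real (energy_pos \<Omega> s \<rho>0) + enn2real (energy_pos \<Omega> s \<rho>1)"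
    using arg_cong[OF P, of enn2real] unfolding split[OF rf] split[OF pf] .
  moreover have "enn2real (energy_neg \<Omega> s r0) + enn2real (energy_neg \<Omega> s r1) = enn2real (energy_neg \<Omega> s \<rho>0) + enn2real (energy_neg \<Omega> s \<rho>1)"
    using arg_cong[OF N, of enn2real] unfolding split[OF nf nf] .
  ultimately show "energy \<Omega> s r0 + energy \<Omega> s r1 = energy \<Omega> s \<rho>0 + energy \<Omega> s \<rho>1"
    unfolding E[OF rf(1)] E[OF rf(2)] E[OF pf(1)] E[OF pf(2)] by simp
qed

text \<open>Leaving \<sigma> in place costs nothing, so the minimal value is finite; hence a
  coupling of finite cost exists, and with it an optimal one. The last clause speaks of arbitrary
  couplings instead of the transport cost, because competitors are produced as couplings.\<close>

lemma minimizer_optimal_plan: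
  fixes \<Omega> :: "'a::euclidean_space set"
  assumes \<Omega>: "open \<Omega>" "x0 \<in> \<Omega>" "bounded \<Omega>" and s: "energy_density_ok \<Omega> s"
    and c: "continuous_on UNIV (\<lambda>z. c (fst z) (snd z))" "\<And>x y. 0 \<le> c x y" "\<And>x. c x x = 0"
    and \<sigma>: "\<sigma> \<in> Xset \<Omega> s" and pos: "0 < (\<integral>\<^sup>+x. ennreal (\<sigma> x) * indicator \<Omega> x \<partial>lborel)"
    and min: "is_minimizer \<Omega> s c \<sigma> \<rho>"
  obtains p where "coupling (density lborel (dens \<Omega> \<rho>)) (density lborel (dens \<Omega> \<sigma>)) p" "cost c p < \<infinity>"
    "\<And>r w. r \<in> Xset \<Omega> s \<Longrightarrow> coupling (density lborel (dens \<Omega> r)) (density lborel (dens \<Omega> \<sigma>)) w \<Longrightarrow>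
       energy \<Omega> s \<rho> + enn2ereal (cost c p) \<le> energy \<Omega> s r + enn2ereal (cost c w)"
proof -
  have \<rho>: "\<rho> \<in> Xset \<Omega> s" and J: "\<And>r. r \<in> Xset \<Omega> s \<Longrightarrow> Jfun \<Omega> s c \<rho> \<sigma> \<le> Jfun \<Omega> s c r \<sigma>"
    using min by (auto simp: is_minimizer_def)
  have int: "set_integrable lborel \<Omega> \<rho>" "set_integrable lborel \<Omega> \<sigma>" using \<rho> \<sigma> by (auto simp: Xset_def)
  note [measurable] = dens_measurable[OF int(1)] dens_measurable[OF int(2)]
  let ?\<mu> = "\<lambda>r. density lborel (dens \<Omega> r)"
  define d where "d = distr (?\<mu> \<sigma>) borel (\<lambda>x. (x, x))"
  have dm: "(\<lambda>x. (x, x)) \<in> ?\<mu> \<sigma> \<rightarrow>\<^sub>M (borel :: ('a \<times> 'a) measure)"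
    by (rule sets_eq_borel_measurableI) (simp, intro borel_measurable_continuous_onI continuous_intros)
  have "Xm d = ?\<mu> \<sigma>" "Ym d = ?\<mu> \<sigma>"
    unfolding d_def by (subst distr_distr[OF _ dm]; simp add: comp_def fst_borel snd_borel distr_id2)+
  then have d: "coupling (?\<mu> \<sigma>) (?\<mu> \<sigma>) d" by (simp add: coupling_def d_def)
  have cm: "(\<lambda>z. ennreal (c (fst z) (snd z))) \<in> borel_measurable borel"
    by (rule measurable_compose[OF borel_measurable_continuous_onI[OF c(1)] measurable_ennreal])
  have "cost c d = 0"
    unfolding cost_def d_def by (subst nn_integral_distr[OF dm]) (use cm in \<open>simp_all add: c(3)\<close>)
  then have "transport_cost \<Omega> c \<sigma> \<sigma> = 0"
    using transport_cost_le_cost[OF \<Omega>(1,2) c(1) int(2,2) d] by simp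
  then have J0: "Jfun \<Omega> s c \<rho> \<sigma> \<le> energy \<Omega> s \<sigma>" using J[OF \<sigma>] by (simp add: Jfun_def zero_ennreal.rep_eq)
  have E\<rho>: "energy \<Omega> s \<rho> \<noteq> -\<infinity>"
    using energy_real[OF energy_pos_finite[OF s \<Omega>(1,3)] energy_neg_finite[OF s \<Omega>(1,3)], of \<rho>] \<rho> by (simp add: Xset_def)
  have "transport_cost \<Omega> c \<rho> \<sigma> < \<infinity>"
  proof (rule ccontr)
    assume "\<not> transport_cost \<Omega> c \<rho> \<sigma> < \<infinity>"
    then have "transport_cost \<Omega> c \<rho> \<sigma> = \<top>" by (simp add: less_top[symmetric])
    then have "Jfun \<Omega> s c \<rho> \<sigma> = \<infinity>" using E\<rho> by (simp add: Jfun_def)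
    then show False using J0 \<sigma> by (simp add: Xset_def)
  qed
  then obtain \<pi> where \<pi>: "\<pi> \<in> couplings \<Omega> \<rho> \<sigma>" "(\<integral>\<^sup>+z. ennreal (c (fst z) (snd z)) \<partial>\<pi>) < \<infinity>"
    unfolding transport_cost_def by (auto simp: INF_less_iff)
  obtain w0 where w0: "coupling (?\<mu> \<rho>) (?\<mu> \<sigma>) w0" "cost c w0 = (\<integral>\<^sup>+z. ennreal (c (fst z) (snd z)) \<partial>\<pi>)"
    using couplings_imp_coupling[OF \<Omega>(1) c(1) int \<pi>(1)] .
  define m where "m = enn2real (emeasure (?\<mu> \<rho>) UNIV)"
  have "emeasure (?\<mu> \<rho>) UNIV = emeasure (?\<mu> \<sigma>) UNIV" using coupling_mass[OF w0(1)] by simp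
  moreover have "0 < emeasure (?\<mu> \<sigma>) UNIV" using pos by (simp add: emeasure_density dens_eq)
  moreover have "emeasure (?\<mu> \<rho>) UNIV < \<infinity>" using dens_integral_finite[OF int(1)] by (simp add: emeasure_density)
  \<comment> \<open>The positive mass comes from \<sigma>; it is needed since the compactness
    argument normalizes to probability measures.\<close>
  ultimately have m: "emeasure (?\<mu> \<rho>) UNIV = ennreal m" "0 < m" by (simp_all add: m_def enn2real_positive_iff)
  have K: "compact (closure \<Omega>)" using \<Omega>(3) by (simp add: compact_closure)
  have nK: "emeasure (?\<mu> r) (- closure \<Omega>) = 0" if "set_integrable lborel \<Omega> r" for r
    using closure_subset[of \<Omega>] dens_measurable[OF that]
    by (intro emeasure_density_eq_0) (auto simp: dens_eq indicator_def intro: borel_closed)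
  obtain p where p: "coupling (?\<mu> \<rho>) (?\<mu> \<sigma>) p" "\<And>w. coupling (?\<mu> \<rho>) (?\<mu> \<sigma>) w \<Longrightarrow> cost c p \<le> cost c w"
    using optimal_plan_exists[OF w0(1) m K nK[OF int(1)] nK[OF int(2)] c(1,2)] by metis
  have pC: "cost c p \<le> transport_cost \<Omega> c \<rho> \<sigma>"
    unfolding transport_cost_def
  proof (rule INF_greatest)
    fix \<pi>' assume "\<pi>' \<in> couplings \<Omega> \<rho> \<sigma>"
    from couplings_imp_coupling[OF \<Omega>(1) c(1) int this] obtain w where
      "coupling (?\<mu> \<rho>) (?\<mu> \<sigma>) w" "cost c w = (\<integral>\<^sup>+z. ennreal (c (fst z) (snd z)) \<partial>\<pi>')" .
    then show "cost c p \<le> (\<integral>\<^sup>+z. ennreal (c (fst z) (snd z)) \<partial>\<pi>')" using p(2) by metis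
  qed
  show ?thesis
  proof (rule that[OF p(1)])
    show "cost c p < \<infinity>" using p(2)[OF w0(1)] w0(2) \<pi>(2) by simp
    fix r w assume r: "r \<in> Xset \<Omega> s" and w: "coupling (?\<mu> r) (?\<mu> \<sigma>) w"
    have "energy \<Omega> s \<rho> + enn2ereal (cost c p) \<le> Jfun \<Omega> s c \<rho> \<sigma>"
      unfolding Jfun_def using pC by (intro add_left_mono) (simp add: less_eq_ennreal.rep_eq)
    also have "\<dots> \<le> Jfun \<Omega> s c r \<sigma>" by (rule J[OF r])
    also have "\<dots> \<le> energy \<Omega> s r + enn2ereal (cost c w)"
      unfolding Jfun_def using transport_cost_le_cost[OF \<Omega>(1,2) c(1) _ int(2) w] r
      by (intro add_left_mono) (simp add: less_eq_ennreal.rep_eq Xset_def)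
    finally show "energy \<Omega> s \<rho> + enn2ereal (cost c p) \<le> energy \<Omega> s r + enn2ereal (cost c w)" .
  qed
qed

text \<open>\<open>dens\<close> clips negative values. Over a nonnegative subtrahend a negative
  minuend gives 0 on both sides, but a negative subtrahend could spoil the identity; hence the
  condition on \<open>\<rho>0\<close>.\<close>

lemma nn_integral_dens_diff:
  fixes \<Omega> :: "'a::euclidean_space set"
  assumes int: "set_integrable lborel \<Omega> \<rho>0" "set_integrable lborel \<Omega> \<rho>1" and nn: "AE x in lborel. x \<in> \<Omega> \<longrightarrow> 0 \<le> \<rho>0 x"
  shows "(\<integral>\<^sup>+x. dens \<Omega> \<rho>1 x - dens \<Omega> \<rho>0 x \<partial>lborel) = ennreal (LINT x:\<Omega>|lborel. max (\<rho>1 x - \<rho>0 x) 0)"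
proof -
  have "integrable lborel (\<lambda>x. max (indicator \<Omega> x *\<^sub>R \<rho>1 x - indicator \<Omega> x *\<^sub>R \<rho>0 x) 0)"
    using int unfolding set_integrable_def by (intro integrable_max Bochner_Integration.integrable_diff) auto
  moreover have "(\<lambda>x. max (indicator \<Omega> x *\<^sub>R \<rho>1 x - indicator \<Omega> x *\<^sub>R \<rho>0 x) 0) = (\<lambda>x. indicator \<Omega> x *\<^sub>R max (\<rho>1 x - \<rho>0 x) 0)"
    by (auto simp: indicator_def fun_eq_iff)
  ultimately have I: "integrable lborel (\<lambda>x. indicator \<Omega> x *\<^sub>R max (\<rho>1 x - \<rho>0 x) 0)" by simp
  have "(\<integral>\<^sup>+x. dens \<Omega> \<rho>1 x - dens \<Omega> \<rho>0 x \<partial>lborel) = (\<integral>\<^sup>+x. ennreal (indicator \<Omega> x *\<^sub>R max (\<rho>1 x - \<rho>0 x) 0) \<partial>lborel)"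
  proof (rule nn_integral_cong_AE)
    show "AE x in lborel. dens \<Omega> \<rho>1 x - dens \<Omega> \<rho>0 x = ennreal (indicator \<Omega> x *\<^sub>R max (\<rho>1 x - \<rho>0 x) 0)"
      using nn
    proof eventually_elim
      case (elim x)
      then show ?case by (cases "x \<in> \<Omega>") (simp_all add: dens_def ennreal_minus max_def ennreal_neg)
    qed
  qed
  also have "\<dots> = ennreal (LINT x:\<Omega>|lborel. max (\<rho>1 x - \<rho>0 x) 0)"
    unfolding set_lebesgue_integral_def by (rule nn_integral_eq_integral[OF I]) simp
  finally show ?thesis .
qed

theorem theorem4p4:
  fixes \<Omega> :: "'a::euclidean_space set"
    and s :: "real \<Rightarrow> 'a \<Rightarrow> ereal"
    and c :: "'a \<Rightarrow> 'a \<Rightarrow> real"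
    and \<rho>0 \<rho>1 \<rho>0s \<rho>1s :: "'a \<Rightarrow> real"
  assumes "smooth_bounded_domain \<Omega>"
    and "energy_density_ok \<Omega> s"
    and "cost_ok c"
    and "\<rho>0 \<in> Xset \<Omega> s" and "\<rho>1 \<in> Xset \<Omega> s"
    and "condN \<Omega> s \<rho>0" and "condN \<Omega> s \<rho>1"
    and "is_minimizer \<Omega> s c \<rho>0 \<rho>0s"
    and "is_minimizer \<Omega> s c \<rho>1 \<rho>1s"
  shows "(LINT x:\<Omega>|lborel. max (\<rho>1s x - \<rho>0s x) 0) \<le> (LINT x:\<Omega>|lborel. max (\<rho>1 x - \<rho>0 x) 0)"
proof -
  have \<Omega>: "open \<Omega>" "bounded \<Omega>" and "\<Omega> \<noteq> {}" using assms(1) by (auto simp: smooth_bounded_domain_def)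
  then obtain x0 where x0: "x0 \<in> \<Omega>" by blast
  note s = assms(2)
  obtain D where "smooth_cost c D" using assms(3) unfolding cost_ok_def smooth_cost_def by metis
  then interpret smooth_cost c D .
  have c0: "c x x = 0" for x using assms(3) by (simp add: cost_ok_def)
  have X: "\<rho>0s \<in> Xset \<Omega> s" "\<rho>1s \<in> Xset \<Omega> s" using assms(8,9) by (auto simp: is_minimizer_def)
  have int: "set_integrable lborel \<Omega> \<rho>0" "set_integrable lborel \<Omega> \<rho>1" "set_integrable lborel \<Omega> \<rho>0s" "set_integrable lborel \<Omega> \<rho>1s"
    using X assms(4,5) by (auto simp: Xset_def)
  let ?\<mu> = "\<lambda>r. density lborel (dens \<Omega> r)"
  obtain p0 where p0: "coupling (?\<mu> \<rho>0s) (?\<mu> \<rho>0) p0" "cost c p0 < \<infinity>"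
    "\<And>r w. r \<in> Xset \<Omega> s \<Longrightarrow> coupling (?\<mu> r) (?\<mu> \<rho>0) w \<Longrightarrow>
       energy \<Omega> s \<rho>0s + enn2ereal (cost c p0) \<le> energy \<Omega> s r + enn2ereal (cost c w)"
  proof (rule minimizer_optimal_plan[OF \<Omega>(1) x0 \<Omega>(2) s c_cont c_nonneg c0 assms(4) _ assms(8)])
    show "0 < (\<integral>\<^sup>+x. ennreal (\<rho>0 x) * indicator \<Omega> x \<partial>lborel)" using assms(6) by (simp add: condN_def)
  qed (rule that)
  obtain p1 where p1: "coupling (?\<mu> \<rho>1s) (?\<mu> \<rho>1) p1" "cost c p1 < \<infinity>"
    "\<And>r w. r \<in> Xset \<Omega> s \<Longrightarrow> coupling (?\<mu> r) (?\<mu> \<rho>1) w \<Longrightarrow>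
       energy \<Omega> s \<rho>1s + enn2ereal (cost c p1) \<le> energy \<Omega> s r + enn2ereal (cost c w)"
  proof (rule minimizer_optimal_plan[OF \<Omega>(1) x0 \<Omega>(2) s c_cont c_nonneg c0 assms(5) _ assms(9)])
    show "0 < (\<integral>\<^sup>+x. ennreal (\<rho>1 x) * indicator \<Omega> x \<partial>lborel)" using assms(7) by (simp add: condN_def)
  qed (rule that)
  have K: "compact (closure \<Omega>)" using \<Omega>(2) by (simp add: compact_closure)
  have dK: "dens \<Omega> r x = 0" if "x \<notin> closure \<Omega>" for r x
    using that closure_subset[of \<Omega>] by (auto simp: dens_eq indicator_def)
  \<comment> \<open>Each minimizer is tested against its swapped density with the given plan. The
    energies are real numbers with the same total before and after the swap, so adding the two
    inequalities leaves only the costs.\<close>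
  have V: "cost c p0 + cost c p1 \<le> cost c w0 + cost c w1"
    if S: "S \<in> sets borel" and w0: "coupling (density lborel (\<lambda>x. if x \<in> S then dens \<Omega> \<rho>1s x else dens \<Omega> \<rho>0s x)) (?\<mu> \<rho>0) w0"
      and w1: "coupling (density lborel (\<lambda>x. if x \<in> S then dens \<Omega> \<rho>0s x else dens \<Omega> \<rho>1s x)) (?\<mu> \<rho>1) w1" for S w0 w1
  proof -
    let ?r0 = "\<lambda>x. if x \<in> S then \<rho>1s x else \<rho>0s x" and ?r1 = "\<lambda>x. if x \<in> S then \<rho>0s x else \<rho>1s x"
    note sw = energy_swap[OF s \<Omega> X S]
    have d: "(\<lambda>x. if x \<in> S then dens \<Omega> \<rho>1s x else dens \<Omega> \<rho>0s x) = dens \<Omega> ?r0"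
      "(\<lambda>x. if x \<in> S then dens \<Omega> \<rho>0s x else dens \<Omega> \<rho>1s x) = dens \<Omega> ?r1" by (auto simp: dens_def fun_eq_iff)
    have E: "\<exists>e. energy \<Omega> s r = ereal e" if "r \<in> Xset \<Omega> s" for r
      using energy_real[OF energy_pos_finite[OF s \<Omega>] energy_neg_finite[OF s \<Omega>], of r] that by (auto simp: Xset_def)
    obtain e0 e1 f0 f1 where e: "energy \<Omega> s \<rho>0s = ereal e0" "energy \<Omega> s \<rho>1s = ereal e1" "energy \<Omega> s ?r0 = ereal f0" "energy \<Omega> s ?r1 = ereal f1"
      using E[OF X(1)] E[OF X(2)] E[OF sw(1)] E[OF sw(2)] by blast
    have le: "ereal e0 + enn2ereal (cost c p0) \<le> ereal f0 + enn2ereal (cost c w0)" "ereal e1 + enn2ereal (cost c p1) \<le> ereal f1 + enn2ereal (cost c w1)"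
      using p0(3)[OF sw(1) w0[unfolded d(1)]] p1(3)[OF sw(2) w1[unfolded d(2)]] unfolding e .
    have eq: "f0 + f1 = e0 + e1" using sw(3) unfolding e by simp
    show ?thesis
    proof (cases "cost c w0 = \<top> \<or> cost c w1 = \<top>")
      case True then show ?thesis by auto
    next
      case False
      then obtain b0 b1 where b: "cost c w0 = ennreal b0" "0 \<le> b0" "cost c w1 = ennreal b1" "0 \<le> b1"
        by (metis ennreal_cases)
      obtain a0 a1 where a: "cost c p0 = ennreal a0" "0 \<le> a0" "cost c p1 = ennreal a1" "0 \<le> a1"
        using p0(2) p1(2) by (metis ennreal_cases infinity_ennreal_def less_irrefl)
      have "e0 + a0 \<le> f0 + b0" "e1 + a1 \<le> f1 + b1" using le a b by (simp_all add: enn2ereal_ennreal)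
      then have "a0 + a1 \<le> b0 + b1" using eq by linarith
      then show ?thesis using a b by (simp add: ennreal_plus[symmetric] ennreal_leI del: ennreal_plus)
    qed
  qed
  have "(\<integral>\<^sup>+x. dens \<Omega> \<rho>1s x - dens \<Omega> \<rho>0s x \<partial>lborel) \<le> (\<integral>\<^sup>+x. dens \<Omega> \<rho>1 x - dens \<Omega> \<rho>0 x \<partial>lborel)"
    by (rule plan_contraction[OF dens_measurable[OF int(3)] dens_measurable[OF int(4)] dens_measurable[OF int(1)] dens_measurable[OF int(2)]
      dens_finite dens_finite dens_finite dens_finite K dK dK dK dK p0(1) p1(1) dens_integral_finite[OF int(3)] dens_integral_finite[OF int(4)]
      p0(2) p1(2) V])
  then have "ennreal (LINT x:\<Omega>|lborel. max (\<rho>1s x - \<rho>0s x) 0) \<le> ennreal (LINT x:\<Omega>|lborel. max (\<rho>1 x - \<rho>0 x) 0)"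
    unfolding nn_integral_dens_diff[OF int(3,4) Xset_nonneg[OF s \<Omega> X(1)]] nn_integral_dens_diff[OF int(1,2) Xset_nonneg[OF s \<Omega> assms(4)]] .
  moreover have "0 \<le> (LINT x:\<Omega>|lborel. max (\<rho>1 x - \<rho>0 x) 0)"
    unfolding set_lebesgue_integral_def by (intro Bochner_Integration.integral_nonneg) simp
  ultimately show ?thesis by (simp add: ennreal_le_iff)
qed

end
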